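(* Let $\varphi\in H^\infty(\mathbb{T})$ and let $M_\varphi:H^2(\mathbb{T})\to H^2(\mathbb{T})$ be the multiplication operator $M_\varphi f=\varphi f$. The following statements are equivalent. (i) $\varphi$ is a finite Blaschke product (of degree $d\ge 1$). (ii) $M_\varphi$ admits an orthonormal basis of finitely many orbits, i.e. there exists a finite family $\{f_i\}_{i=1}^m\subseteq H^2(\mathbb{T})$ such that $\{M_\varphi^n f_i\}_{1\le i\le m,\,n\ge 0}$ is an orthonormal basis of $H^2(\mathbb{T})$. (iii) $M_\varphi$ admits a Parseval frame of finitely many orbits, i.e. there exists a finite family $\{f_i\}_{i=1}^m\subseteq H^2(\mathbb{T})$ such that $\{M_\varphi^n f_i\}_{1\le i\le m,\,n\ge 0}$ is a Parseval frame for $H^2(\mathbb{T})$. (iv) $M_\varphi$ admits a frame of finitely many orbits, i.e. there exists a finite family $\{f_i\}_{i=1}^m\subseteq H^2(\mathbb{T})$ such that $\{M_\varphi^n f_i\}_{1\le i\le m,\,n\ge 0}$ is a frame for $H^2(\mathbb{T})$.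
   Context: $\mathbb{T}=\{\zeta\in\mathbb{C}:|\zeta|=1\}$ carries normalized Lebesgue measure $d\zeta$, and $\mathbb{D}$ is the open unit disc. $H^2(\mathbb{T})$ is the closed subspace of $L^2(\mathbb{T})$ of functions $f$ whose Fourier coefficients $\widehat f(k)=\int_{\mathbb{T}} f(\zeta)\zeta^{-k}\,d\zeta$ vanish for all integers $k<0$, and $H^\infty(\mathbb{T})=L^\infty(\mathbb{T})\cap H^2(\mathbb{T})$. A finite Blaschke product of degree $d\ge 1$ is a function of the form $\zeta\mapsto c\prod_{j=1}^d\frac{\zeta-a_j}{1-\overline{a_j}\zeta}$ with $|c|=1$ and $a_1,\dots,a_d\in\mathbb{D}$ (repetitions allowed); equality of $\varphi$ with such a function is understood almost everywhere on $\mathbb{T}$. A countable family $\{x_j\}_{j\in\Omega}$ in a Hilbert space $\mathcal{H}$ is a frame for $\mathcal{H}$ if there are constants $A,B>0$ with $A\|y\|^2\le\sum_{j\in\Omega}|\langle y,x_j\rangle|^2\le B\|y\|^2$ for all $y\in\mathcal{H}$; it is a Parseval frame if one can take $A=B=1$. *)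

theory Defs
  imports "HOL-Analysis.Analysis"
begin

text \<open>
  Elements of the Lebesgue spaces on the unit circle are represented by Borel functions of type
  \<^typ>\<open>complex \<Rightarrow> complex\<close>, with equality almost everywhere with respect to the measure below;
  its space is the circle, so values off the circle play no role.
\<close>

definition circle_measure :: "complex measure" where
  "circle_measure =
     distr (uniform_measure lborel {0..<2 * pi}) (restrict_space borel (sphere 0 1)) cis"

lemma measurable_cis_circle [measurable]:
  "cis \<in> borel \<rightarrow>\<^sub>M restrict_space borel (sphere 0 1)"
  by (intro measurable_restrict_space2 borel_measurable_continuous_onI)
     (auto intro!: continuous_intros)

lemma space_circle_measure [simp]: "space circle_measure = sphere 0 1"
  by (simp add: circle_measure_def space_restrict_space)

lemma emeasure_circle_measure: "emeasure circle_measure (sphere 0 1) = 1"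
proof -
  have m: "cis \<in> uniform_measure lborel {0..<2 * pi} \<rightarrow>\<^sub>M restrict_space borel (sphere 0 1)"
    by simp
  have "sphere 0 1 \<in> sets (restrict_space borel (sphere (0::complex) 1))"
    by (simp add: sets_restrict_space_iff)
  moreover have "cis -` sphere 0 1 = (UNIV :: real set)"
    by auto
  ultimately have "emeasure circle_measure (sphere 0 1)
      = emeasure (uniform_measure lborel {0..<2 * pi}) UNIV"
    unfolding circle_measure_def by (simp add: emeasure_distr[OF m])
  also have "\<dots> = 1"
    by (simp add: emeasure_uniform_measure ennreal_divide_self)
  finally show ?thesis .
qed

definition L2_circle :: "(complex \<Rightarrow> complex) set" where
  "L2_circle = {f \<in> borel_measurable circle_measure.
     integrable circle_measure (\<lambda>\<zeta>. (cmod (f \<zeta>))\<^sup>2)}"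

definition Linf_circle :: "(complex \<Rightarrow> complex) set" where
  "Linf_circle = {f \<in> borel_measurable circle_measure.
     \<exists>C. AE \<zeta> in circle_measure. cmod (f \<zeta>) \<le> C}"

definition fourier_coeff :: "(complex \<Rightarrow> complex) \<Rightarrow> int \<Rightarrow> complex" where
  "fourier_coeff f k = (LINT \<zeta>|circle_measure. f \<zeta> * \<zeta> powi (- k))"

definition H2 :: "(complex \<Rightarrow> complex) set" where
  "H2 = {f \<in> L2_circle. \<forall>k<0. fourier_coeff f k = 0}"

definition Hinf :: "(complex \<Rightarrow> complex) set" where
  "Hinf = Linf_circle \<inter> H2"

definition L2_inner :: "(complex \<Rightarrow> complex) \<Rightarrow> (complex \<Rightarrow> complex) \<Rightarrow> complex" where
  "L2_inner f g = (LINT \<zeta>|circle_measure. f \<zeta> * cnj (g \<zeta>))"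

definition L2_norm :: "(complex \<Rightarrow> complex) \<Rightarrow> real" where
  "L2_norm f = sqrt (LINT \<zeta>|circle_measure. (cmod (f \<zeta>))\<^sup>2)"

definition mult_op :: "(complex \<Rightarrow> complex) \<Rightarrow> (complex \<Rightarrow> complex) \<Rightarrow> (complex \<Rightarrow> complex)" where
  "mult_op \<phi> f = (\<lambda>\<zeta>. \<phi> \<zeta> * f \<zeta>)"

definition finite_blaschke_product :: "(complex \<Rightarrow> complex) \<Rightarrow> bool" where
  "finite_blaschke_product \<phi> \<longleftrightarrow>
     (\<exists>(d::nat) c a. d \<ge> 1 \<and> cmod c = 1 \<and> (\<forall>j\<in>{1..d}. a j \<in> ball 0 1) \<and>
        (AE \<zeta> in circle_measure. \<phi> \<zeta> = c * (\<Prod>j=1..d. (\<zeta> - a j) / (1 - cnj (a j) * \<zeta>))))"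

text \<open>
  The last conjunct says that the finite linear combinations of the family are dense in H2.
\<close>

definition orthonormal_basis_H2 :: "'j set \<Rightarrow> ('j \<Rightarrow> complex \<Rightarrow> complex) \<Rightarrow> bool" where
  "orthonormal_basis_H2 \<Omega> x \<longleftrightarrow>
     (\<forall>j\<in>\<Omega>. x j \<in> H2) \<and>
     (\<forall>i\<in>\<Omega>. \<forall>j\<in>\<Omega>. L2_inner (x i) (x j) = (if i = j then 1 else 0)) \<and>
     (\<forall>y\<in>H2. \<forall>\<epsilon>>0. \<exists>F c. finite F \<and> F \<subseteq> \<Omega> \<and>
        L2_norm (\<lambda>\<zeta>. y \<zeta> - (\<Sum>j\<in>F. c j * x j \<zeta>)) < \<epsilon>)"

text \<open>
  Summability is stated separately because \<^const>\<open>infsum\<close> is 0 on families that are not summable.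
\<close>

definition frame_bounds_H2 ::
    "real \<Rightarrow> real \<Rightarrow> 'j set \<Rightarrow> ('j \<Rightarrow> complex \<Rightarrow> complex) \<Rightarrow> bool" where
  "frame_bounds_H2 A B \<Omega> x \<longleftrightarrow>
     countable \<Omega> \<and> (\<forall>j\<in>\<Omega>. x j \<in> H2) \<and>
     (\<forall>y\<in>H2.
        (\<lambda>j. (cmod (L2_inner y (x j)))\<^sup>2) summable_on \<Omega> \<and>
        A * (L2_norm y)\<^sup>2 \<le> (\<Sum>\<^sub>\<infinity>j\<in>\<Omega>. (cmod (L2_inner y (x j)))\<^sup>2) \<and>
        (\<Sum>\<^sub>\<infinity>j\<in>\<Omega>. (cmod (L2_inner y (x j)))\<^sup>2) \<le> B * (L2_norm y)\<^sup>2)"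

definition frame_H2 :: "'j set \<Rightarrow> ('j \<Rightarrow> complex \<Rightarrow> complex) \<Rightarrow> bool" where
  "frame_H2 \<Omega> x \<longleftrightarrow> (\<exists>A>0. \<exists>B>0. frame_bounds_H2 A B \<Omega> x)"

definition parseval_frame_H2 :: "'j set \<Rightarrow> ('j \<Rightarrow> complex \<Rightarrow> complex) \<Rightarrow> bool" where
  "parseval_frame_H2 \<Omega> x \<longleftrightarrow> frame_bounds_H2 1 1 \<Omega> x"

end

theory Submission
  imports Defs "HOL-Complex_Analysis.Conformal_Mappings" "HOL-Computational_Algebra.Polynomial"
begin

text \<open>
  An orthonormal basis is a Parseval frame and a Parseval frame is a frame, so two implications carry
  the proof.

  \<^bold>\<open>A finite Blaschke product has an orthonormal basis of orbits.\<close>  Such a \<open>\<phi>\<close> acts isometrically, and the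
  orbits of an orthonormal basis of \<open>H2 \<ominus> \<phi> H2\<close> are orthonormal.  That space is finite-dimensional: one
  Blaschke factor at \<open>a\<close> splits off exactly the multiples of the Szego kernel
  (\<open>blaschke_factor_split\<close>), and stacking the factors gives the Takenaka--Malmquist vectors
  (\<open>blaschke_product_wandering_basis\<close>).  Dividing \<open>N\<close> times by \<open>\<phi>\<close> leaves a remainder \<open>\<phi> ^ N * z\<close> with \<open>z\<close>
  bounded; since \<open>\<bar>\<phi>(0)\<bar> < 1\<close>, each of its Fourier coefficients tends to zero
  (\<open>fourier_coeff_power_mult_tendsto_0\<close>), and as the remainder is an orthogonal projection of a fixed
  function this forces its norm to zero (\<open>wandering_basis_orbits\<close>).

  \<^bold>\<open>A frame of orbits forces a finite Blaschke product.\<close>  Multiplication by \<open>\<zeta> ^ K\<close> with large \<open>K\<close> brings every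
  \<open>L\<^sup>2\<close> function close to the Hardy space, so both frame bounds may be tested on \<open>L\<^sup>2\<close> functions
  (\<open>frame_bessel_L2\<close>, \<open>frame_lower_bound_L2\<close>).  Testing on \<open>cnj \<phi> ^ N\<close> times an indicator shows
  \<open>\<bar>\<phi>\<bar> \<le> 1\<close>, because the powers of \<open>\<phi>\<close> stay bounded.  Testing on \<open>\<zeta> ^ K\<close> times the indicator of a set where
  \<open>\<bar>\<phi>\<bar> \<le> r < 1\<close> shows that this set is null: late orbit members are small there, and the finitely many early
  ones become orthogonal to it by Riemann--Lebesgue (\<open>orbit_frame_ge_1\<close>).  So \<open>\<phi>\<close> is inner.

  For inner \<open>\<phi>\<close> an element of \<open>H2 \<ominus> \<phi> H2\<close> orthogonal to the \<open>m\<close> generators is orthogonal to the frame, hence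
  zero; so \<open>m + 1\<close> backward shifts of \<open>\<phi>\<close>, all of which lie in that space, are linearly dependent, and
  \<open>\<phi>\<close> is a quotient of polynomials (\<open>orbit_frame_rational\<close>).  In lowest terms its denominator has no
  zero in the closed disc, and removing the zeros of the numerator inside the disc as Blaschke factors leaves a
  constant by the maximum principle (\<open>rational_inner_blaschke\<close>).  The degree is not zero, because the
  orbits of a unimodular constant repeat the same vectors up to phase (\<open>orbit_frame_not_constant\<close>).
\<close>

section \<open>Square-integrable functions on the circle\<close>

lemma sets_circle_measure [measurable_cong]:
  "sets circle_measure = sets (restrict_space borel (sphere 0 1))"
  by (simp add: circle_measure_def)

lemma finite_measure_circle: "finite_measure circle_measure"
  by (rule finite_measureI) (simp add: emeasure_circle_measure)

interpretation circle: finite_measure circle_measure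
  by (rule finite_measure_circle)

lemma circle_measure_total [simp]: "measure circle_measure (sphere 0 1) = 1"
  by (simp add: measure_def emeasure_circle_measure)

lemma borel_measurable_circle_continuous:
  fixes f :: "complex \<Rightarrow> 'b::topological_space"
  assumes "continuous_on (sphere 0 1) f"
  shows "f \<in> borel_measurable circle_measure"
  using borel_measurable_continuous_on_restrict[OF assms]
  by (simp add: measurable_cong_sets[OF sets_circle_measure refl])

lemma measurable_circle_id [measurable]: "(\<lambda>\<zeta>. \<zeta>) \<in> borel_measurable circle_measure"
  by (intro borel_measurable_circle_continuous continuous_intros)

lemma measurable_circle_power_int [measurable]:
  "(\<lambda>\<zeta>. \<zeta> powi k) \<in> borel_measurable circle_measure"
  by (intro borel_measurable_circle_continuous continuous_intros) auto

lemma AE_circle: "(\<And>\<zeta>. cmod \<zeta> = 1 \<Longrightarrow> P \<zeta>) \<Longrightarrow> AE \<zeta> in circle_measure. P \<zeta>"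
  by (rule AE_I2) (simp add: dist_norm)

lemma circle_integral_cong:
  fixes f g :: "complex \<Rightarrow> 'b::{banach, second_countable_topology}"
  shows "(\<And>\<zeta>. cmod \<zeta> = 1 \<Longrightarrow> f \<zeta> = g \<zeta>) \<Longrightarrow>
    integral\<^sup>L circle_measure f = integral\<^sup>L circle_measure g"
  by (rule Bochner_Integration.integral_cong) (simp_all add: dist_norm)

lemma L2_measurable: "f \<in> L2_circle \<Longrightarrow> f \<in> borel_measurable circle_measure"
  by (simp add: L2_circle_def)

lemma L2_integrable_square: "f \<in> L2_circle \<Longrightarrow> integrable circle_measure (\<lambda>\<zeta>. (cmod (f \<zeta>))\<^sup>2)"
  by (simp add: L2_circle_def)

lemma L2_dominated:
  assumes "f \<in> borel_measurable circle_measure" "integrable circle_measure g"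
    "AE \<zeta> in circle_measure. (cmod (f \<zeta>))\<^sup>2 \<le> g \<zeta>"
  shows "f \<in> L2_circle"
  unfolding L2_circle_def
proof safe
  show "integrable circle_measure (\<lambda>\<zeta>. (cmod (f \<zeta>))\<^sup>2)"
    by (rule Bochner_Integration.integrable_bound[OF assms(2)]) (use assms in \<open>auto elim: eventually_mono\<close>)
qed (use assms in auto)

lemma L2_AE_bounded:
  assumes "f \<in> borel_measurable circle_measure" "AE \<zeta> in circle_measure. cmod (f \<zeta>) \<le> C"
  shows "f \<in> L2_circle"
  by (rule L2_dominated[where g="\<lambda>_. C\<^sup>2"])
     (use assms in \<open>auto elim!: eventually_mono intro!: power_mono\<close>)

lemma L2_continuous:
  assumes "continuous_on (sphere 0 1) f"
  shows "f \<in> L2_circle"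
proof -
  have "compact (f ` sphere 0 1)"
    using assms by (intro compact_continuous_image) auto
  then obtain C where C: "\<And>x. x \<in> f ` sphere 0 1 \<Longrightarrow> norm x \<le> C"
    using compact_imp_bounded[of "f ` sphere 0 1"] unfolding bounded_iff by auto
  show ?thesis
    by (rule L2_AE_bounded[where C=C]) (auto intro!: AE_circle C borel_measurable_circle_continuous assms)
qed

lemma L2_const [simp]: "(\<lambda>\<zeta>. c) \<in> L2_circle"
  by (intro L2_continuous continuous_intros)

lemma L2_power_int [simp]: "(\<lambda>\<zeta>. \<zeta> powi k) \<in> L2_circle"
  by (intro L2_continuous continuous_intros) auto

lemma L2_poly [simp]: "poly p \<in> L2_circle"
  by (intro L2_continuous continuous_intros)

lemma borel_measurable_cnj [measurable (raw)]:
  "f \<in> borel_measurable M \<Longrightarrow> (\<lambda>x. cnj (f x)) \<in> borel_measurable M"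
  by (rule borel_measurable_continuous_on[where f=cnj]) (auto intro: continuous_intros)

lemma L2_cnj: "f \<in> L2_circle \<Longrightarrow> (\<lambda>\<zeta>. cnj (f \<zeta>)) \<in> L2_circle"
  by (auto simp: L2_circle_def)

lemma L2_AE_bounded_mult:
  assumes g: "g \<in> borel_measurable circle_measure" "AE \<zeta> in circle_measure. cmod (g \<zeta>) \<le> C"
    and f: "f \<in> L2_circle"
  shows "(\<lambda>\<zeta>. g \<zeta> * f \<zeta>) \<in> L2_circle"
proof (rule L2_dominated[where g="\<lambda>\<zeta>. C\<^sup>2 * (cmod (f \<zeta>))\<^sup>2"])
  show "AE \<zeta> in circle_measure. (cmod (g \<zeta> * f \<zeta>))\<^sup>2 \<le> C\<^sup>2 * (cmod (f \<zeta>))\<^sup>2"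
    using g(2) by eventually_elim
      (auto simp: norm_mult power_mult_distrib intro!: mult_right_mono power_mono)
qed (use g f L2_measurable L2_integrable_square in auto)

lemma L2_cmult: "f \<in> L2_circle \<Longrightarrow> (\<lambda>\<zeta>. c * f \<zeta>) \<in> L2_circle"
  by (rule L2_AE_bounded_mult[where C="cmod c"]) auto

lemma L2_add:
  assumes "f \<in> L2_circle" "g \<in> L2_circle"
  shows "(\<lambda>\<zeta>. f \<zeta> + g \<zeta>) \<in> L2_circle"
proof (rule L2_dominated[where g="\<lambda>\<zeta>. 2 * (cmod (f \<zeta>))\<^sup>2 + 2 * (cmod (g \<zeta>))\<^sup>2"])
  have "(cmod (a + b))\<^sup>2 \<le> 2 * (cmod a)\<^sup>2 + 2 * (cmod b)\<^sup>2" for a b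
  proof -
    have "(cmod (a + b))\<^sup>2 \<le> (cmod a + cmod b)\<^sup>2"
      by (intro power_mono norm_triangle_ineq) auto
    also have "\<dots> \<le> 2 * (cmod a)\<^sup>2 + 2 * (cmod b)\<^sup>2"
      using zero_le_power2[of "cmod a - cmod b"] by (simp add: power2_eq_square algebra_simps)
    finally show ?thesis .
  qed
  then show "AE \<zeta> in circle_measure.
      (cmod (f \<zeta> + g \<zeta>))\<^sup>2 \<le> 2 * (cmod (f \<zeta>))\<^sup>2 + 2 * (cmod (g \<zeta>))\<^sup>2"
    by auto
qed (use assms L2_measurable L2_integrable_square in auto)

lemma L2_diff: "f \<in> L2_circle \<Longrightarrow> g \<in> L2_circle \<Longrightarrow> (\<lambda>\<zeta>. f \<zeta> - g \<zeta>) \<in> L2_circle"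
  using L2_add[of f "\<lambda>\<zeta>. - 1 * g \<zeta>"] L2_cmult[of g "-1"] by simp

lemma L2_sum: "(\<And>j. j \<in> J \<Longrightarrow> f j \<in> L2_circle) \<Longrightarrow> (\<lambda>\<zeta>. \<Sum>j\<in>J. f j \<zeta>) \<in> L2_circle"
  by (induction J rule: infinite_finite_induct) (auto intro: L2_add)

lemma L2_mult_integrable:
  assumes "f \<in> L2_circle" "g \<in> L2_circle"
  shows "integrable circle_measure (\<lambda>\<zeta>. f \<zeta> * g \<zeta>)"
proof (rule Bochner_Integration.integrable_bound)
  show "integrable circle_measure (\<lambda>\<zeta>. (cmod (f \<zeta>))\<^sup>2 + (cmod (g \<zeta>))\<^sup>2)"
    using assms by (intro Bochner_Integration.integrable_add L2_integrable_square)
  have "cmod a * cmod b \<le> (cmod a)\<^sup>2 + (cmod b)\<^sup>2" for a b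
    using sum_squares_bound[of "cmod a" "cmod b"] mult_nonneg_nonneg[OF norm_ge_zero[of a] norm_ge_zero[of b]]
    by linarith
  then show "AE \<zeta> in circle_measure. norm (f \<zeta> * g \<zeta>) \<le> norm ((cmod (f \<zeta>))\<^sup>2 + (cmod (g \<zeta>))\<^sup>2)"
    by (auto simp: norm_mult)
qed (use assms L2_measurable in auto)

lemma L2_inner_integrable:
  "f \<in> L2_circle \<Longrightarrow> g \<in> L2_circle \<Longrightarrow> integrable circle_measure (\<lambda>\<zeta>. f \<zeta> * cnj (g \<zeta>))"
  by (intro L2_mult_integrable L2_cnj)

lemma L2_inner_cong:
  "(\<And>\<zeta>. cmod \<zeta> = 1 \<Longrightarrow> f \<zeta> * cnj (g \<zeta>) = f' \<zeta> * cnj (g' \<zeta>)) \<Longrightarrow> L2_inner f g = L2_inner f' g'"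
  unfolding L2_inner_def by (rule circle_integral_cong)

lemma L2_inner_cong_AE:
  assumes "AE \<zeta> in circle_measure. f \<zeta> * cnj (g \<zeta>) = f' \<zeta> * cnj (g' \<zeta>)"
    "f \<in> L2_circle" "g \<in> L2_circle" "f' \<in> L2_circle" "g' \<in> L2_circle"
  shows "L2_inner f g = L2_inner f' g'"
  unfolding L2_inner_def
proof (rule integral_cong_AE)
  have [measurable]: "f \<in> borel_measurable circle_measure" "g \<in> borel_measurable circle_measure"
    "f' \<in> borel_measurable circle_measure" "g' \<in> borel_measurable circle_measure"
    using assms L2_measurable by auto
  show "(\<lambda>\<zeta>. f \<zeta> * cnj (g \<zeta>)) \<in> borel_measurable circle_measure" "(\<lambda>\<zeta>. f' \<zeta> * cnj (g' \<zeta>)) \<in> borel_measurable circle_measure"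
    by simp_all
qed (rule assms)

lemma L2_inner_add_left:
  "f \<in> L2_circle \<Longrightarrow> g \<in> L2_circle \<Longrightarrow> h \<in> L2_circle \<Longrightarrow>
    L2_inner (\<lambda>\<zeta>. f \<zeta> + g \<zeta>) h = L2_inner f h + L2_inner g h"
  unfolding L2_inner_def distrib_right
  by (intro Bochner_Integration.integral_add L2_inner_integrable)

lemma L2_inner_diff_left:
  "f \<in> L2_circle \<Longrightarrow> g \<in> L2_circle \<Longrightarrow> h \<in> L2_circle \<Longrightarrow>
    L2_inner (\<lambda>\<zeta>. f \<zeta> - g \<zeta>) h = L2_inner f h - L2_inner g h"
  unfolding L2_inner_def left_diff_distrib
  by (intro Bochner_Integration.integral_diff L2_inner_integrable)

lemma L2_inner_cmult_left: "L2_inner (\<lambda>\<zeta>. c * f \<zeta>) g = c * L2_inner f g"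
  unfolding L2_inner_def by (simp add: mult.assoc)

lemma L2_inner_commute: "L2_inner g f = cnj (L2_inner f g)"
  unfolding L2_inner_def Bochner_Integration.integral_cnj[symmetric] by (simp add: mult.commute)

lemma L2_inner_cmult_right: "L2_inner f (\<lambda>\<zeta>. c * g \<zeta>) = cnj c * L2_inner f g"
  unfolding L2_inner_def by (simp add: mult_ac)

lemma L2_inner_diff_right:
  "f \<in> L2_circle \<Longrightarrow> g \<in> L2_circle \<Longrightarrow> h \<in> L2_circle \<Longrightarrow>
    L2_inner h (\<lambda>\<zeta>. f \<zeta> - g \<zeta>) = L2_inner h f - L2_inner h g"
  by (simp add: L2_inner_commute[of h] L2_inner_diff_left)

lemma L2_inner_sum_left:
  "(\<And>j. j \<in> J \<Longrightarrow> f j \<in> L2_circle) \<Longrightarrow> g \<in> L2_circle \<Longrightarrow>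
    L2_inner (\<lambda>\<zeta>. \<Sum>j\<in>J. f j \<zeta>) g = (\<Sum>j\<in>J. L2_inner (f j) g)"
  unfolding L2_inner_def sum_distrib_right
  by (intro Bochner_Integration.integral_sum L2_inner_integrable)

lemma L2_inner_lincomb_left:
  "(\<And>j. j \<in> J \<Longrightarrow> f j \<in> L2_circle) \<Longrightarrow> g \<in> L2_circle \<Longrightarrow>
    L2_inner (\<lambda>\<zeta>. \<Sum>j\<in>J. c j * f j \<zeta>) g = (\<Sum>j\<in>J. c j * L2_inner (f j) g)"
  by (subst L2_inner_sum_left) (auto simp: L2_inner_cmult_left intro: L2_cmult)

lemma L2_inner_lincomb_right:
  "(\<And>j. j \<in> J \<Longrightarrow> f j \<in> L2_circle) \<Longrightarrow> g \<in> L2_circle \<Longrightarrow>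
    L2_inner g (\<lambda>\<zeta>. \<Sum>j\<in>J. c j * f j \<zeta>) = (\<Sum>j\<in>J. cnj (c j) * L2_inner g (f j))"
  by (simp add: L2_inner_commute[of g] L2_inner_lincomb_left)

lemma L2_norm_nonneg [simp]: "0 \<le> L2_norm f"
  by (simp add: L2_norm_def)

lemma L2_norm_square: "(L2_norm f)\<^sup>2 = (LINT \<zeta>|circle_measure. (cmod (f \<zeta>))\<^sup>2)"
  by (simp add: L2_norm_def)

lemma L2_inner_self: "L2_inner f f = of_real ((L2_norm f)\<^sup>2)"
  unfolding L2_norm_square L2_inner_def
  by (simp flip: complex_norm_square integral_complex_of_real)

lemma L2_norm_cong: "(\<And>\<zeta>. cmod \<zeta> = 1 \<Longrightarrow> cmod (f \<zeta>) = cmod (g \<zeta>)) \<Longrightarrow> L2_norm f = L2_norm g"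
  unfolding L2_norm_def by (intro arg_cong[where f=sqrt] circle_integral_cong) auto

lemma L2_norm_cong_AE:
  assumes "AE \<zeta> in circle_measure. cmod (f \<zeta>) = cmod (g \<zeta>)" "f \<in> L2_circle" "g \<in> L2_circle"
  shows "L2_norm f = L2_norm g"
proof -
  have [measurable]: "f \<in> borel_measurable circle_measure" "g \<in> borel_measurable circle_measure"
    using assms L2_measurable by auto
  show ?thesis
    unfolding L2_norm_def
    by (intro arg_cong[where f=sqrt] integral_cong_AE) (use assms(1) in \<open>auto elim: eventually_mono\<close>)
qed

lemma L2_norm_cmult: "L2_norm (\<lambda>\<zeta>. c * f \<zeta>) = cmod c * L2_norm f"
  by (simp add: L2_norm_def norm_mult power_mult_distrib real_sqrt_mult)

lemma L2_norm_const [simp]: "L2_norm (\<lambda>\<zeta>. c) = cmod c"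
  by (simp add: L2_norm_def)

lemma L2_norm_mono_AE:
  assumes "AE \<zeta> in circle_measure. cmod (f \<zeta>) \<le> C * cmod (g \<zeta>)"
    "f \<in> L2_circle" "g \<in> L2_circle" "0 \<le> C"
  shows "L2_norm f \<le> C * L2_norm g"
proof -
  have "(L2_norm f)\<^sup>2 \<le> (LINT \<zeta>|circle_measure. C\<^sup>2 * (cmod (g \<zeta>))\<^sup>2)"
    unfolding L2_norm_square
  proof (rule integral_mono_AE)
    show "AE \<zeta> in circle_measure. (cmod (f \<zeta>))\<^sup>2 \<le> C\<^sup>2 * (cmod (g \<zeta>))\<^sup>2"
      using assms(1) by eventually_elim (auto simp flip: power_mult_distrib intro!: power_mono)
  qed (use assms L2_integrable_square in auto)
  also have "\<dots> = (C * L2_norm g)\<^sup>2"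
    by (simp add: power_mult_distrib L2_norm_square)
  finally show ?thesis
    by (rule power2_le_imp_le) (use assms in auto)
qed

lemma L2_norm_eq_0_AE:
  assumes "f \<in> L2_circle" "L2_norm f = 0"
  shows "AE \<zeta> in circle_measure. f \<zeta> = 0"
proof -
  have "(LINT \<zeta>|circle_measure. (cmod (f \<zeta>))\<^sup>2) = 0"
    using assms(2) by (simp flip: L2_norm_square)
  then have "AE \<zeta> in circle_measure. (cmod (f \<zeta>))\<^sup>2 = 0"
    using integral_nonneg_eq_0_iff_AE[OF L2_integrable_square[OF assms(1)]] by simp
  then show ?thesis by simp
qed

lemma L2_norm_diff_square:
  assumes "f \<in> L2_circle" "g \<in> L2_circle"
  shows "(L2_norm (\<lambda>\<zeta>. f \<zeta> - g \<zeta>))\<^sup>2 = (L2_norm f)\<^sup>2 - 2 * Re (L2_inner f g) + (L2_norm g)\<^sup>2"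
proof -
  have "complex_of_real ((L2_norm (\<lambda>\<zeta>. f \<zeta> - g \<zeta>))\<^sup>2) =
      L2_inner f f - L2_inner f g - (cnj (L2_inner f g) - L2_inner g g)"
    unfolding L2_inner_self[symmetric] L2_inner_commute[of g f, symmetric]
    using assms by (simp add: L2_inner_diff_left L2_inner_diff_right L2_diff)
  from arg_cong[OF this, of Re] show ?thesis
    by (simp add: L2_inner_self)
qed

lemma L2_Cauchy_Schwarz:
  assumes f: "f \<in> L2_circle" and g: "g \<in> L2_circle"
  shows "cmod (L2_inner f g) \<le> L2_norm f * L2_norm g"
proof (cases "L2_norm g = 0")
  case True
  have "L2_inner f g = L2_inner f (\<lambda>_. 0)"
    by (rule L2_inner_cong_AE) (use L2_norm_eq_0_AE[OF g True] f g in \<open>auto elim: eventually_mono\<close>)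
  then show ?thesis by (simp add: L2_inner_def)
next
  case False
  define a where "a = L2_inner f g"
  define r where "r = (L2_norm g)\<^sup>2"
  have r: "r > 0" using False by (simp add: r_def)
  have "0 \<le> (L2_norm (\<lambda>\<zeta>. f \<zeta> - (a / r) * g \<zeta>))\<^sup>2" by simp
  also have "\<dots> = (L2_norm f)\<^sup>2 - (cmod a)\<^sup>2 / r"
  proof -
    have *: "Re (cnj a * a) = (cmod a)\<^sup>2"
      unfolding cmod_power2 by (simp add: power2_eq_square)
    have "Re (cnj (a / r) * a) = (cmod a)\<^sup>2 / r"
      using * by (simp add: Re_divide_of_real)
    then have "Re (L2_inner f (\<lambda>\<zeta>. (a / r) * g \<zeta>)) = (cmod a)\<^sup>2 / r"
      unfolding L2_inner_cmult_right a_def[symmetric] .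
    moreover have "(L2_norm (\<lambda>\<zeta>. (a / r) * g \<zeta>))\<^sup>2 = (cmod a)\<^sup>2 / r"
      unfolding L2_norm_cmult power_mult_distrib r_def[symmetric]
      using r by (simp add: norm_divide power_divide power2_eq_square)
    ultimately show ?thesis
      unfolding L2_norm_diff_square[OF f L2_cmult[OF g]] by simp
  qed
  finally have "(cmod a)\<^sup>2 \<le> (L2_norm f * L2_norm g)\<^sup>2"
    using r by (simp add: field_simps power_mult_distrib flip: r_def)
  then show ?thesis
    unfolding a_def by (rule power2_le_imp_le) auto
qed

lemma L2_norm_triangle:
  assumes "f \<in> L2_circle" "g \<in> L2_circle"
  shows "L2_norm (\<lambda>\<zeta>. f \<zeta> + g \<zeta>) \<le> L2_norm f + L2_norm g"
proof (rule power2_le_imp_le)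
  have "- Re (L2_inner f (\<lambda>\<zeta>. - 1 * g \<zeta>)) \<le> L2_norm f * L2_norm g"
    unfolding L2_inner_cmult_right
    using order_trans[OF complex_Re_le_cmod L2_Cauchy_Schwarz[OF assms]] by simp
  moreover have "L2_norm (\<lambda>\<zeta>. - 1 * g \<zeta>) = L2_norm g"
    unfolding L2_norm_cmult by simp
  ultimately show "(L2_norm (\<lambda>\<zeta>. f \<zeta> + g \<zeta>))\<^sup>2 \<le> (L2_norm f + L2_norm g)\<^sup>2"
    using L2_norm_diff_square[OF assms(1) L2_cmult[OF assms(2), of "-1"]]
    by (simp add: power2_sum)
qed auto

lemma L2_norm_triangle3:
  assumes "f \<in> L2_circle" "g \<in> L2_circle" "h \<in> L2_circle"
  shows "L2_norm (\<lambda>\<zeta>. f \<zeta> - h \<zeta>) \<le> L2_norm (\<lambda>\<zeta>. f \<zeta> - g \<zeta>) + L2_norm (\<lambda>\<zeta>. g \<zeta> - h \<zeta>)"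
  using L2_norm_triangle[OF L2_diff[OF assms(1,2)] L2_diff[OF assms(2,3)]] by simp

text \<open>
  For \<open>k \<noteq> 0\<close> the antiderivative of \<open>cis (k * x)\<close> is again \<open>2 * pi\<close>-periodic, so its increments over a
  full period vanish.
\<close>

lemma circle_integral_power_int:
  "(LINT \<zeta>|circle_measure. \<zeta> powi k) = (if k = 0 then 1 else 0)"
proof (cases "k = 0")
  case False
  define F :: "real \<Rightarrow> complex" where "F = (\<lambda>x. exp (\<i> * of_int k * of_real x) / (\<i> * of_int k))"
  have m: "cis \<in> uniform_measure lborel {0..<2*pi} \<rightarrow>\<^sub>M restrict_space borel (sphere 0 1)"
    by simp
  have mk: "(\<lambda>\<zeta>::complex. \<zeta> powi k) \<in> borel_measurable (restrict_space borel (sphere 0 1))"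
    using measurable_circle_power_int[of k] by (simp add: measurable_cong_sets[OF sets_circle_measure refl])
  have "(LINT \<zeta>|circle_measure. \<zeta> powi k) = (LINT x|uniform_measure lborel {0..<2*pi}. cis x powi k)"
    unfolding circle_measure_def by (rule integral_distr[OF m mk])
  also have "\<dots> = (LINT x|uniform_measure lborel {0..<2*pi}. cis (of_int k * x))"
    by (simp add: cis_power_int mult.commute)
  also have "\<dots> = (LINT x|lborel. (indicator {0..<2*pi} x / (2*pi)) *\<^sub>R cis (of_int k * x))"
  proof -
    have u: "uniform_measure lborel {0..<2*pi} =
        density lborel (\<lambda>x. ennreal (indicator {0..<2*pi} x / (2*pi)))"
      unfolding uniform_measure_def
      by (intro arg_cong2[where f=density] refl ext) (auto simp: indicator_def divide_ennreal simp flip: ennreal_1)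
    show ?thesis
      unfolding u by (subst integral_density) auto
  qed
  also have "\<dots> = (LINT x|lborel. (1 / (2*pi)) *\<^sub>R (indicator {0..2*pi} x *\<^sub>R cis (of_int k * x)))"
    by (rule integral_cong_AE)
       (auto intro!: eventually_mono[OF AE_lborel_singleton[of "2*pi"]] simp: indicator_def)
  also have "\<dots> = (1 / (2*pi)) *\<^sub>R (LINT x|lborel. indicator {0..2*pi} x *\<^sub>R cis (of_int k * x))"
    by (rule integral_scaleR_right)
  also have "(LINT x|lborel. indicator {0..2*pi} x *\<^sub>R cis (of_int k * x)) = F (2*pi) - F 0"
  proof (rule integral_FTC_Icc)
    fix x
    show "(F has_vector_derivative cis (of_int k * x)) (at x within {0..2*pi})"
      unfolding F_def
    proof (rule has_vector_derivative_real_field)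
      show "((\<lambda>z. exp (\<i> * of_int k * z) / (\<i> * of_int k)) has_field_derivative cis (of_int k * x))
          (at (of_real x))"
        using False by (auto intro!: derivative_eq_intros simp: cis_conv_exp mult_ac)
    qed
  qed (auto intro!: continuous_intros)
  also have "\<dots> = 0"
    using exp_integer_2pi[of "of_int k"] by (simp add: F_def mult_ac)
  finally show ?thesis using False by simp
qed simp

lemma fourier_coeff_eq_inner: "fourier_coeff f k = L2_inner f (\<lambda>\<zeta>. \<zeta> powi k)"
proof -
  have "\<zeta> powi (- k) = cnj (\<zeta> powi k)" if "cmod \<zeta> = 1" for \<zeta>
  proof -
    have "\<zeta> powi k * cnj (\<zeta> powi k) = 1"
      unfolding complex_norm_square[symmetric] using that by (simp add: norm_power_int)
    from inverse_unique[OF this] show ?thesis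
      by (simp add: power_int_minus)
  qed
  then show ?thesis
    unfolding fourier_coeff_def L2_inner_def by (intro circle_integral_cong) simp
qed

section \<open>Density of trigonometric polynomials\<close>

lemma fourier_coeff_cong:
  "(\<And>\<zeta>. cmod \<zeta> = 1 \<Longrightarrow> f \<zeta> = g \<zeta>) \<Longrightarrow> fourier_coeff f k = fourier_coeff g k"
  unfolding fourier_coeff_def by (rule circle_integral_cong) simp

lemma L2_cong:
  assumes "\<And>\<zeta>. cmod \<zeta> = 1 \<Longrightarrow> f \<zeta> = g \<zeta>" "g \<in> L2_circle"
  shows "f \<in> L2_circle"
proof -
  have "f \<in> borel_measurable circle_measure \<longleftrightarrow> g \<in> borel_measurable circle_measure"
    by (rule measurable_cong) (use assms in \<open>simp add: dist_norm\<close>)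
  moreover have "integrable circle_measure (\<lambda>\<zeta>. (cmod (f \<zeta>))\<^sup>2) \<longleftrightarrow> integrable circle_measure (\<lambda>\<zeta>. (cmod (g \<zeta>))\<^sup>2)"
    by (rule Bochner_Integration.integrable_cong) (use assms in \<open>auto simp: dist_norm\<close>)
  ultimately show ?thesis using assms(2) by (auto simp: L2_circle_def)
qed

lemma L2_power_mult:
  assumes "f \<in> L2_circle" shows "(\<lambda>\<zeta>. \<zeta> ^ n * f \<zeta>) \<in> L2_circle"
  by (rule L2_AE_bounded_mult[where C=1]) (auto intro: AE_circle simp: norm_power assms)

lemma L2_poly_mult:
  assumes "f \<in> L2_circle" shows "(\<lambda>\<zeta>. poly p \<zeta> * f \<zeta>) \<in> L2_circle"
proof -
  have "(\<lambda>\<zeta>. \<Sum>i\<le>degree p. coeff p i * (\<zeta> ^ i * f \<zeta>)) \<in> L2_circle"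
    by (intro L2_sum L2_cmult L2_power_mult assms)
  then show ?thesis by (simp add: poly_altdef sum_distrib_right mult.assoc)
qed

lemma L2_norm_power_mult: "L2_norm (\<lambda>\<zeta>. \<zeta> ^ n * f \<zeta>) = L2_norm f"
  by (rule L2_norm_cong) (simp add: norm_mult norm_power)

lemma L2_norm_dominated_convergence:
  assumes s: "\<And>n. s n \<in> L2_circle" and f: "f \<in> L2_circle" and w: "integrable circle_measure w"
    and lim: "\<And>\<zeta>. cmod \<zeta> = 1 \<Longrightarrow> (\<lambda>n. s n \<zeta>) \<longlonglongrightarrow> f \<zeta>"
    and bound: "\<And>n \<zeta>. cmod \<zeta> = 1 \<Longrightarrow> (cmod (f \<zeta> - s n \<zeta>))\<^sup>2 \<le> w \<zeta>"
  shows "(\<lambda>n. L2_norm (\<lambda>\<zeta>. f \<zeta> - s n \<zeta>)) \<longlonglongrightarrow> 0"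
proof -
  have [measurable]: "f \<in> borel_measurable circle_measure" "\<And>n. s n \<in> borel_measurable circle_measure"
    using s f L2_measurable by auto
  have "(\<lambda>n. LINT \<zeta>|circle_measure. (cmod (f \<zeta> - s n \<zeta>))\<^sup>2) \<longlonglongrightarrow> (LINT \<zeta>|circle_measure. 0)"
  proof (rule integral_dominated_convergence[OF _ _ w])
    show "AE \<zeta> in circle_measure. (\<lambda>n. (cmod (f \<zeta> - s n \<zeta>))\<^sup>2) \<longlonglongrightarrow> 0"
    proof (rule AE_circle)
      fix \<zeta> :: complex assume "cmod \<zeta> = 1"
      then have "(\<lambda>n. (cmod (f \<zeta> - s n \<zeta>))\<^sup>2) \<longlonglongrightarrow> (cmod (f \<zeta> - f \<zeta>))\<^sup>2"
        by (intro tendsto_norm tendsto_power tendsto_diff tendsto_const lim)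
      then show "(\<lambda>n. (cmod (f \<zeta> - s n \<zeta>))\<^sup>2) \<longlonglongrightarrow> 0" by simp
    qed
  qed (use bound in \<open>auto intro!: AE_circle\<close>)
  from tendsto_real_sqrt[OF this] show ?thesis
    by (simp add: L2_norm_def)
qed

text \<open>
  A trigonometric polynomial is \<open>\<zeta> ^ (- n)\<close> times an ordinary polynomial; clearing the negative
  power keeps every later computation inside \<^typ>\<open>complex poly\<close>.
\<close>

definition trig_approximable :: "(complex \<Rightarrow> complex) \<Rightarrow> bool" where
  "trig_approximable f \<longleftrightarrow>
     f \<in> L2_circle \<and> (\<forall>\<epsilon>>0. \<exists>n p. L2_norm (\<lambda>\<zeta>. \<zeta> ^ n * f \<zeta> - poly p \<zeta>) < \<epsilon>)"

lemma trig_approximable_cong: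
  assumes "\<And>\<zeta>. cmod \<zeta> = 1 \<Longrightarrow> f \<zeta> = g \<zeta>" "trig_approximable g"
  shows "trig_approximable f"
proof -
  have "L2_norm (\<lambda>\<zeta>. \<zeta> ^ n * f \<zeta> - poly p \<zeta>) = L2_norm (\<lambda>\<zeta>. \<zeta> ^ n * g \<zeta> - poly p \<zeta>)" for n p
    by (rule L2_norm_cong) (simp add: assms)
  then show ?thesis
    using assms(2) L2_cong[OF assms(1)] by (auto simp: trig_approximable_def)
qed

lemma trig_approximable_add:
  assumes f: "trig_approximable f" and g: "trig_approximable g"
  shows "trig_approximable (\<lambda>\<zeta>. f \<zeta> + g \<zeta>)"
  unfolding trig_approximable_def
proof (intro conjI allI impI)
  have L: "f \<in> L2_circle" "g \<in> L2_circle"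
    using f g by (auto simp: trig_approximable_def)
  then show "(\<lambda>\<zeta>. f \<zeta> + g \<zeta>) \<in> L2_circle" by (rule L2_add)
  fix \<epsilon> :: real assume e: "0 < \<epsilon>"
  then obtain n p m q where
    np: "L2_norm (\<lambda>\<zeta>. \<zeta> ^ n * f \<zeta> - poly p \<zeta>) < \<epsilon>/2" and
    mq: "L2_norm (\<lambda>\<zeta>. \<zeta> ^ m * g \<zeta> - poly q \<zeta>) < \<epsilon>/2"
    using f g unfolding trig_approximable_def by (meson half_gt_zero)
  let ?F = "\<lambda>\<zeta>. \<zeta> ^ m * (\<zeta> ^ n * f \<zeta> - poly p \<zeta>)" and ?G = "\<lambda>\<zeta>. \<zeta> ^ n * (\<zeta> ^ m * g \<zeta> - poly q \<zeta>)"
  have "L2_norm (\<lambda>\<zeta>. ?F \<zeta> + ?G \<zeta>) \<le> L2_norm ?F + L2_norm ?G"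
    by (intro L2_norm_triangle L2_power_mult L2_diff L L2_poly)
  also have "\<dots> < \<epsilon>"
    using np mq by (simp add: L2_norm_power_mult)
  finally have "L2_norm (\<lambda>\<zeta>. \<zeta> ^ (m + n) * (f \<zeta> + g \<zeta>) - poly (monom 1 m * p + monom 1 n * q) \<zeta>) < \<epsilon>"
    by (simp add: poly_monom algebra_simps power_add)
  then show "\<exists>n p. L2_norm (\<lambda>\<zeta>. \<zeta> ^ n * (f \<zeta> + g \<zeta>) - poly p \<zeta>) < \<epsilon>" by blast
qed

lemma trig_approximable_poly: "trig_approximable (poly p)"
  unfolding trig_approximable_def
proof (intro conjI allI impI)
  fix \<epsilon> :: real assume "0 < \<epsilon>"
  then have "L2_norm (\<lambda>\<zeta>. \<zeta> ^ 0 * poly p \<zeta> - poly p \<zeta>) < \<epsilon>" by simp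
  then show "\<exists>n q. L2_norm (\<lambda>\<zeta>. \<zeta> ^ n * poly p \<zeta> - poly q \<zeta>) < \<epsilon>" by blast
qed simp

lemma trig_approximable_cmult:
  assumes f: "trig_approximable f"
  shows "trig_approximable (\<lambda>\<zeta>. c * f \<zeta>)"
  unfolding trig_approximable_def
proof (intro conjI allI impI)
  show "(\<lambda>\<zeta>. c * f \<zeta>) \<in> L2_circle"
    using f by (auto simp: trig_approximable_def intro: L2_cmult)
  fix \<epsilon> :: real assume e: "0 < \<epsilon>"
  then have "\<epsilon> / (cmod c + 1) > 0" by (simp add: add_nonneg_pos)
  then obtain n p where np: "L2_norm (\<lambda>\<zeta>. \<zeta> ^ n * f \<zeta> - poly p \<zeta>) < \<epsilon> / (cmod c + 1)"
    using f unfolding trig_approximable_def by blast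
  have "L2_norm (\<lambda>\<zeta>. c * (\<zeta> ^ n * f \<zeta> - poly p \<zeta>)) \<le>
      (cmod c + 1) * L2_norm (\<lambda>\<zeta>. \<zeta> ^ n * f \<zeta> - poly p \<zeta>)"
    unfolding L2_norm_cmult by (intro mult_right_mono) auto
  also have "\<dots> < \<epsilon>"
    using np pos_less_divide_eq[of "cmod c + 1"] by (simp add: mult.commute add_nonneg_pos)
  finally have "L2_norm (\<lambda>\<zeta>. \<zeta> ^ n * (c * f \<zeta>) - poly (smult c p) \<zeta>) < \<epsilon>"
    by (simp add: algebra_simps)
  then show "\<exists>n p. L2_norm (\<lambda>\<zeta>. \<zeta> ^ n * (c * f \<zeta>) - poly p \<zeta>) < \<epsilon>" by blast
qed

lemma trig_approximable_sum:
  "(\<And>j. j \<in> J \<Longrightarrow> trig_approximable (f j)) \<Longrightarrow> trig_approximable (\<lambda>\<zeta>. \<Sum>j\<in>J. f j \<zeta>)"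
  by (induction J rule: infinite_finite_induct)
     (use trig_approximable_poly[of 0] in \<open>auto intro: trig_approximable_add simp: poly_0[abs_def]\<close>)

lemma trig_approximable_closed:
  assumes f: "f \<in> L2_circle"
    and approx: "\<And>\<epsilon>. \<epsilon> > 0 \<Longrightarrow> \<exists>g. trig_approximable g \<and> L2_norm (\<lambda>\<zeta>. f \<zeta> - g \<zeta>) < \<epsilon>"
  shows "trig_approximable f"
  unfolding trig_approximable_def
proof (intro conjI allI impI)
  fix \<epsilon> :: real assume e: "0 < \<epsilon>"
  obtain g where g: "trig_approximable g" "L2_norm (\<lambda>\<zeta>. f \<zeta> - g \<zeta>) < \<epsilon>/2"
    using approx[of "\<epsilon>/2"] e by auto
  then have L: "g \<in> L2_circle" by (simp add: trig_approximable_def)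
  obtain n p where np: "L2_norm (\<lambda>\<zeta>. \<zeta> ^ n * g \<zeta> - poly p \<zeta>) < \<epsilon>/2"
    using g(1) e unfolding trig_approximable_def by (meson half_gt_zero)
  have "L2_norm (\<lambda>\<zeta>. \<zeta> ^ n * f \<zeta> - poly p \<zeta>) \<le>
     L2_norm (\<lambda>\<zeta>. \<zeta> ^ n * f \<zeta> - \<zeta> ^ n * g \<zeta>) + L2_norm (\<lambda>\<zeta>. \<zeta> ^ n * g \<zeta> - poly p \<zeta>)"
    by (intro L2_norm_triangle3 L2_power_mult f L L2_poly)
  also have "L2_norm (\<lambda>\<zeta>. \<zeta> ^ n * f \<zeta> - \<zeta> ^ n * g \<zeta>) = L2_norm (\<lambda>\<zeta>. f \<zeta> - g \<zeta>)"
    using L2_norm_power_mult[of n "\<lambda>\<zeta>. f \<zeta> - g \<zeta>"] by (simp add: right_diff_distrib)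
  finally have "L2_norm (\<lambda>\<zeta>. \<zeta> ^ n * f \<zeta> - poly p \<zeta>) < \<epsilon>" using g(2) np by simp
  then show "\<exists>n p. L2_norm (\<lambda>\<zeta>. \<zeta> ^ n * f \<zeta> - poly p \<zeta>) < \<epsilon>" by blast
qed (rule f)

lemma trig_approximable_limit:
  assumes s: "\<And>n. trig_approximable (s n)" and f: "f \<in> L2_circle" and w: "integrable circle_measure w"
    and lim: "\<And>\<zeta>. cmod \<zeta> = 1 \<Longrightarrow> (\<lambda>n. s n \<zeta>) \<longlonglongrightarrow> f \<zeta>"
    and bound: "\<And>n \<zeta>. cmod \<zeta> = 1 \<Longrightarrow> (cmod (f \<zeta> - s n \<zeta>))\<^sup>2 \<le> w \<zeta>"
  shows "trig_approximable f"
proof (rule trig_approximable_closed[OF f])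
  fix \<epsilon> :: real assume e: "0 < \<epsilon>"
  have "(\<lambda>n. L2_norm (\<lambda>\<zeta>. f \<zeta> - s n \<zeta>)) \<longlonglongrightarrow> 0"
    by (rule L2_norm_dominated_convergence[OF _ f w lim bound])
       (use s in \<open>auto simp: trig_approximable_def\<close>)
  from order_tendstoD(2)[OF this e]
  obtain n where "L2_norm (\<lambda>\<zeta>. f \<zeta> - s n \<zeta>) < \<epsilon>"
    by (auto simp: eventually_sequentially)
  with s show "\<exists>g. trig_approximable g \<and> L2_norm (\<lambda>\<zeta>. f \<zeta> - g \<zeta>) < \<epsilon>" by blast
qed

lemma real_polynomial_function_on_circle:
  assumes "real_polynomial_function h"
  shows "\<exists>n p. \<forall>\<zeta>. cmod \<zeta> = 1 \<longrightarrow> \<zeta> ^ n * of_real (h \<zeta>) = poly p \<zeta>"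
  using assms
proof (induction h rule: real_polynomial_function.induct)
  case (linear f)
  define a b where "a = f 1" "b = f \<i>"
  have "\<zeta> ^ 1 * of_real (f \<zeta>) = poly [:(a + \<i> * b) / 2, 0, (a - \<i> * b) / 2:] \<zeta>" if "cmod \<zeta> = 1" for \<zeta>
  proof -
    have "f \<zeta> = f (Re \<zeta> *\<^sub>R 1 + Im \<zeta> *\<^sub>R \<i>)"
      by (rule arg_cong[where f=f]) (simp add: complex_eq_iff)
    also have "\<dots> = Re \<zeta> * a + Im \<zeta> * b"
      using linear by (simp only: bounded_linear.linear linear_add linear_scale a_b_def) simp
    finally have *: "f \<zeta> = Re \<zeta> * a + Im \<zeta> * b" .
    have c: "\<zeta> * cnj \<zeta> = 1"
      unfolding complex_norm_square[symmetric] using that by simp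
    have "complex_of_real (f \<zeta>) = (\<zeta> + cnj \<zeta>) / 2 * a + (\<zeta> - cnj \<zeta>) * (- \<i> / 2) * b"
      unfolding * by (simp add: complex_eq_iff Re_divide Im_divide power2_eq_square)
    from arg_cong[OF this, of "\<lambda>t. \<zeta> * t"]
    have "\<zeta> * of_real (f \<zeta>) = (\<zeta> * \<zeta> + \<zeta> * cnj \<zeta>) / 2 * a + (\<zeta> * \<zeta> - \<zeta> * cnj \<zeta>) * (- \<i> / 2) * b"
      by (simp add: field_simps)
    then show ?thesis
      unfolding c by (simp add: field_simps)
  qed
  then show ?case by blast
next
  case (const c)
  have "\<zeta> ^ 0 * of_real c = poly [:of_real c:] \<zeta>" for \<zeta> :: complex by simp
  then show ?case by blast
next
  case (add f g)
  obtain n p where n: "\<And>\<zeta>. cmod \<zeta> = 1 \<Longrightarrow> \<zeta> ^ n * of_real (f \<zeta>) = poly p \<zeta>"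
    using add.IH(1) by blast
  obtain m q where m: "\<And>\<zeta>. cmod \<zeta> = 1 \<Longrightarrow> \<zeta> ^ m * of_real (g \<zeta>) = poly q \<zeta>"
    using add.IH(2) by blast
  have "cmod \<zeta> = 1 \<Longrightarrow>
      \<zeta> ^ (n + m) * of_real (f \<zeta> + g \<zeta>) = poly (monom 1 m * p + monom 1 n * q) \<zeta>" for \<zeta>
    by (simp add: poly_monom power_add algebra_simps flip: n m)
  then show ?case by blast
next
  case (mult f g)
  obtain n p where n: "\<And>\<zeta>. cmod \<zeta> = 1 \<Longrightarrow> \<zeta> ^ n * of_real (f \<zeta>) = poly p \<zeta>"
    using mult.IH(1) by blast
  obtain m q where m: "\<And>\<zeta>. cmod \<zeta> = 1 \<Longrightarrow> \<zeta> ^ m * of_real (g \<zeta>) = poly q \<zeta>"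
    using mult.IH(2) by blast
  have "cmod \<zeta> = 1 \<Longrightarrow> \<zeta> ^ (n + m) * of_real (f \<zeta> * g \<zeta>) = poly (p * q) \<zeta>" for \<zeta>
    by (simp add: power_add mult_ac flip: n m)
  then show ?case by blast
qed

text \<open>Stone--Weierstrass; on the circle \<open>cnj \<zeta> = 1 / \<zeta>\<close>, so polynomials in the real and imaginary
  part are trigonometric polynomials.\<close>

lemma trig_approximable_continuous:
  assumes cont: "continuous_on (sphere 0 1) f"
  shows "trig_approximable f"
proof (rule trig_approximable_closed)
  fix \<epsilon> :: real assume e: "0 < \<epsilon>"
  obtain g where g: "polynomial_function g" "\<And>\<zeta>. \<zeta> \<in> sphere 0 1 \<Longrightarrow> norm (f \<zeta> - g \<zeta>) < \<epsilon>/2"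
    using Stone_Weierstrass_polynomial_function[OF _ cont, of "\<epsilon>/2"] e by auto
  have "trig_approximable (\<lambda>\<zeta>. of_real (h (g \<zeta>)))" if h: "bounded_linear h" for h
  proof -
    have "real_polynomial_function (h \<circ> g)"
      using g(1) h unfolding polynomial_function_def by blast
    from real_polynomial_function_on_circle[OF this]
    obtain n p where np: "\<And>\<zeta>. cmod \<zeta> = 1 \<Longrightarrow> \<zeta> ^ n * of_real (h (g \<zeta>)) = poly p \<zeta>"
      unfolding o_def by blast
    have "L2_norm (\<lambda>\<zeta>. \<zeta> ^ n * of_real (h (g \<zeta>)) - poly p \<zeta>) = L2_norm (\<lambda>\<zeta>. 0)"
      by (rule L2_norm_cong) (simp add: np)
    then have "L2_norm (\<lambda>\<zeta>. \<zeta> ^ n * of_real (h (g \<zeta>)) - poly p \<zeta>) = 0" by simp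
    moreover have "(\<lambda>\<zeta>. of_real (h (g \<zeta>))) \<in> L2_circle"
      by (intro L2_continuous continuous_on_of_real bounded_linear.continuous_on[OF h]
          continuous_on_polymonial_function[OF g(1)])
    ultimately show ?thesis
      unfolding trig_approximable_def by metis
  qed
  from this[OF bounded_linear_Re] this[OF bounded_linear_Im]
  have "trig_approximable (\<lambda>\<zeta>. of_real (Re (g \<zeta>)) + \<i> * of_real (Im (g \<zeta>)))"
    by (intro trig_approximable_add trig_approximable_cmult)
  then have G: "trig_approximable g" by (simp flip: complex_eq)
  have "L2_norm (\<lambda>\<zeta>. f \<zeta> - g \<zeta>) \<le> \<epsilon>/2 * L2_norm (\<lambda>\<zeta>. 1)"
    using e G g(2) cont
    by (intro L2_norm_mono_AE L2_diff L2_continuous[OF cont])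
       (auto intro!: AE_circle less_imp_le simp: dist_norm trig_approximable_def)
  also have "\<dots> < \<epsilon>" using e by simp
  finally show "\<exists>g. trig_approximable g \<and> L2_norm (\<lambda>\<zeta>. f \<zeta> - g \<zeta>) < \<epsilon>" using G by blast
qed (rule L2_continuous[OF cont])

lemma L2_indicator:
  assumes "A \<in> sets borel"
  shows "indicator A \<in> L2_circle"
proof (rule L2_AE_bounded[where C=1])
  have "(\<lambda>\<zeta>. indicator A \<zeta> :: complex) \<in> borel_measurable circle_measure"
    using assms by measurable
  then show "(indicator A :: complex \<Rightarrow> complex) \<in> borel_measurable circle_measure" .
qed (auto intro!: AE_circle simp: indicator_def)

text \<open>
  The indicator of a closed set is the pointwise limit of the continuous functions
  \<open>max 0 (1 - n * infdist \<zeta> C)\<close>; closed sets are stable under intersection and generate the Borel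
  sets, and dominated limits pass through complements and disjoint unions.
\<close>

lemma trig_approximable_indicator:
  assumes "A \<in> sets borel"
  shows "trig_approximable (indicator A)"
proof -
  have stable: "Int_stable (Collect closed :: complex set set)"
    by (auto simp: Int_stable_def)
  have gen: "Collect closed \<subseteq> Pow (UNIV :: complex set)" by simp
  have "A \<in> sigma_sets UNIV (Collect closed)"
    using assms by (simp add: borel_eq_closed)
  from stable gen this show ?thesis
  proof (induction rule: sigma_sets_induct_disjoint)
    case (basic C)
    then have C: "closed C" by simp
    show ?case
    proof (cases "C = {}")
      case True
      then show ?thesis using trig_approximable_poly[of 0] by (simp add: poly_0[abs_def] indicator_def)
    next
      case False
      define s where "s n \<zeta> = complex_of_real (max 0 (1 - real n * infdist \<zeta> C))" for n \<zeta>
      have b: "0 \<le> max 0 (1 - real n * infdist \<zeta> C) \<and> max 0 (1 - real n * infdist \<zeta> C) \<le> 1" for n \<zeta>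
        by (simp add: infdist_nonneg)
      show ?thesis
      proof (rule trig_approximable_limit[where s=s and w="\<lambda>_. 1"])
        show "trig_approximable (s n)" for n
          unfolding s_def by (intro trig_approximable_continuous continuous_intros)
        show "indicator C \<in> L2_circle"
          using C by (intro L2_indicator borel_closed)
        show "(\<lambda>n. s n \<zeta>) \<longlonglongrightarrow> indicator C \<zeta>" for \<zeta>
        proof (cases "\<zeta> \<in> C")
          case True
          then show ?thesis by (simp add: s_def)
        next
          case nin: False
          then have pos: "infdist \<zeta> C > 0"
            using C False by (metis in_closed_iff_infdist_zero infdist_nonneg less_le)
          obtain N where N: "real N * infdist \<zeta> C > 1"
            using reals_Archimedean3[OF pos] by blast
          have "s n \<zeta> = 0" if "n \<ge> N" for n
          proof -
            have "real N * infdist \<zeta> C \<le> real n * infdist \<zeta> C"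
              using that pos by (intro mult_right_mono) auto
            then show ?thesis using N by (simp add: s_def)
          qed
          then have "eventually (\<lambda>n. s n \<zeta> = 0) sequentially"
            by (auto simp: eventually_sequentially)
          then show ?thesis using nin by (simp add: tendsto_eventually)
        qed
        show "(cmod (indicator C \<zeta> - s n \<zeta>))\<^sup>2 \<le> 1" for n \<zeta>
        proof -
          have "indicator C \<zeta> - s n \<zeta> = of_real (indicator C \<zeta> - max 0 (1 - real n * infdist \<zeta> C))"
            by (simp add: s_def indicator_def)
          then have "cmod (indicator C \<zeta> - s n \<zeta>) \<le> 1"
            using b[of n \<zeta>] by (simp only: norm_of_real) (auto simp: indicator_def)
          then show ?thesis by (intro power_le_one) auto
        qed
      qed simp
    qed
  next
    case empty
    then show ?case using trig_approximable_poly[of 0] by (simp add: poly_0[abs_def] indicator_def)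
  next
    case (compl A)
    have "trig_approximable (\<lambda>\<zeta>. poly 1 \<zeta> + - 1 * indicator A \<zeta>)"
      by (intro trig_approximable_add trig_approximable_cmult trig_approximable_poly compl)
    then show ?case by (rule trig_approximable_cong[rotated]) (auto simp: indicator_def)
  next
    case (union A)
    then have borel: "A i \<in> sets borel" for i by (auto simp: borel_eq_closed)
    define s where "s n \<zeta> = (\<Sum>i<n. indicator (A i) \<zeta> :: complex)" for n \<zeta>
    have s: "s n = indicator (\<Union>i<n. A i)" for n
      unfolding s_def using union(1)
      by (intro ext, subst indicator_UN_disjoint) (auto simp: disjoint_family_on_def)
    show ?case
    proof (rule trig_approximable_limit[where s=s and w="\<lambda>_. 1"])
      show "trig_approximable (s n)" for n
        unfolding s_def by (intro trig_approximable_sum union)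
      show "indicator (\<Union> (range A)) \<in> L2_circle"
        using borel by (intro L2_indicator) auto
      show "(\<lambda>n. s n \<zeta>) \<longlonglongrightarrow> indicator (\<Union> (range A)) \<zeta>" for \<zeta>
        unfolding s by (rule LIMSEQ_indicator_UN)
      show "(cmod (indicator (\<Union> (range A)) \<zeta> - s n \<zeta>))\<^sup>2 \<le> 1" for n \<zeta>
        unfolding s by (auto simp: indicator_def)
    qed simp
  qed
qed

text \<open>A square-integrable function is a limit of simple functions dominated by twice its modulus.\<close>

theorem trig_approximable_L2:
  assumes f: "f \<in> L2_circle"
  shows "trig_approximable f"
proof -
  obtain F where F: "\<And>i. simple_function circle_measure (F i)"
    "\<And>\<zeta>. \<zeta> \<in> space circle_measure \<Longrightarrow> (\<lambda>i. F i \<zeta>) \<longlonglongrightarrow> f \<zeta>"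
    "\<And>i \<zeta>. \<zeta> \<in> space circle_measure \<Longrightarrow> dist (F i \<zeta>) 0 \<le> 2 * dist (f \<zeta>) 0"
    using borel_measurable_implies_sequence_metric[OF L2_measurable[OF f], of 0] by blast
  show ?thesis
  proof (rule trig_approximable_limit[where s=F and w="\<lambda>\<zeta>. 9 * (cmod (f \<zeta>))\<^sup>2"])
    show "trig_approximable (F i)" for i
    proof -
      have *: "trig_approximable (\<lambda>\<zeta>. \<Sum>y\<in>F i ` space circle_measure. y * indicator (F i -` {y} \<inter> space circle_measure) \<zeta>)"
      proof (intro trig_approximable_sum trig_approximable_cmult trig_approximable_indicator)
        fix y
        have "F i -` {y} \<inter> space circle_measure \<in> sets circle_measure"
          using simple_functionD(2)[OF F(1)] by blast
        then show "F i -` {y} \<inter> space circle_measure \<in> sets borel"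
          unfolding sets_circle_measure by (subst (asm) sets_restrict_space_iff) auto
      qed
      have fin: "finite (F i ` space circle_measure)"
        using simple_functionD(1)[OF F(1)] .
      show ?thesis
      proof (rule trig_approximable_cong[OF _ *])
        fix \<zeta> :: complex assume "cmod \<zeta> = 1"
        then have z: "\<zeta> \<in> space circle_measure" by simp
        have "(\<Sum>y\<in>F i ` space circle_measure. y * indicator (F i -` {y} \<inter> space circle_measure) \<zeta>) =
          (\<Sum>y\<in>F i ` space circle_measure. if y = F i \<zeta> then y else 0)"
          using z by (intro sum.cong) (auto simp: indicator_def)
        also have "\<dots> = F i \<zeta>"
          using z fin by (simp del: space_circle_measure)
        finally show "F i \<zeta> = (\<Sum>y\<in>F i ` space circle_measure. y * indicator (F i -` {y} \<inter> space circle_measure) \<zeta>)" by simp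
      qed
    qed
    show "integrable circle_measure (\<lambda>\<zeta>. 9 * (cmod (f \<zeta>))\<^sup>2)"
      using L2_integrable_square[OF f] by simp
    fix \<zeta> :: complex and n assume "cmod \<zeta> = 1"
    then have z: "\<zeta> \<in> space circle_measure" by simp
    show "(\<lambda>i. F i \<zeta>) \<longlonglongrightarrow> f \<zeta>" using F(2)[OF z] .
    have "cmod (f \<zeta> - F n \<zeta>) \<le> 3 * cmod (f \<zeta>)"
      using norm_triangle_ineq4[of "f \<zeta>" "F n \<zeta>"] F(3)[OF z, of n] by (simp add: dist_norm)
    then have "(cmod (f \<zeta> - F n \<zeta>))\<^sup>2 \<le> (3 * cmod (f \<zeta>))\<^sup>2"
      by (intro power_mono) auto
    then show "(cmod (f \<zeta> - F n \<zeta>))\<^sup>2 \<le> 9 * (cmod (f \<zeta>))\<^sup>2"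
      by (simp add: power_mult_distrib)
  qed (rule f)
qed

corollary L2_trig_dense:
  assumes "f \<in> L2_circle" "\<epsilon> > 0"
  obtains n p where "L2_norm (\<lambda>\<zeta>. \<zeta> ^ n * f \<zeta> - poly p \<zeta>) < \<epsilon>"
  using trig_approximable_L2[OF assms(1)] assms(2) unfolding trig_approximable_def by blast

section \<open>The Hardy space and its bounded multipliers\<close>

lemma fourier_coeff_add:
  "f \<in> L2_circle \<Longrightarrow> g \<in> L2_circle \<Longrightarrow>
    fourier_coeff (\<lambda>\<zeta>. f \<zeta> + g \<zeta>) k = fourier_coeff f k + fourier_coeff g k"
  by (simp add: fourier_coeff_eq_inner L2_inner_add_left)

lemma fourier_coeff_diff:
  "f \<in> L2_circle \<Longrightarrow> g \<in> L2_circle \<Longrightarrow>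
    fourier_coeff (\<lambda>\<zeta>. f \<zeta> - g \<zeta>) k = fourier_coeff f k - fourier_coeff g k"
  by (simp add: fourier_coeff_eq_inner L2_inner_diff_left)

lemma fourier_coeff_cmult: "fourier_coeff (\<lambda>\<zeta>. c * f \<zeta>) k = c * fourier_coeff f k"
  by (simp add: fourier_coeff_eq_inner L2_inner_cmult_left)

lemma fourier_coeff_const: "fourier_coeff (\<lambda>\<zeta>. c) k = (if k = 0 then c else 0)"
  using circle_integral_power_int[of "- k"] by (simp add: fourier_coeff_def)

lemma fourier_coeff_id_mult: "fourier_coeff (\<lambda>\<zeta>. \<zeta> * f \<zeta>) k = fourier_coeff f (k - 1)"
  unfolding fourier_coeff_def
proof (rule circle_integral_cong)
  fix \<zeta> :: complex assume "cmod \<zeta> = 1"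
  then have "\<zeta> \<noteq> 0" by auto
  then have "\<zeta> powi (- (k - 1)) = \<zeta> * \<zeta> powi (- k)"
    using power_int_add_1[of \<zeta> "- k"] by simp
  then show "\<zeta> * f \<zeta> * \<zeta> powi (- k) = f \<zeta> * \<zeta> powi (- (k - 1))" by simp
qed

lemma fourier_coeff_power_mult: "fourier_coeff (\<lambda>\<zeta>. \<zeta> ^ n * f \<zeta>) k = fourier_coeff f (k - int n)"
proof (induction n arbitrary: k)
  case (Suc n)
  then show ?case
    using fourier_coeff_id_mult[of "\<lambda>\<zeta>. \<zeta> ^ n * f \<zeta>" k] by (simp add: mult.assoc algebra_simps)
qed simp

lemma fourier_coeff_cnj_mult: "fourier_coeff (\<lambda>\<zeta>. cnj \<zeta> * f \<zeta>) k = fourier_coeff f (k + 1)"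
proof -
  have "fourier_coeff (\<lambda>\<zeta>. \<zeta> * (cnj \<zeta> * f \<zeta>)) (k + 1) = fourier_coeff f (k + 1)"
    by (rule fourier_coeff_cong) (simp flip: mult.assoc complex_norm_square)
  then show ?thesis by (simp add: fourier_coeff_id_mult)
qed

lemma cmod_fourier_coeff_le:
  assumes "f \<in> L2_circle" shows "cmod (fourier_coeff f k) \<le> L2_norm f"
proof -
  have "L2_norm (\<lambda>\<zeta>. \<zeta> powi k) = L2_norm (\<lambda>\<zeta>. 1)"
    by (rule L2_norm_cong) (simp add: norm_power_int)
  then show ?thesis
    using L2_Cauchy_Schwarz[OF assms, of "\<lambda>\<zeta>. \<zeta> powi k"] by (simp add: fourier_coeff_eq_inner)
qed

lemma fourier_coeff_cong_AE:
  assumes "AE \<zeta> in circle_measure. f \<zeta> = g \<zeta>" "f \<in> L2_circle" "g \<in> L2_circle"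
  shows "fourier_coeff f k = fourier_coeff g k"
  unfolding fourier_coeff_eq_inner
  by (rule L2_inner_cong_AE) (use assms in \<open>auto elim: eventually_mono\<close>)

lemma H2_L2: "f \<in> H2 \<Longrightarrow> f \<in> L2_circle"
  by (simp add: H2_def)

lemma H2_neg_coeff: "f \<in> H2 \<Longrightarrow> k < 0 \<Longrightarrow> fourier_coeff f k = 0"
  by (simp add: H2_def)

lemma H2I: "f \<in> L2_circle \<Longrightarrow> (\<And>k. k < 0 \<Longrightarrow> fourier_coeff f k = 0) \<Longrightarrow> f \<in> H2"
  by (simp add: H2_def)

lemma H2_cong:
  "(\<And>\<zeta>. cmod \<zeta> = 1 \<Longrightarrow> f \<zeta> = g \<zeta>) \<Longrightarrow> g \<in> H2 \<Longrightarrow> f \<in> H2"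
  using L2_cong[of f g] fourier_coeff_cong[of f g] by (auto simp: H2_def)

lemma H2_add: "f \<in> H2 \<Longrightarrow> g \<in> H2 \<Longrightarrow> (\<lambda>\<zeta>. f \<zeta> + g \<zeta>) \<in> H2"
  by (auto simp: H2_def L2_add fourier_coeff_add)

lemma H2_diff: "f \<in> H2 \<Longrightarrow> g \<in> H2 \<Longrightarrow> (\<lambda>\<zeta>. f \<zeta> - g \<zeta>) \<in> H2"
  by (auto simp: H2_def L2_diff fourier_coeff_diff)

lemma H2_cmult: "f \<in> H2 \<Longrightarrow> (\<lambda>\<zeta>. c * f \<zeta>) \<in> H2"
  by (auto simp: H2_def L2_cmult fourier_coeff_cmult)

lemma H2_const [simp]: "(\<lambda>\<zeta>. c) \<in> H2"
  by (auto simp: H2_def fourier_coeff_const)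

lemma H2_sum: "(\<And>j. j \<in> J \<Longrightarrow> f j \<in> H2) \<Longrightarrow> (\<lambda>\<zeta>. \<Sum>j\<in>J. f j \<zeta>) \<in> H2"
  by (induction J rule: infinite_finite_induct) (auto intro: H2_add)

lemma H2_power_mult: "f \<in> H2 \<Longrightarrow> (\<lambda>\<zeta>. \<zeta> ^ n * f \<zeta>) \<in> H2"
  by (auto simp: H2_def L2_power_mult fourier_coeff_power_mult)

lemma H2_id_mult: "f \<in> H2 \<Longrightarrow> (\<lambda>\<zeta>. \<zeta> * f \<zeta>) \<in> H2"
  using H2_power_mult[of f 1] by simp

lemma H2_poly_mult:
  assumes "f \<in> H2" shows "(\<lambda>\<zeta>. poly p \<zeta> * f \<zeta>) \<in> H2"
proof -
  have "(\<lambda>\<zeta>. \<Sum>i\<le>degree p. coeff p i * (\<zeta> ^ i * f \<zeta>)) \<in> H2"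
    by (intro H2_sum H2_cmult H2_power_mult assms)
  then show ?thesis by (simp add: poly_altdef sum_distrib_right mult.assoc)
qed

lemma H2_poly [simp]: "poly p \<in> H2"
  using H2_poly_mult[OF H2_const, of p 1] by simp

lemma H2_closed:
  assumes f: "f \<in> L2_circle"
    and approx: "\<And>\<epsilon>. \<epsilon> > 0 \<Longrightarrow> \<exists>g\<in>H2. L2_norm (\<lambda>\<zeta>. f \<zeta> - g \<zeta>) < \<epsilon>"
  shows "f \<in> H2"
proof (rule H2I[OF f])
  fix k :: int assume k: "k < 0"
  have "cmod (fourier_coeff f k) < \<epsilon>" if "\<epsilon> > 0" for \<epsilon>
  proof -
    obtain g where g: "g \<in> H2" "L2_norm (\<lambda>\<zeta>. f \<zeta> - g \<zeta>) < \<epsilon>"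
      using approx[OF \<open>\<epsilon> > 0\<close>] by blast
    have "fourier_coeff f k = fourier_coeff (\<lambda>\<zeta>. f \<zeta> - g \<zeta>) k"
      using f g(1) k by (simp add: fourier_coeff_diff H2_L2 H2_neg_coeff)
    also have "cmod \<dots> \<le> L2_norm (\<lambda>\<zeta>. f \<zeta> - g \<zeta>)"
      by (intro cmod_fourier_coeff_le L2_diff f H2_L2 g)
    finally show ?thesis using g(2) by simp
  qed
  from this[of "cmod (fourier_coeff f k)"] show "fourier_coeff f k = 0" by auto
qed

lemma L2_inner_poly_right:
  assumes "g \<in> L2_circle"
  shows "L2_inner g (poly p) = (\<Sum>i\<le>degree p. cnj (coeff p i) * fourier_coeff g (int i))"
proof -
  have "L2_inner g (poly p) = L2_inner g (\<lambda>\<zeta>. \<Sum>i\<le>degree p. coeff p i * \<zeta> powi int i)"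
    by (simp add: poly_altdef[abs_def])
  then show ?thesis
    using assms by (simp add: L2_inner_lincomb_right fourier_coeff_eq_inner del: power_int_of_nat)
qed

text \<open>
  If \<open>\<zeta> ^ n * h\<close> is close to \<open>p\<close>, split \<open>p = \<zeta> ^ n * q + r\<close> with \<open>degree r < n\<close>: the part
  \<open>\<zeta> ^ (- n) * r\<close> is orthogonal to the Hardy space, so dropping it only improves the approximation.
\<close>

lemma H2_poly_dense:
  assumes h: "h \<in> H2" and e: "\<epsilon> > 0"
  obtains q where "L2_norm (\<lambda>\<zeta>. h \<zeta> - poly q \<zeta>) < \<epsilon>"
proof -
  obtain n p where np: "L2_norm (\<lambda>\<zeta>. \<zeta> ^ n * h \<zeta> - poly p \<zeta>) < \<epsilon>"
    using L2_trig_dense[OF H2_L2[OF h] e] by blast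
  define q where "q = p div monom 1 n"
  define r where "r = p mod monom 1 n"
  have p: "p = q * monom 1 n + r"
    unfolding q_def r_def by (rule div_mult_mod_eq[symmetric])
  have r: "coeff r i = 0" if "i \<ge> n" for i
  proof -
    have "r = 0 \<or> degree r < n"
      using degree_mod_less[of "monom 1 n :: complex poly" p] by (simp add: r_def degree_monom_eq monom_eq_0_iff)
    then show ?thesis using that by (auto intro: coeff_eq_0)
  qed
  define d where "d = (\<lambda>\<zeta>. h \<zeta> - poly q \<zeta>)"
  have d: "d \<in> H2" unfolding d_def by (intro H2_diff h H2_poly)
  have nd: "(\<lambda>\<zeta>. \<zeta> ^ n * d \<zeta>) \<in> L2_circle" by (intro L2_power_mult H2_L2 d)
  have "fourier_coeff (\<lambda>\<zeta>. \<zeta> ^ n * d \<zeta>) (int i) = 0" if "i < n" for i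
    using that d by (simp add: fourier_coeff_power_mult H2_neg_coeff)
  then have "cnj (coeff r i) * fourier_coeff (\<lambda>\<zeta>. \<zeta> ^ n * d \<zeta>) (int i) = 0" for i
    using r[of i] by (cases "i < n") auto
  then have "L2_inner (\<lambda>\<zeta>. \<zeta> ^ n * d \<zeta>) (poly r) = 0"
    unfolding L2_inner_poly_right[OF nd] by (intro sum.neutral) auto
  then have "(L2_norm (\<lambda>\<zeta>. \<zeta> ^ n * d \<zeta> - poly r \<zeta>))\<^sup>2 = (L2_norm d)\<^sup>2 + (L2_norm (poly r))\<^sup>2"
    using L2_norm_diff_square[OF nd L2_poly[of r]] by (simp add: L2_norm_power_mult)
  moreover have "(\<lambda>\<zeta>. \<zeta> ^ n * d \<zeta> - poly r \<zeta>) = (\<lambda>\<zeta>. \<zeta> ^ n * h \<zeta> - poly p \<zeta>)"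
    by (simp add: p d_def poly_monom algebra_simps)
  ultimately have "(L2_norm d)\<^sup>2 \<le> (L2_norm (\<lambda>\<zeta>. \<zeta> ^ n * h \<zeta> - poly p \<zeta>))\<^sup>2" by simp
  then have "L2_norm d \<le> L2_norm (\<lambda>\<zeta>. \<zeta> ^ n * h \<zeta> - poly p \<zeta>)"
    by (rule power2_le_imp_le) simp
  with np show thesis by (intro that[of q]) (simp add: d_def)
qed

lemma HinfE:
  assumes "f \<in> Hinf"
  obtains C where "C \<ge> 0" "f \<in> borel_measurable circle_measure"
    "AE \<zeta> in circle_measure. cmod (f \<zeta>) \<le> C" "f \<in> H2"
proof -
  obtain C where "f \<in> borel_measurable circle_measure"
    "AE \<zeta> in circle_measure. cmod (f \<zeta>) \<le> C" "f \<in> H2"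
    using assms unfolding Hinf_def Linf_circle_def by blast
  then show thesis by (intro that[of "max C 0"]) (auto elim: eventually_mono)
qed

lemma Hinf_H2: "f \<in> Hinf \<Longrightarrow> f \<in> H2"
  by (simp add: Hinf_def)

lemma HinfI:
  "f \<in> H2 \<Longrightarrow> AE \<zeta> in circle_measure. cmod (f \<zeta>) \<le> C \<Longrightarrow> f \<in> Hinf"
  unfolding Hinf_def Linf_circle_def using H2_L2 L2_measurable by auto

text \<open>
  A polynomial times \<open>f\<close> has no negative Fourier coefficients because multiplication by \<open>\<zeta>\<close> shifts them
  upwards; boundedness of \<open>f\<close> carries this over to \<open>L\<^sup>2\<close>-limits of polynomials.
\<close>

lemma Hinf_mult_H2:
  assumes f: "f \<in> Hinf" and h: "h \<in> H2"
  shows "(\<lambda>\<zeta>. f \<zeta> * h \<zeta>) \<in> H2"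
proof -
  obtain C where C: "C \<ge> 0" "f \<in> borel_measurable circle_measure"
    "AE \<zeta> in circle_measure. cmod (f \<zeta>) \<le> C" and f2: "f \<in> H2"
    using HinfE[OF f] by blast
  show ?thesis
  proof (rule H2_closed)
    show L: "(\<lambda>\<zeta>. f \<zeta> * h \<zeta>) \<in> L2_circle"
      by (rule L2_AE_bounded_mult[OF C(2,3) H2_L2[OF h]])
    fix \<epsilon> :: real assume e: "0 < \<epsilon>"
    then have "\<epsilon> / (C + 1) > 0" using C(1) by simp
    then obtain q where q: "L2_norm (\<lambda>\<zeta>. h \<zeta> - poly q \<zeta>) < \<epsilon> / (C + 1)"
      using H2_poly_dense[OF h] by blast
    have g: "(\<lambda>\<zeta>. poly q \<zeta> * f \<zeta>) \<in> H2" by (rule H2_poly_mult[OF f2])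
    have "L2_norm (\<lambda>\<zeta>. f \<zeta> * h \<zeta> - poly q \<zeta> * f \<zeta>) \<le> (C + 1) * L2_norm (\<lambda>\<zeta>. h \<zeta> - poly q \<zeta>)"
    proof (rule L2_norm_mono_AE)
      show "AE \<zeta> in circle_measure. cmod (f \<zeta> * h \<zeta> - poly q \<zeta> * f \<zeta>) \<le> (C + 1) * cmod (h \<zeta> - poly q \<zeta>)"
        using C(3)
      proof eventually_elim
        case (elim \<zeta>)
        have "cmod (f \<zeta> * h \<zeta> - poly q \<zeta> * f \<zeta>) = cmod (f \<zeta>) * cmod (h \<zeta> - poly q \<zeta>)"
          by (simp flip: norm_mult add: algebra_simps)
        also have "\<dots> \<le> (C + 1) * cmod (h \<zeta> - poly q \<zeta>)"
          using elim by (intro mult_right_mono) auto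
        finally show ?case .
      qed
    qed (use L g h C(1) in \<open>auto intro: L2_diff H2_L2\<close>)
    also have "\<dots> < \<epsilon>" using q C(1) by (simp add: field_simps)
    finally show "\<exists>g\<in>H2. L2_norm (\<lambda>\<zeta>. f \<zeta> * h \<zeta> - g \<zeta>) < \<epsilon>" by (intro bexI[OF _ g])
  qed
qed

lemma Hinf_mult:
  assumes f: "f \<in> Hinf" and g: "g \<in> Hinf"
  shows "(\<lambda>\<zeta>. f \<zeta> * g \<zeta>) \<in> Hinf"
proof -
  obtain C D where C: "C \<ge> 0" and bounds: "AE \<zeta> in circle_measure. cmod (f \<zeta>) \<le> C"
    "AE \<zeta> in circle_measure. cmod (g \<zeta>) \<le> D"
    using HinfE[OF f] HinfE[OF g] by metis
  from bounds have "AE \<zeta> in circle_measure. cmod (f \<zeta> * g \<zeta>) \<le> C * D"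
    by eventually_elim (use C in \<open>auto simp: norm_mult intro: mult_mono\<close>)
  with Hinf_mult_H2[OF f Hinf_H2[OF g]] show ?thesis
    by (rule HinfI)
qed

lemma Hinf_const [simp]: "(\<lambda>\<zeta>. c) \<in> Hinf"
  by (rule HinfI[where C="cmod c"]) auto

lemma Hinf_power: "f \<in> Hinf \<Longrightarrow> (\<lambda>\<zeta>. f \<zeta> ^ n) \<in> Hinf"
  by (induction n) (auto intro: Hinf_mult)

text \<open>On the Hardy space this is the adjoint of multiplication by \<open>\<zeta>\<close>.\<close>

definition backward_shift :: "(complex \<Rightarrow> complex) \<Rightarrow> complex \<Rightarrow> complex" where
  "backward_shift g = (\<lambda>\<zeta>. cnj \<zeta> * (g \<zeta> - fourier_coeff g 0))"

lemma backward_shift_eq: "cmod \<zeta> = 1 \<Longrightarrow> \<zeta> * backward_shift g \<zeta> = g \<zeta> - fourier_coeff g 0"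
  by (simp add: backward_shift_def flip: mult.assoc complex_norm_square)

lemma L2_cnj_id_mult: "f \<in> L2_circle \<Longrightarrow> (\<lambda>\<zeta>. cnj \<zeta> * f \<zeta>) \<in> L2_circle"
  by (rule L2_AE_bounded_mult[where C=1]) (auto intro: AE_circle)

lemma backward_shift_H2:
  assumes "g \<in> H2" shows "backward_shift g \<in> H2"
proof (rule H2I)
  have L: "(\<lambda>\<zeta>. g \<zeta> - fourier_coeff g 0) \<in> L2_circle"
    by (intro L2_diff H2_L2 assms L2_const)
  then show "backward_shift g \<in> L2_circle"
    unfolding backward_shift_def by (rule L2_cnj_id_mult)
  fix k :: int assume "k < 0"
  then show "fourier_coeff (backward_shift g) k = 0"
    using H2_neg_coeff[OF assms, of "k + 1"] H2_L2[OF assms]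
    by (cases "k = - 1")
      (simp_all add: backward_shift_def fourier_coeff_cnj_mult fourier_coeff_diff fourier_coeff_const)
qed

lemma fourier_coeff_0_mult:
  assumes f: "f \<in> Hinf" and g: "g \<in> H2"
  shows "fourier_coeff (\<lambda>\<zeta>. f \<zeta> * g \<zeta>) 0 = fourier_coeff f 0 * fourier_coeff g 0"
proof -
  let ?g = "fourier_coeff g 0"
  have fg: "(\<lambda>\<zeta>. f \<zeta> * backward_shift g \<zeta>) \<in> H2"
    by (intro Hinf_mult_H2 f backward_shift_H2 g)
  have "fourier_coeff (\<lambda>\<zeta>. f \<zeta> * g \<zeta>) 0 =
      fourier_coeff (\<lambda>\<zeta>. ?g * f \<zeta> + \<zeta> * (f \<zeta> * backward_shift g \<zeta>)) 0"
  proof (rule fourier_coeff_cong)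
    fix \<zeta> :: complex assume "cmod \<zeta> = 1"
    from backward_shift_eq[OF this, of g]
    have "g \<zeta> = ?g + \<zeta> * backward_shift g \<zeta>" by simp
    then show "f \<zeta> * g \<zeta> = ?g * f \<zeta> + \<zeta> * (f \<zeta> * backward_shift g \<zeta>)"
      by (metis (no_types, lifting) distrib_left mult.commute mult.left_commute)
  qed
  also have "\<dots> = ?g * fourier_coeff f 0"
    using f fg by (subst fourier_coeff_add)
      (auto intro: L2_cmult H2_L2 Hinf_H2 H2_id_mult simp: fourier_coeff_cmult fourier_coeff_id_mult H2_neg_coeff)
  finally show ?thesis by (simp add: mult.commute)
qed

section \<open>Szego kernels and Blaschke factors\<close>

definition szego :: "complex \<Rightarrow> complex \<Rightarrow> complex" where
  "szego a \<zeta> = 1 / (1 - cnj a * \<zeta>)"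

definition blaschke_factor :: "complex \<Rightarrow> complex \<Rightarrow> complex" where
  "blaschke_factor a \<zeta> = (\<zeta> - a) / (1 - cnj a * \<zeta>)"

lemma blaschke_factor_eq: "blaschke_factor a \<zeta> = (\<zeta> - a) * szego a \<zeta>"
  by (simp add: blaschke_factor_def szego_def)

lemma szego_denom_nonzero:
  assumes "cmod a < 1" "cmod \<zeta> \<le> 1"
  shows "1 - cnj a * \<zeta> \<noteq> 0"
proof
  assume "1 - cnj a * \<zeta> = 0"
  then have "cmod (cnj a * \<zeta>) = 1" by (metis eq_iff_diff_eq_0 norm_one)
  moreover have "cmod a * cmod \<zeta> \<le> cmod a * 1"
    using assms by (intro mult_left_mono) auto
  ultimately show False using assms by (simp add: norm_mult)
qed

lemma cmod_blaschke_factor: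
  assumes a: "cmod a < 1" and z: "cmod \<zeta> = 1"
  shows "cmod (blaschke_factor a \<zeta>) = 1"
proof -
  have "\<zeta> * cnj \<zeta> = 1" unfolding complex_norm_square[symmetric] using z by simp
  then have "\<zeta> * cnj (1 - cnj a * \<zeta>) = \<zeta> - a" by (simp add: algebra_simps)
  then have "cmod (\<zeta> - a) = cmod (1 - cnj a * \<zeta>)"
    using z by (metis complex_mod_cnj mult_1 norm_mult)
  then show ?thesis
    using szego_denom_nonzero[OF a, of \<zeta>] z by (simp add: blaschke_factor_def norm_divide)
qed

lemma szego_L2:
  assumes "cmod a < 1" shows "szego a \<in> L2_circle"
  unfolding szego_def[abs_def]
  by (intro L2_continuous continuous_intros) (use szego_denom_nonzero[OF assms] in auto)

lemma szego_coeff: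
  assumes a: "cmod a < 1"
  shows "fourier_coeff (szego a) k = (if k = 0 then 1 else 0) + cnj a * fourier_coeff (szego a) (k - 1)"
proof -
  have "fourier_coeff (szego a) k = fourier_coeff (\<lambda>\<zeta>. 1 + cnj a * (\<zeta> * szego a \<zeta>)) k"
    by (rule fourier_coeff_cong) (use szego_denom_nonzero[OF a] in \<open>simp add: szego_def field_simps\<close>)
  also have "\<dots> = (if k = 0 then 1 else 0) + cnj a * fourier_coeff (szego a) (k - 1)"
    using L2_power_mult[OF szego_L2[OF a], of 1]
    by (subst fourier_coeff_add) (auto intro!: L2_cmult simp: fourier_coeff_const fourier_coeff_cmult fourier_coeff_id_mult)
  finally show ?thesis .
qed

text \<open>
  By the recursion from \<open>u = 1 + cnj a * \<zeta> * u\<close>, a coefficient of negative order is \<open>cnj a ^ n\<close> times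
  the one \<open>n\<close> places further down, for every \<open>n\<close>, and vanishes since all of them are bounded.
\<close>

lemma szego_H2:
  assumes a: "cmod a < 1" shows "szego a \<in> H2"
proof (rule H2I[OF szego_L2[OF a]])
  fix k :: int assume k: "k < 0"
  have "fourier_coeff (szego a) k = cnj a ^ n * fourier_coeff (szego a) (k - int n)" for n
  proof (induction n)
    case (Suc n)
    then show ?case
      using k szego_coeff[OF a, of "k - int n"] by (simp add: algebra_simps)
  qed simp
  then have "cmod (fourier_coeff (szego a) k) \<le> cmod a ^ n * L2_norm (szego a)" for n
    using cmod_fourier_coeff_le[OF szego_L2[OF a], of "k - int n"]
    by (metis complex_mod_cnj mult_left_mono norm_ge_zero norm_mult norm_power zero_le_power)
  moreover have "(\<lambda>n. cmod a ^ n * L2_norm (szego a)) \<longlonglongrightarrow> 0 * L2_norm (szego a)"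
    by (intro tendsto_mult LIMSEQ_power_zero tendsto_const) (use a in simp)
  ultimately have "cmod (fourier_coeff (szego a) k) \<le> 0 * L2_norm (szego a)"
    by (intro LIMSEQ_le_const) auto
  then show "fourier_coeff (szego a) k = 0" by simp
qed

lemma szego_coeff_0: "cmod a < 1 \<Longrightarrow> fourier_coeff (szego a) 0 = 1"
  using szego_coeff[of a 0] H2_neg_coeff[OF szego_H2, of a "-1"] by simp

lemma blaschke_factor_Hinf:
  assumes a: "cmod a < 1" shows "blaschke_factor a \<in> Hinf"
proof (rule HinfI[where C=1])
  have "(\<lambda>\<zeta>. poly [:- a, 1:] \<zeta> * szego a \<zeta>) \<in> H2"
    by (rule H2_poly_mult[OF szego_H2[OF a]])
  then show "blaschke_factor a \<in> H2"
    by (simp add: blaschke_factor_eq[abs_def])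
qed (use cmod_blaschke_factor[OF a] in \<open>auto intro: AE_circle\<close>)

lemma blaschke_factor_coeff_0:
  assumes a: "cmod a < 1" shows "fourier_coeff (blaschke_factor a) 0 = - a"
proof -
  have "fourier_coeff (\<lambda>\<zeta>. \<zeta> * szego a \<zeta> - a * szego a \<zeta>) 0 = - a"
    using a H2_id_mult[OF szego_H2[OF a]]
    by (subst fourier_coeff_diff)
      (auto intro: L2_cmult szego_L2 H2_L2 simp: fourier_coeff_cmult fourier_coeff_id_mult szego_coeff_0 H2_neg_coeff szego_H2)
  then show ?thesis
    by (simp add: blaschke_factor_eq[abs_def] left_diff_distrib)
qed

text \<open>
  The kernel reproduces the value at \<open>a\<close>; what is needed of this is that functions vanishing at \<open>a\<close>
  are orthogonal to it.  On the circle \<open>(\<zeta> - a) * cnj (szego a \<zeta>) = \<zeta>\<close>, so the inner product is the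
  mean of \<open>\<zeta> * g\<close>, which has no constant term.
\<close>

lemma szego_annihilates:
  assumes a: "cmod a < 1" and g: "g \<in> H2"
  shows "L2_inner (\<lambda>\<zeta>. (\<zeta> - a) * g \<zeta>) (szego a) = 0"
proof -
  have "L2_inner (\<lambda>\<zeta>. (\<zeta> - a) * g \<zeta>) (szego a) = (LINT \<zeta>|circle_measure. \<zeta> * g \<zeta>)"
    unfolding L2_inner_def
  proof (rule circle_integral_cong)
    fix \<zeta> :: complex assume z: "cmod \<zeta> = 1"
    have nz: "1 - a * cnj \<zeta> \<noteq> 0"
      using szego_denom_nonzero[OF a, of \<zeta>] z
      by (metis complex_cnj_cnj complex_cnj_diff complex_cnj_mult complex_cnj_one complex_cnj_zero order_refl)
    have "\<zeta> * cnj \<zeta> = 1" unfolding complex_norm_square[symmetric] using z by simp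
    then have "\<zeta> - a = \<zeta> * (1 - a * cnj \<zeta>)" by (simp add: algebra_simps)
    then show "(\<zeta> - a) * g \<zeta> * cnj (szego a \<zeta>) = \<zeta> * g \<zeta>"
      using nz by (simp add: szego_def)
  qed
  also have "\<dots> = fourier_coeff (\<lambda>\<zeta>. \<zeta> * g \<zeta>) 0" by (simp add: fourier_coeff_def)
  also have "\<dots> = 0" by (simp add: fourier_coeff_id_mult H2_neg_coeff[OF g])
  finally show ?thesis .
qed

lemma szego_annihilates_blaschke:
  assumes a: "cmod a < 1" and g: "g \<in> H2"
  shows "L2_inner (\<lambda>\<zeta>. blaschke_factor a \<zeta> * g \<zeta>) (szego a) = 0"
proof -
  have "(\<lambda>\<zeta>. szego a \<zeta> * g \<zeta>) \<in> H2"
  proof (rule Hinf_mult_H2[OF HinfI[OF szego_H2[OF a], where C="1 / (1 - cmod a)"] g], rule AE_circle)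
    fix \<zeta> :: complex assume z: "cmod \<zeta> = 1"
    have "1 - cmod a \<le> cmod (1 - cnj a * \<zeta>)"
      using norm_triangle_ineq2[of 1 "cnj a * \<zeta>"] z by (simp add: norm_mult)
    then show "cmod (szego a \<zeta>) \<le> 1 / (1 - cmod a)"
      using a by (simp add: szego_def norm_divide frac_le)
  qed
  from szego_annihilates[OF a this] show ?thesis
    by (simp add: blaschke_factor_eq mult.assoc)
qed

lemma L2_inner_poly_szego:
  assumes a: "cmod a < 1"
  shows "L2_inner (poly p) (szego a) = poly p a"
proof -
  obtain q where "p - [:poly p a:] = [:- a, 1:] * q"
    using poly_eq_0_iff_dvd[of "p - [:poly p a:]" a] by (auto elim: dvdE)
  then have q: "poly p \<zeta> = poly p a + (\<zeta> - a) * poly q \<zeta>" for \<zeta>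
  proof -
    have "poly (p - [:poly p a:]) \<zeta> = poly ([:- a, 1:] * q) \<zeta>"
      using \<open>p - [:poly p a:] = [:- a, 1:] * q\<close> by simp
    then show ?thesis by (simp add: algebra_simps)
  qed
  have "L2_inner (\<lambda>\<zeta>. 1) (szego a) = cnj (fourier_coeff (szego a) 0)"
    by (subst L2_inner_commute) (simp add: fourier_coeff_eq_inner)
  then have one: "L2_inner (\<lambda>\<zeta>. 1) (szego a) = 1"
    using a by (simp add: szego_coeff_0)
  have L: "(\<lambda>\<zeta>. (\<zeta> - a) * poly q \<zeta>) \<in> L2_circle"
    using L2_poly_mult[OF L2_poly[of q], of "[:- a, 1:]"] by simp
  have "L2_inner (\<lambda>\<zeta>. poly p a * 1 + (\<zeta> - a) * poly q \<zeta>) (szego a) = poly p a"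
    unfolding L2_inner_add_left[OF L2_cmult[OF L2_const] L szego_L2[OF a]]
      L2_inner_cmult_left one szego_annihilates[OF a H2_poly] by simp
  then show ?thesis unfolding mult_1_right q[symmetric] .
qed

lemma szego_identity:
  assumes "cmod a < 1" "cmod \<zeta> \<le> 1"
  shows "of_real (1 - (cmod a)\<^sup>2) * szego a \<zeta> = 1 + cnj a * blaschke_factor a \<zeta>"
proof -
  have "(complex_of_real (cmod a))\<^sup>2 = a * cnj a"
    using complex_norm_square[of a] by simp
  then show ?thesis
    using szego_denom_nonzero[OF assms]
    by (simp add: szego_def blaschke_factor_def field_simps)
qed

lemma szego_norm:
  assumes a: "cmod a < 1"
  shows "(1 - (cmod a)\<^sup>2) * (L2_norm (szego a))\<^sup>2 = 1"
proof -
  have b: "(\<lambda>\<zeta>. blaschke_factor a \<zeta> * 1) \<in> L2_circle"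
    using H2_L2[OF Hinf_H2[OF blaschke_factor_Hinf[OF a]]] by simp
  have one: "L2_inner (\<lambda>\<zeta>. 1) (szego a) = 1"
    using L2_inner_poly_szego[OF a, of 1] by (simp add: one_pCons poly_pCons[abs_def])
  have "of_real (1 - (cmod a)\<^sup>2) * L2_inner (szego a) (szego a) =
      L2_inner (\<lambda>\<zeta>. of_real (1 - (cmod a)\<^sup>2) * szego a \<zeta>) (szego a)"
    by (rule L2_inner_cmult_left[symmetric])
  also have "\<dots> = L2_inner (\<lambda>\<zeta>. 1 + cnj a * (blaschke_factor a \<zeta> * 1)) (szego a)"
  proof (rule L2_inner_cong)
    fix \<zeta> :: complex assume "cmod \<zeta> = 1"
    then show "of_real (1 - (cmod a)\<^sup>2) * szego a \<zeta> * cnj (szego a \<zeta>) =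
        (1 + cnj a * (blaschke_factor a \<zeta> * 1)) * cnj (szego a \<zeta>)"
      by (subst szego_identity[OF a]) auto
  qed
  also have "\<dots> = 1"
    unfolding L2_inner_add_left[OF L2_const L2_cmult[OF b] szego_L2[OF a]]
      L2_inner_cmult_left szego_annihilates_blaschke[OF a H2_const] one by simp
  finally show ?thesis
    unfolding L2_inner_self by (simp only: of_real_mult[symmetric] of_real_eq_1_iff)
qed

text \<open>
  The Szego kernel spans the orthogonal complement of the functions divisible by the Blaschke
  factor.  For polynomials the quotient is a polynomial; the general case follows since
  \<open>y \<mapsto> cnj b * (y - projection)\<close> is \<open>L\<^sup>2\<close>-bounded and the Hardy space is closed.
\<close>

lemma blaschke_factor_split:
  assumes a: "cmod a < 1" and y: "y \<in> H2"
  obtains z c where "z \<in> H2"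
    "\<And>\<zeta>. cmod \<zeta> = 1 \<Longrightarrow> y \<zeta> = c * szego a \<zeta> + blaschke_factor a \<zeta> * z \<zeta>"
proof -
  define s where "s = complex_of_real (1 - (cmod a)\<^sup>2)"
  define b where "b = blaschke_factor a"
  define T where "T g = (\<lambda>\<zeta>. cnj (b \<zeta>) * (g \<zeta> - s * L2_inner g (szego a) * szego a \<zeta>))" for g
  have bb: "b \<zeta> * cnj (b \<zeta>) = 1" if "cmod \<zeta> = 1" for \<zeta>
    unfolding complex_norm_square[symmetric] b_def using cmod_blaschke_factor[OF a that] by simp
  have bm: "(\<lambda>\<zeta>. cnj (b \<zeta>)) \<in> borel_measurable circle_measure"
    unfolding b_def using L2_measurable[OF H2_L2[OF Hinf_H2[OF blaschke_factor_Hinf[OF a]]]] by simp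
  have bb1: "AE \<zeta> in circle_measure. cmod (cnj (b \<zeta>)) \<le> 1"
    using cmod_blaschke_factor[OF a] by (auto simp: b_def intro: AE_circle)
  have TL: "T g \<in> L2_circle" if "g \<in> L2_circle" for g
    unfolding T_def by (intro L2_AE_bounded_mult[OF bm bb1] L2_diff that L2_cmult szego_L2 a)
  have Tdiff: "T f \<zeta> - T g \<zeta> = T (\<lambda>\<zeta>. f \<zeta> - g \<zeta>) \<zeta>" if "f \<in> L2_circle" "g \<in> L2_circle" for f g \<zeta>
    unfolding T_def using that by (simp add: L2_inner_diff_left szego_L2 a algebra_simps)
  define C where "C = 1 + cmod s * L2_norm (szego a) * L2_norm (szego a)"
  have C: "C > 0" unfolding C_def by (intro add_pos_nonneg) auto
  have Tbound: "L2_norm (T g) \<le> C * L2_norm g" if g: "g \<in> L2_circle" for g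
  proof -
    have "L2_norm (T g) = L2_norm (\<lambda>\<zeta>. g \<zeta> - s * L2_inner g (szego a) * szego a \<zeta>)"
      by (rule L2_norm_cong) (simp add: T_def norm_mult b_def cmod_blaschke_factor a)
    also have "\<dots> \<le> L2_norm (\<lambda>\<zeta>. g \<zeta> - 0) + L2_norm (\<lambda>\<zeta>. 0 - s * L2_inner g (szego a) * szego a \<zeta>)"
      by (intro L2_norm_triangle3 g L2_cmult szego_L2 a L2_const)
    also have "L2_norm (\<lambda>\<zeta>. 0 - s * L2_inner g (szego a) * szego a \<zeta>) =
        cmod (s * L2_inner g (szego a)) * L2_norm (szego a)"
      using L2_norm_cmult[of "- (s * L2_inner g (szego a))" "szego a"] by simp
    also have "\<dots> \<le> cmod s * (L2_norm g * L2_norm (szego a)) * L2_norm (szego a)"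
      unfolding norm_mult by (intro mult_right_mono mult_left_mono L2_Cauchy_Schwarz g szego_L2 a) auto
    finally show ?thesis by (simp add: C_def algebra_simps)
  qed
  have "T y \<in> H2"
  proof (rule H2_closed[OF TL[OF H2_L2[OF y]]])
    fix \<epsilon> :: real assume "0 < \<epsilon>"
    then have "\<epsilon> / C > 0" using C by simp
    then obtain p where p: "L2_norm (\<lambda>\<zeta>. y \<zeta> - poly p \<zeta>) < \<epsilon> / C"
      using H2_poly_dense[OF y] by blast
    have "[:- a, 1:] dvd p - [:poly p a:]"
      by (simp flip: poly_eq_0_iff_dvd)
    then obtain q where "p - [:poly p a:] = [:- a, 1:] * q" by (elim dvdE)
    then have "poly (p - [:poly p a:]) \<zeta> = poly ([:- a, 1:] * q) \<zeta>" for \<zeta> by simp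
    then have q: "poly p \<zeta> = poly p a + (\<zeta> - a) * poly q \<zeta>" for \<zeta>
      by (simp add: algebra_simps)
    have "T (poly p) \<in> H2"
    proof (rule H2_cong)
      fix \<zeta> :: complex assume z: "cmod \<zeta> = 1"
      have nz: "1 - cnj a * \<zeta> \<noteq> 0" using szego_denom_nonzero[OF a, of \<zeta>] z by simp
      have "\<zeta> - a = b \<zeta> * (1 - cnj a * \<zeta>)" using nz by (simp add: b_def blaschke_factor_def)
      then have 1: "poly p \<zeta> = poly p a + b \<zeta> * ((1 - cnj a * \<zeta>) * poly q \<zeta>)"
        by (subst q) (simp add: mult_ac)
      have 2: "s * szego a \<zeta> = 1 + cnj a * b \<zeta>"
        unfolding s_def b_def by (rule szego_identity) (use a z in auto)
      have "T (poly p) \<zeta> = cnj (b \<zeta>) * (poly p \<zeta> - poly p a * (s * szego a \<zeta>))"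
        unfolding T_def L2_inner_poly_szego[OF a] by (simp add: mult_ac)
      also have "\<dots> = (b \<zeta> * cnj (b \<zeta>)) * ((1 - cnj a * \<zeta>) * poly q \<zeta> - cnj a * poly p a)"
        unfolding 2 by (subst 1) (simp add: algebra_simps)
      also have "\<dots> = poly ([:1, - cnj a:] * q - [:cnj a * poly p a:]) \<zeta>"
        unfolding bb[OF z] by (simp add: algebra_simps)
      finally show "T (poly p) \<zeta> = poly ([:1, - cnj a:] * q - [:cnj a * poly p a:]) \<zeta>" .
    qed (rule H2_poly)
    moreover have "L2_norm (\<lambda>\<zeta>. T y \<zeta> - T (poly p) \<zeta>) < \<epsilon>"
    proof -
      have "L2_norm (\<lambda>\<zeta>. T y \<zeta> - T (poly p) \<zeta>) = L2_norm (T (\<lambda>\<zeta>. y \<zeta> - poly p \<zeta>))"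
        using Tdiff[OF H2_L2[OF y] L2_poly] by simp
      also have "\<dots> \<le> C * L2_norm (\<lambda>\<zeta>. y \<zeta> - poly p \<zeta>)"
        by (intro Tbound L2_diff H2_L2 y L2_poly)
      also have "\<dots> < \<epsilon>" using p C by (simp add: field_simps)
      finally show ?thesis .
    qed
    ultimately show "\<exists>g\<in>H2. L2_norm (\<lambda>\<zeta>. T y \<zeta> - g \<zeta>) < \<epsilon>" by (intro bexI)
  qed
  moreover have "y \<zeta> = s * L2_inner y (szego a) * szego a \<zeta> + blaschke_factor a \<zeta> * T y \<zeta>"
    if "cmod \<zeta> = 1" for \<zeta>
    unfolding T_def b_def[symmetric] mult.assoc[symmetric] bb[OF that] by simp
  ultimately show thesis by (rule that)
qed

section \<open>Orthonormal orbits of a finite Blaschke product\<close>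

lemma L2_inner_unimodular_mult:
  assumes "\<phi> \<in> borel_measurable circle_measure" "AE \<zeta> in circle_measure. cmod (\<phi> \<zeta>) = 1"
    and f: "f \<in> L2_circle" and g: "g \<in> L2_circle"
  shows "L2_inner (\<lambda>\<zeta>. \<phi> \<zeta> * f \<zeta>) (\<lambda>\<zeta>. \<phi> \<zeta> * g \<zeta>) = L2_inner f g"
proof (rule L2_inner_cong_AE)
  show "AE \<zeta> in circle_measure. \<phi> \<zeta> * f \<zeta> * cnj (\<phi> \<zeta> * g \<zeta>) = f \<zeta> * cnj (g \<zeta>)"
    using assms(2)
  proof eventually_elim
    case (elim \<zeta>)
    then have "\<phi> \<zeta> * cnj (\<phi> \<zeta>) = 1" unfolding complex_norm_square[symmetric] by simp
    then show ?case by simp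
  qed
qed (use assms in \<open>auto intro!: L2_AE_bounded_mult[where C=1] elim: eventually_mono\<close>)

lemma tendsto_0_geometric_recursion:
  fixes x e :: "nat \<Rightarrow> complex"
  assumes c: "cmod c < 1" and rec: "\<And>N. x (Suc N) = c * x N + e N" and e: "e \<longlonglongrightarrow> 0"
  shows "x \<longlonglongrightarrow> 0"
proof (rule LIMSEQ_I)
  fix r :: real assume r: "0 < r"
  define t where "t = r / 2 * (1 - cmod c)"
  have t_alt: "t = r / 2 - cmod c * (r / 2)" by (simp add: t_def diff_divide_distrib algebra_simps)
  have "t > 0" using r c by (simp add: t_def)
  from LIMSEQ_D[OF e this] obtain M where M: "\<And>n. n \<ge> M \<Longrightarrow> cmod (e n) < t" by auto
  have step: "cmod (x (M + j)) \<le> r / 2 + cmod c ^ j * cmod (x M)" for j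
  proof (induction j)
    case (Suc j)
    have "cmod (x (M + Suc j)) \<le> cmod c * cmod (x (M + j)) + cmod (e (M + j))"
      using norm_triangle_ineq[of "c * x (M + j)" "e (M + j)"] by (simp add: rec norm_mult)
    also have "\<dots> \<le> cmod c * (r / 2 + cmod c ^ j * cmod (x M)) + t"
      using M[of "M + j"] Suc by (intro add_mono mult_left_mono) auto
    also have "\<dots> = r / 2 + cmod c ^ Suc j * cmod (x M)"
      by (simp add: t_alt algebra_simps)
    finally show ?case .
  qed (use r in simp)
  have "(\<lambda>j. cmod c ^ j * cmod (x M)) \<longlonglongrightarrow> 0 * cmod (x M)"
    by (intro tendsto_mult LIMSEQ_power_zero tendsto_const) (use c in simp)
  then obtain J where J: "\<And>j. j \<ge> J \<Longrightarrow> cmod c ^ j * cmod (x M) < r / 2"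
    using order_tendstoD(2)[of "\<lambda>j. cmod c ^ j * cmod (x M)" 0 sequentially "r / 2"] r
    by (auto simp: eventually_sequentially)
  have "norm (x n - 0) < r" if "n \<ge> M + J" for n
  proof -
    have "cmod c ^ (n - M) * cmod (x M) < r / 2"
      using that by (intro J) linarith
    moreover have "cmod (x n) \<le> r / 2 + cmod c ^ (n - M) * cmod (x M)"
      using step[of "n - M"] that by simp
    ultimately show ?thesis by simp
  qed
  then show "\<exists>no. \<forall>n\<ge>no. norm (x n - 0) < r" by blast
qed

lemma L2_norm_backward_shift_le:
  assumes "g \<in> L2_circle" shows "L2_norm (backward_shift g) \<le> 2 * L2_norm g"
proof -
  have "L2_norm (backward_shift g) = L2_norm (\<lambda>\<zeta>. g \<zeta> - fourier_coeff g 0)"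
    by (rule L2_norm_cong) (simp add: backward_shift_def norm_mult)
  also have "\<dots> \<le> L2_norm (\<lambda>\<zeta>. g \<zeta> - 0) + L2_norm (\<lambda>\<zeta>. 0 - fourier_coeff g 0)"
    by (intro L2_norm_triangle3 assms L2_const)
  also have "\<dots> \<le> 2 * L2_norm g"
    using cmod_fourier_coeff_le[OF assms, of 0] by simp
  finally show ?thesis .
qed

text \<open>
  Powers of \<open>\<phi>\<close> lose every fixed Fourier coefficient when \<open>\<phi>\<close> is a strict contraction at the
  origin.  Peeling off constant terms (\<open>g = g(0) + \<zeta> g'\<close>, likewise for \<open>\<phi>\<close>) reduces the
  coefficient of order \<open>k + 1\<close> to the one of order \<open>k\<close> and a geometric recursion.
\<close>

lemma fourier_coeff_power_mult_tendsto_0: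
  assumes \<phi>: "\<phi> \<in> Hinf" and c: "cmod (fourier_coeff \<phi> 0) < 1"
    and g: "\<And>N. g N \<in> H2" "\<And>N. L2_norm (g N) \<le> C"
  shows "(\<lambda>N. fourier_coeff (\<lambda>\<zeta>. \<phi> \<zeta> ^ N * g N \<zeta>) (int k)) \<longlonglongrightarrow> 0"
  using g
proof (induction k arbitrary: g C)
  case 0
  have pw: "fourier_coeff (\<lambda>\<zeta>. \<phi> \<zeta> ^ N) 0 = fourier_coeff \<phi> 0 ^ N" for N
  proof (induction N)
    case (Suc N)
    then show ?case using fourier_coeff_0_mult[OF \<phi> Hinf_H2[OF Hinf_power[OF \<phi>]], of N] by simp
  qed (simp add: fourier_coeff_const)
  have lim: "(\<lambda>N. cmod (fourier_coeff \<phi> 0) ^ N * C) \<longlonglongrightarrow> 0"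
    using tendsto_mult[OF LIMSEQ_power_zero tendsto_const, of "cmod (fourier_coeff \<phi> 0)" C] c by simp
  have "cmod (fourier_coeff (\<lambda>\<zeta>. \<phi> \<zeta> ^ N * g N \<zeta>) 0) \<le> cmod (fourier_coeff \<phi> 0) ^ N * C" for N
    unfolding fourier_coeff_0_mult[OF Hinf_power[OF \<phi>] 0(1)] pw norm_mult norm_power
    using cmod_fourier_coeff_le[OF H2_L2[OF 0(1)], of N 0] 0(2)[of N]
    by (intro mult_left_mono) auto
  then show ?case
    unfolding of_nat_0 by (intro Lim_null_comparison[OF always_eventually lim] allI)
next
  case (Suc k)
  let ?k = "int (Suc k)" and ?c = "fourier_coeff \<phi> 0"
  have P: "(\<lambda>\<zeta>. \<phi> \<zeta> ^ N) \<in> Hinf" for N by (rule Hinf_power[OF \<phi>])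
  have split: "fourier_coeff (\<lambda>\<zeta>. \<phi> \<zeta> ^ N * h \<zeta>) ?k =
      fourier_coeff h 0 * fourier_coeff (\<lambda>\<zeta>. \<phi> \<zeta> ^ N) ?k +
      fourier_coeff (\<lambda>\<zeta>. \<phi> \<zeta> ^ N * backward_shift h \<zeta>) (int k)" if h: "h \<in> H2" for h N
  proof -
    have m: "(\<lambda>\<zeta>. \<phi> \<zeta> ^ N * backward_shift h \<zeta>) \<in> H2"
      by (intro Hinf_mult_H2 P backward_shift_H2 h)
    have "fourier_coeff (\<lambda>\<zeta>. \<phi> \<zeta> ^ N * h \<zeta>) ?k =
      fourier_coeff (\<lambda>\<zeta>. fourier_coeff h 0 * \<phi> \<zeta> ^ N + \<zeta> * (\<phi> \<zeta> ^ N * backward_shift h \<zeta>)) ?k"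
    proof (rule fourier_coeff_cong)
      fix \<zeta> :: complex assume "cmod \<zeta> = 1"
      from backward_shift_eq[OF this, of h]
      have e: "h \<zeta> = fourier_coeff h 0 + \<zeta> * backward_shift h \<zeta>" by simp
      show "\<phi> \<zeta> ^ N * h \<zeta> = fourier_coeff h 0 * \<phi> \<zeta> ^ N + \<zeta> * (\<phi> \<zeta> ^ N * backward_shift h \<zeta>)"
        by (subst e) (simp add: algebra_simps)
    qed
    also have "\<dots> = fourier_coeff h 0 * fourier_coeff (\<lambda>\<zeta>. \<phi> \<zeta> ^ N) ?k +
        fourier_coeff (\<lambda>\<zeta>. \<zeta> * (\<phi> \<zeta> ^ N * backward_shift h \<zeta>)) ?k"
      unfolding fourier_coeff_add[OF L2_cmult[OF H2_L2[OF Hinf_H2[OF P]]] H2_L2[OF H2_id_mult[OF m]]]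
        fourier_coeff_cmult ..
    finally show ?thesis by (simp add: fourier_coeff_id_mult)
  qed
  have x: "(\<lambda>N. fourier_coeff (\<lambda>\<zeta>. \<phi> \<zeta> ^ N) ?k) \<longlonglongrightarrow> 0"
  proof (rule tendsto_0_geometric_recursion[OF c])
    show "fourier_coeff (\<lambda>\<zeta>. \<phi> \<zeta> ^ Suc N) ?k = ?c * fourier_coeff (\<lambda>\<zeta>. \<phi> \<zeta> ^ N) ?k +
        fourier_coeff (\<lambda>\<zeta>. \<phi> \<zeta> ^ N * backward_shift \<phi> \<zeta>) (int k)" for N
      using split[OF Hinf_H2[OF \<phi>], of N] by (simp add: mult.commute)
    show "(\<lambda>N. fourier_coeff (\<lambda>\<zeta>. \<phi> \<zeta> ^ N * backward_shift \<phi> \<zeta>) (int k)) \<longlonglongrightarrow> 0"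
      by (rule Suc.IH) (auto intro: backward_shift_H2 Hinf_H2 \<phi>)
  qed
  have "(\<lambda>N. fourier_coeff (g N) 0 * fourier_coeff (\<lambda>\<zeta>. \<phi> \<zeta> ^ N) ?k) \<longlonglongrightarrow> 0"
  proof (rule Lim_null_comparison)
    show "(\<lambda>N. C * cmod (fourier_coeff (\<lambda>\<zeta>. \<phi> \<zeta> ^ N) ?k)) \<longlonglongrightarrow> 0"
      using tendsto_mult[OF tendsto_const[of C] tendsto_norm[OF x]] by simp
    have "cmod (fourier_coeff (g N) 0) \<le> C" for N
      using cmod_fourier_coeff_le[OF H2_L2[OF Suc.prems(1)], of N 0] Suc.prems(2)[of N] by simp
    then show "eventually (\<lambda>N. norm (fourier_coeff (g N) 0 * fourier_coeff (\<lambda>\<zeta>. \<phi> \<zeta> ^ N) ?k)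
        \<le> C * cmod (fourier_coeff (\<lambda>\<zeta>. \<phi> \<zeta> ^ N) ?k)) sequentially"
      unfolding norm_mult by (intro always_eventually allI mult_right_mono) auto
  qed
  moreover have "(\<lambda>N. fourier_coeff (\<lambda>\<zeta>. \<phi> \<zeta> ^ N * backward_shift (g N) \<zeta>) (int k)) \<longlonglongrightarrow> 0"
  proof (rule Suc.IH)
    show "backward_shift (g N) \<in> H2" for N by (intro backward_shift_H2 Suc.prems)
    show "L2_norm (backward_shift (g N)) \<le> 2 * C" for N
      using L2_norm_backward_shift_le[OF H2_L2[OF Suc.prems(1)]] Suc.prems(2)[of N]
      by (meson mult_left_mono order_trans zero_le_numeral)
  qed
  ultimately have "(\<lambda>N. fourier_coeff (g N) 0 * fourier_coeff (\<lambda>\<zeta>. \<phi> \<zeta> ^ N) ?k +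
     fourier_coeff (\<lambda>\<zeta>. \<phi> \<zeta> ^ N * backward_shift (g N) \<zeta>) (int k)) \<longlonglongrightarrow> 0 + 0"
    by (rule tendsto_add)
  then show ?case using split[OF Suc.prems(1)] by simp
qed

lemma mult_op_power: "(mult_op \<phi> ^^ n) f = (\<lambda>\<zeta>. \<phi> \<zeta> ^ n * f \<zeta>)"
  by (induction n) (simp_all add: mult_op_def mult_ac)

text \<open>
  An orthonormal basis \<open>f 1, \<dots>, f d\<close> of the wandering subspace \<open>H2 \<ominus> \<phi> H2\<close>; spanning is stated as
  the division with remainder \<open>H2 = span f + \<phi> H2\<close>.
\<close>

definition wandering_basis :: "(complex \<Rightarrow> complex) \<Rightarrow> nat \<Rightarrow> (nat \<Rightarrow> complex \<Rightarrow> complex) \<Rightarrow> bool" where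
  "wandering_basis \<phi> d f \<longleftrightarrow>
     (\<forall>i\<in>{1..d}. f i \<in> H2) \<and>
     (\<forall>i\<in>{1..d}. \<forall>j\<in>{1..d}. L2_inner (f i) (f j) = (if i = j then 1 else 0)) \<and>
     (\<forall>i\<in>{1..d}. \<forall>h\<in>H2. L2_inner (f i) (\<lambda>\<zeta>. \<phi> \<zeta> * h \<zeta>) = 0) \<and>
     (\<forall>y\<in>H2. \<exists>c. \<exists>z\<in>H2. AE \<zeta> in circle_measure. y \<zeta> = (\<Sum>i=1..d. c i * f i \<zeta>) + \<phi> \<zeta> * z \<zeta>)"

lemma wandering_basis_cong_AE:
  assumes wb: "wandering_basis \<psi> d f" and \<psi>: "\<psi> \<in> Hinf" and \<phi>: "\<phi> \<in> Hinf"
    and ae: "AE \<zeta> in circle_measure. \<phi> \<zeta> = \<psi> \<zeta>"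
  shows "wandering_basis \<phi> d f"
proof -
  have "L2_inner (f i) (\<lambda>\<zeta>. \<phi> \<zeta> * h \<zeta>) = 0" if "i \<in> {1..d}" "h \<in> H2" for i h
  proof -
    have "L2_inner (f i) (\<lambda>\<zeta>. \<phi> \<zeta> * h \<zeta>) = L2_inner (f i) (\<lambda>\<zeta>. \<psi> \<zeta> * h \<zeta>)"
    proof (rule L2_inner_cong_AE)
      show "AE \<zeta> in circle_measure. f i \<zeta> * cnj (\<phi> \<zeta> * h \<zeta>) = f i \<zeta> * cnj (\<psi> \<zeta> * h \<zeta>)"
        using ae by eventually_elim simp
      show "f i \<in> L2_circle" "f i \<in> L2_circle"
        using wb that by (auto simp: wandering_basis_def intro: H2_L2)
    qed (use that \<phi> \<psi> in \<open>auto intro!: H2_L2 Hinf_mult_H2\<close>)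
    then show ?thesis using wb that by (simp add: wandering_basis_def)
  qed
  moreover have "\<exists>c. \<exists>z\<in>H2. AE \<zeta> in circle_measure. y \<zeta> = (\<Sum>i=1..d. c i * f i \<zeta>) + \<phi> \<zeta> * z \<zeta>"
    if y: "y \<in> H2" for y
  proof -
    obtain c z where z: "z \<in> H2" and
      "AE \<zeta> in circle_measure. y \<zeta> = (\<Sum>i=1..d. c i * f i \<zeta>) + \<psi> \<zeta> * z \<zeta>"
      using wb y unfolding wandering_basis_def by blast
    from this(2) ae have "AE \<zeta> in circle_measure. y \<zeta> = (\<Sum>i=1..d. c i * f i \<zeta>) + \<phi> \<zeta> * z \<zeta>"
      by eventually_elim simp
    with z show ?thesis by blast
  qed
  ultimately show ?thesis using wb unfolding wandering_basis_def by blast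
qed

text \<open>
  The Takenaka--Malmquist system: the \<open>i\<close>-th vector is the normalised Szego kernel at \<open>a i\<close> times the
  first \<open>i - 1\<close> Blaschke factors.  Each further factor \<open>b\<close> splits the quotient of the previous division into
  a multiple of its kernel and a multiple of \<open>b\<close>.
\<close>

lemma blaschke_product_wandering_basis:
  assumes c: "cmod c = 1" and a: "\<And>j. j \<in> {1..d} \<Longrightarrow> cmod (a j) < 1"
  defines "B \<equiv> \<lambda>n \<zeta>. c * (\<Prod>j=1..n. blaschke_factor (a j) \<zeta>)"
  shows "\<exists>f. wandering_basis (B d) d f"
    and "B d \<in> Hinf"
    and "\<And>\<zeta>. cmod \<zeta> = 1 \<Longrightarrow> cmod (B d \<zeta>) = 1"
    and "fourier_coeff (B d) 0 = c * (\<Prod>j=1..d. - a j)"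
proof -
  define f where "f i = (\<lambda>\<zeta>. B (i - 1) \<zeta> * (sqrt (1 - (cmod (a i))\<^sup>2) * szego (a i) \<zeta>))" for i
  have B_Suc: "B (Suc n) = (\<lambda>\<zeta>. B n \<zeta> * blaschke_factor (a (Suc n)) \<zeta>)" for n
    by (simp add: B_def mult.assoc)
  have "wandering_basis (B n) n f \<and> B n \<in> Hinf \<and> (\<forall>\<zeta>. cmod \<zeta> = 1 \<longrightarrow> cmod (B n \<zeta>) = 1) \<and>
      fourier_coeff (B n) 0 = c * (\<Prod>j=1..n. - a j)" if "n \<le> d" for n
    using that
  proof (induction n)
    case 0
    have B0: "B 0 = (\<lambda>\<zeta>. c)" by (simp add: B_def)
    have "\<exists>z\<in>H2. AE \<zeta> in circle_measure. y \<zeta> = c * z \<zeta>" if "y \<in> H2" for y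
    proof (intro bexI[of _ "\<lambda>\<zeta>. inverse c * y \<zeta>"] H2_cmult that)
      have "c \<noteq> 0" using c by auto
      then show "AE \<zeta> in circle_measure. y \<zeta> = c * (inverse c * y \<zeta>)" by simp
    qed
    then show ?case using c by (simp add: B0 wandering_basis_def fourier_coeff_const)
  next
    case (Suc n)
    let ?b = "blaschke_factor (a (Suc n))" and ?u = "szego (a (Suc n))"
      and ?s = "complex_of_real (sqrt (1 - (cmod (a (Suc n)))\<^sup>2))"
    have an: "cmod (a (Suc n)) < 1" using a Suc.prems by auto
    have wb: "wandering_basis (B n) n f" and BH: "B n \<in> Hinf"
      and B1: "\<And>\<zeta>. cmod \<zeta> = 1 \<Longrightarrow> cmod (B n \<zeta>) = 1"
      and B0: "fourier_coeff (B n) 0 = c * (\<Prod>j=1..n. - a j)"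
      using Suc by auto
    have bH: "?b \<in> Hinf" by (rule blaschke_factor_Hinf[OF an])
    have BH': "B (Suc n) \<in> Hinf" unfolding B_Suc by (rule Hinf_mult[OF BH bH])
    have B1': "\<And>\<zeta>. cmod \<zeta> = 1 \<Longrightarrow> cmod (B (Suc n) \<zeta>) = 1"
      by (simp add: B_Suc norm_mult B1 cmod_blaschke_factor an)
    have B0': "fourier_coeff (B (Suc n)) 0 = c * (\<Prod>j=1..Suc n. - a j)"
      unfolding B_Suc fourier_coeff_0_mult[OF BH Hinf_H2[OF bH]] B0 blaschke_factor_coeff_0[OF an]
      by simp
    have fn: "f (Suc n) = (\<lambda>\<zeta>. B n \<zeta> * (?s * ?u \<zeta>))" by (simp add: f_def)
    have eH: "(\<lambda>\<zeta>. ?s * ?u \<zeta>) \<in> H2" by (intro H2_cmult szego_H2 an)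
    have fH: "f (Suc n) \<in> H2" unfolding fn by (rule Hinf_mult_H2[OF BH eH])
    have inner_B: "L2_inner (\<lambda>\<zeta>. B n \<zeta> * g \<zeta>) (\<lambda>\<zeta>. B n \<zeta> * h \<zeta>) = L2_inner g h"
      if "g \<in> L2_circle" "h \<in> L2_circle" for g h
      by (rule L2_inner_unimodular_mult)
        (use that BH B1 in \<open>auto intro: AE_circle L2_measurable H2_L2 Hinf_H2\<close>)
    have norm: "L2_inner (f (Suc n)) (f (Suc n)) = 1"
    proof -
      have "1 - (cmod (a (Suc n)))\<^sup>2 \<ge> 0"
        using an by (simp add: power_le_one)
      then have ss: "?s * ?s = of_real (1 - (cmod (a (Suc n)))\<^sup>2)"
        by (simp flip: of_real_mult)
      have "L2_inner (f (Suc n)) (f (Suc n)) = ?s * ?s * L2_inner ?u ?u"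
        unfolding fn inner_B[OF H2_L2[OF eH] H2_L2[OF eH]]
        by (simp add: L2_inner_cmult_left L2_inner_cmult_right)
      also have "\<dots> = of_real ((1 - (cmod (a (Suc n)))\<^sup>2) * (L2_norm ?u)\<^sup>2)"
        unfolding ss L2_inner_self by simp
      finally show ?thesis unfolding szego_norm[OF an] by simp
    qed
    have old_new: "L2_inner (f i) (\<lambda>\<zeta>. B n \<zeta> * h \<zeta>) = 0" if "i \<in> {1..n}" "h \<in> H2" for i h
      using wb that by (auto simp: wandering_basis_def)
    have orth: "L2_inner (f i) (\<lambda>\<zeta>. B (Suc n) \<zeta> * h \<zeta>) = 0" if i: "i \<in> {1..Suc n}" and h: "h \<in> H2" for i h
    proof (cases "i = Suc n")
      case True
      have bh: "(\<lambda>\<zeta>. ?b \<zeta> * h \<zeta>) \<in> H2" by (rule Hinf_mult_H2[OF bH h])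
      have "L2_inner (f (Suc n)) (\<lambda>\<zeta>. B n \<zeta> * (?b \<zeta> * h \<zeta>)) = ?s * L2_inner ?u (\<lambda>\<zeta>. ?b \<zeta> * h \<zeta>)"
        unfolding fn inner_B[OF H2_L2[OF eH] H2_L2[OF bh]] by (rule L2_inner_cmult_left)
      also have "\<dots> = 0"
        by (subst L2_inner_commute) (simp add: szego_annihilates_blaschke[OF an h])
      finally show ?thesis by (simp add: True B_Suc mult.assoc)
    next
      case False
      then show ?thesis
        using old_new[of i "\<lambda>\<zeta>. ?b \<zeta> * h \<zeta>"] i Hinf_mult_H2[OF bH h]
        by (simp add: B_Suc mult.assoc)
    qed
    have on: "L2_inner (f i) (f j) = (if i = j then 1 else 0)"
      if ij: "i \<in> {1..Suc n}" "j \<in> {1..Suc n}" for i j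
    proof -
      have new: "L2_inner (f k) (f (Suc n)) = 0" if "k \<in> {1..n}" for k
        unfolding fn by (rule old_new[OF that eH])
      consider "i = Suc n" "j = Suc n" | "i = Suc n" "j \<in> {1..n}" | "i \<in> {1..n}" "j = Suc n"
        | "i \<in> {1..n}" "j \<in> {1..n}"
        using ij by fastforce
      then show ?thesis
      proof cases
        case 2
        then show ?thesis using new[of j] L2_inner_commute[of "f (Suc n)" "f j"] by auto
      next
        case 4
        then show ?thesis using wb by (auto simp: wandering_basis_def)
      qed (use norm new in auto)
    qed
    have decomp: "\<exists>c. \<exists>z\<in>H2. AE \<zeta> in circle_measure.
        y \<zeta> = (\<Sum>i=1..Suc n. c i * f i \<zeta>) + B (Suc n) \<zeta> * z \<zeta>" if y: "y \<in> H2" for y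
    proof -
      obtain c z where z: "z \<in> H2" and
        yz: "AE \<zeta> in circle_measure. y \<zeta> = (\<Sum>i=1..n. c i * f i \<zeta>) + B n \<zeta> * z \<zeta>"
        using wb y unfolding wandering_basis_def by blast
      obtain w k where w: "w \<in> H2" and zw: "\<And>\<zeta>. cmod \<zeta> = 1 \<Longrightarrow> z \<zeta> = k * ?u \<zeta> + ?b \<zeta> * w \<zeta>"
        using blaschke_factor_split[OF an z] by blast
      have s0: "?s \<noteq> 0" using an by (simp add: abs_square_eq_1)
      have "AE \<zeta> in circle_measure. cmod \<zeta> = 1" by (rule AE_circle)
      with yz have "AE \<zeta> in circle_measure.
          y \<zeta> = (\<Sum>i=1..Suc n. (c(Suc n := k / ?s)) i * f i \<zeta>) + B (Suc n) \<zeta> * w \<zeta>"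
      proof eventually_elim
        case (elim \<zeta>)
        have "(\<Sum>i=1..n. (c(Suc n := k / ?s)) i * f i \<zeta>) = (\<Sum>i=1..n. c i * f i \<zeta>)"
          by (intro sum.cong) auto
        then show ?case
          using elim s0 by (simp add: zw[OF elim(2)] B_Suc fn algebra_simps)
      qed
      with w show ?thesis by blast
    qed
    have fall: "f i \<in> H2" if "i \<in> {1..Suc n}" for i
      using wb fH that by (cases "i = Suc n") (auto simp: wandering_basis_def)
    have "wandering_basis (B (Suc n)) (Suc n) f"
      unfolding wandering_basis_def using fall on orth decomp by blast
    then show ?case using BH' B1' B0' by blast
  qed
  from this[OF order_refl] show "\<exists>f. wandering_basis (B d) d f" "B d \<in> Hinf"
    "\<And>\<zeta>. cmod \<zeta> = 1 \<Longrightarrow> cmod (B d \<zeta>) = 1" "fourier_coeff (B d) 0 = c * (\<Prod>j=1..d. - a j)"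
    by auto
qed

text \<open>
  The orbits of the wandering vectors are orthonormal since \<open>\<phi>\<close> acts isometrically, and dividing
  \<open>N\<close> times leaves the remainder \<open>\<phi> ^ N * z\<close> with \<open>z\<close> no longer than \<open>y\<close>.  Its squared norm is its
  inner product with \<open>y\<close>, hence nearly with a polynomial, and that tends to zero because
  each Fourier coefficient does.
\<close>

lemma wandering_basis_orbits:
  assumes wb: "wandering_basis \<phi> d f" and \<phi>: "\<phi> \<in> Hinf"
    and uni: "AE \<zeta> in circle_measure. cmod (\<phi> \<zeta>) = 1" and c0: "cmod (fourier_coeff \<phi> 0) < 1"
  shows "orthonormal_basis_H2 ({1..d} \<times> (UNIV :: nat set)) (\<lambda>(i, n). (mult_op \<phi> ^^ n) (f i))"
proof -
  define x where "x i n = (\<lambda>\<zeta>. \<phi> \<zeta> ^ n * f i \<zeta>)" for i n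
  have f: "f i \<in> H2" if "i \<in> {1..d}" for i
    using wb that by (auto simp: wandering_basis_def)
  have P: "(\<lambda>\<zeta>. \<phi> \<zeta> ^ n) \<in> Hinf" for n by (rule Hinf_power[OF \<phi>])
  have Pm: "(\<lambda>\<zeta>. \<phi> \<zeta> ^ n) \<in> borel_measurable circle_measure" for n by (intro L2_measurable H2_L2 Hinf_H2 P)
  have Pu: "AE \<zeta> in circle_measure. cmod (\<phi> \<zeta> ^ n) = 1" for n
    using uni by eventually_elim (simp add: norm_power)
  have xH: "x i n \<in> H2" if "i \<in> {1..d}" for i n
    unfolding x_def by (intro Hinf_mult_H2 P f that)
  have wander: "L2_inner (f i) (\<lambda>\<zeta>. \<phi> \<zeta> * h \<zeta>) = 0" if "i \<in> {1..d}" "h \<in> H2" for i h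
    using wb that by (auto simp: wandering_basis_def)
  have inner_P: "L2_inner (\<lambda>\<zeta>. \<phi> \<zeta> ^ n * g \<zeta>) (\<lambda>\<zeta>. \<phi> \<zeta> ^ n * h \<zeta>) = L2_inner g h"
    if "g \<in> L2_circle" "h \<in> L2_circle" for n g h
    by (rule L2_inner_unimodular_mult[OF Pm Pu that])
  have later: "L2_inner (x i n) (\<lambda>\<zeta>. \<phi> \<zeta> ^ n' * h \<zeta>) = 0"
    if i: "i \<in> {1..d}" and n: "n < n'" and h: "h \<in> H2" for i n n' h
  proof -
    define m where "m = n' - n - 1"
    have n': "n' = n + Suc m" using n by (simp add: m_def)
    have mh: "(\<lambda>\<zeta>. \<phi> \<zeta> ^ m * h \<zeta>) \<in> H2" by (intro Hinf_mult_H2 P h)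
    have "L2_inner (x i n) (\<lambda>\<zeta>. \<phi> \<zeta> ^ n' * h \<zeta>) =
        L2_inner (\<lambda>\<zeta>. \<phi> \<zeta> ^ n * f i \<zeta>) (\<lambda>\<zeta>. \<phi> \<zeta> ^ n * (\<phi> \<zeta> * (\<phi> \<zeta> ^ m * h \<zeta>)))"
      by (simp add: x_def n' power_add mult_ac)
    also have "\<dots> = 0"
      unfolding inner_P[OF H2_L2[OF f[OF i]] H2_L2[OF Hinf_mult_H2[OF \<phi> mh]]]
      by (rule wander[OF i mh])
    finally show ?thesis .
  qed
  have orthonormal: "L2_inner (x i n) (x i' n') = (if (i, n) = (i', n') then 1 else 0)"
    if i: "i \<in> {1..d}" "i' \<in> {1..d}" for i n i' n'
  proof -
    consider "n < n'" | "n' < n" | "n = n'" by linarith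
    then show ?thesis
    proof cases
      case 1
      then show ?thesis using later[OF i(1) 1 f[OF i(2)]] by (simp add: x_def)
    next
      case 2
      then show ?thesis
        using later[OF i(2) 2 f[OF i(1)]] L2_inner_commute[of "x i n" "x i' n'"] by (simp add: x_def)
    next
      case 3
      then show ?thesis
        using wb i unfolding x_def by (simp add: inner_P H2_L2 f wandering_basis_def)
    qed
  qed
  have dense: "\<exists>F c. finite F \<and> F \<subseteq> {1..d} \<times> UNIV \<and>
      L2_norm (\<lambda>\<zeta>. y \<zeta> - (\<Sum>j\<in>F. c j * (case j of (i, n) \<Rightarrow> x i n) \<zeta>)) < \<epsilon>"
    if y: "y \<in> H2" and e: "\<epsilon> > 0" for y and \<epsilon> :: real
  proof -
    have "\<exists>c. \<exists>z\<in>H2. AE \<zeta> in circle_measure.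
        y \<zeta> = (\<Sum>n<N. \<Sum>i=1..d. c n i * x i n \<zeta>) + \<phi> \<zeta> ^ N * z \<zeta>" for N
    proof (induction N)
      case 0
      then show ?case by (intro exI bexI[OF _ y]) simp
    next
      case (Suc N)
      then obtain c z where z: "z \<in> H2" and
        yz: "AE \<zeta> in circle_measure. y \<zeta> = (\<Sum>n<N. \<Sum>i=1..d. c n i * x i n \<zeta>) + \<phi> \<zeta> ^ N * z \<zeta>"
        by blast
      obtain k w where w: "w \<in> H2" and
        zw: "AE \<zeta> in circle_measure. z \<zeta> = (\<Sum>i=1..d. k i * f i \<zeta>) + \<phi> \<zeta> * w \<zeta>"
        using wb z unfolding wandering_basis_def by blast
      from yz zw have "AE \<zeta> in circle_measure. y \<zeta> =
          (\<Sum>n<Suc N. \<Sum>i=1..d. (c(N := k)) n i * x i n \<zeta>) + \<phi> \<zeta> ^ Suc N * w \<zeta>"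
      proof eventually_elim
        case (elim \<zeta>)
        have "\<phi> \<zeta> ^ N * z \<zeta> = (\<Sum>i=1..d. k i * x i N \<zeta>) + \<phi> \<zeta> ^ Suc N * w \<zeta>"
          by (simp add: elim(2) distrib_left sum_distrib_left x_def mult_ac)
        moreover have "(\<Sum>n<N. \<Sum>i=1..d. (c(N := k)) n i * x i n \<zeta>) = (\<Sum>n<N. \<Sum>i=1..d. c n i * x i n \<zeta>)"
          by (intro sum.cong) auto
        ultimately show ?case using elim(1) by simp
      qed
      with w show ?case by blast
    qed
    then have "\<forall>N. \<exists>c z. z \<in> H2 \<and> (AE \<zeta> in circle_measure.
        y \<zeta> = (\<Sum>n<N. \<Sum>i=1..d. c n i * x i n \<zeta>) + \<phi> \<zeta> ^ N * z \<zeta>)"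
      by blast
    from choice[OF this] obtain c where "\<forall>N. \<exists>z. z \<in> H2 \<and> (AE \<zeta> in circle_measure.
        y \<zeta> = (\<Sum>n<N. \<Sum>i=1..d. c N n i * x i n \<zeta>) + \<phi> \<zeta> ^ N * z \<zeta>)" ..
    from choice[OF this] obtain z where z: "\<And>N. z N \<in> H2" and
      yz: "\<And>N. AE \<zeta> in circle_measure.
        y \<zeta> = (\<Sum>n<N. \<Sum>i=1..d. c N n i * x i n \<zeta>) + \<phi> \<zeta> ^ N * z N \<zeta>" by blast
    define S where "S N = (\<lambda>\<zeta>. \<Sum>n<N. \<Sum>i=1..d. c N n i * x i n \<zeta>)" for N
    define R where "R N = (\<lambda>\<zeta>. \<phi> \<zeta> ^ N * z N \<zeta>)" for N
    have SH: "S N \<in> H2" for N unfolding S_def by (intro H2_sum H2_cmult xH) 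
    have RH: "R N \<in> H2" for N unfolding R_def by (intro Hinf_mult_H2 P z)
    have yS: "L2_norm (\<lambda>\<zeta>. y \<zeta> - S N \<zeta>) = L2_norm (R N)" for N
    proof (rule L2_norm_cong_AE)
      show "AE \<zeta> in circle_measure. cmod (y \<zeta> - S N \<zeta>) = cmod (R N \<zeta>)"
        using yz[of N] by eventually_elim (simp add: S_def R_def)
    qed (intro L2_diff H2_L2 y SH RH)+
    have Rnorm: "L2_norm (R N) = L2_norm (z N)" for N
      using inner_P[OF H2_L2[OF z] H2_L2[OF z], of N N N] unfolding R_def[symmetric] L2_inner_self
      by (simp del: of_real_power)
    have xR: "L2_inner (x i n) (R N) = 0" if "i \<in> {1..d}" "n < N" for i n N
      unfolding R_def by (rule later[OF that z])
    have SR: "L2_inner (S N) (R N) = 0" for N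
    proof -
      have level: "L2_inner (\<lambda>\<zeta>. \<Sum>i=1..d. c N n i * x i n \<zeta>) (R N) = 0" if "n < N" for n
      proof -
        have "L2_inner (\<lambda>\<zeta>. \<Sum>i=1..d. c N n i * x i n \<zeta>) (R N) =
            (\<Sum>i=1..d. c N n i * L2_inner (x i n) (R N))"
          by (intro L2_inner_lincomb_left H2_L2 xH RH)
        then show ?thesis using xR that by simp
      qed
      have "L2_inner (S N) (R N) = (\<Sum>n<N. L2_inner (\<lambda>\<zeta>. \<Sum>i=1..d. c N n i * x i n \<zeta>) (R N))"
        unfolding S_def by (intro L2_inner_sum_left L2_sum L2_cmult H2_L2 xH RH)
      then show ?thesis using level by simp
    qed
    have yR: "L2_inner y (R N) = of_real ((L2_norm (R N))\<^sup>2)" for N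
    proof -
      have "L2_inner y (R N) = L2_inner (\<lambda>\<zeta>. S N \<zeta> + R N \<zeta>) (R N)"
      proof (rule L2_inner_cong_AE)
        show "AE \<zeta> in circle_measure. y \<zeta> * cnj (R N \<zeta>) = (S N \<zeta> + R N \<zeta>) * cnj (R N \<zeta>)"
          using yz[of N] by eventually_elim (simp add: S_def R_def)
      qed (intro L2_add H2_L2 y SH RH)+
      then show ?thesis
        by (simp add: L2_inner_add_left H2_L2 SH RH SR L2_inner_self)
    qed
    have Rle: "L2_norm (R N) \<le> L2_norm y" for N
    proof (cases "L2_norm (R N) = 0")
      case False
      have "L2_norm (R N) * L2_norm (R N) \<le> L2_norm y * L2_norm (R N)"
        using L2_Cauchy_Schwarz[OF H2_L2[OF y] H2_L2[OF RH[of N]]]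
        unfolding yR norm_of_real by (simp add: power2_eq_square)
      then show ?thesis using False by (metis L2_norm_nonneg less_le mult_right_le_imp_le)
    qed simp
    have "\<epsilon>\<^sup>2 / (2 * (L2_norm y + 1)) > 0"
      using e by (simp add: add_nonneg_pos)
    then obtain q where q: "L2_norm (\<lambda>\<zeta>. y \<zeta> - poly q \<zeta>) < \<epsilon>\<^sup>2 / (2 * (L2_norm y + 1))"
      using H2_poly_dense[OF y] by blast
    have "(\<lambda>N. \<Sum>i\<le>degree q. cnj (coeff q i) * fourier_coeff (R N) (int i)) \<longlonglongrightarrow> (\<Sum>i\<le>degree q. cnj (coeff q i) * 0)"
    proof (intro tendsto_sum tendsto_mult tendsto_const)
      fix i
      show "(\<lambda>N. fourier_coeff (R N) (int i)) \<longlonglongrightarrow> 0"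
        unfolding R_def
        by (rule fourier_coeff_power_mult_tendsto_0[OF \<phi> c0 z, where C = "L2_norm y"]) (use Rle Rnorm in simp)
    qed
    then have "(\<lambda>N. L2_inner (R N) (poly q)) \<longlonglongrightarrow> 0"
      by (simp add: L2_inner_poly_right H2_L2 RH)
    from LIMSEQ_D[OF this, of "\<epsilon>\<^sup>2 / 2"] e
    obtain N where N: "cmod (L2_inner (R N) (poly q)) < \<epsilon>\<^sup>2 / 2" by auto
    have "complex_of_real ((L2_norm (R N))\<^sup>2) =
        L2_inner (\<lambda>\<zeta>. y \<zeta> - poly q \<zeta>) (R N) + cnj (L2_inner (R N) (poly q))"
      unfolding yR[symmetric]
      by (simp add: L2_inner_diff_left H2_L2 y RH L2_inner_commute[symmetric])
    then have "(L2_norm (R N))\<^sup>2 \<le> cmod (L2_inner (\<lambda>\<zeta>. y \<zeta> - poly q \<zeta>) (R N)) + cmod (L2_inner (R N) (poly q))"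
      by (metis complex_mod_cnj norm_of_real norm_triangle_ineq abs_of_nonneg zero_le_power2)
    also have "cmod (L2_inner (\<lambda>\<zeta>. y \<zeta> - poly q \<zeta>) (R N)) \<le> L2_norm (\<lambda>\<zeta>. y \<zeta> - poly q \<zeta>) * L2_norm (R N)"
      by (intro L2_Cauchy_Schwarz L2_diff H2_L2 y RH L2_poly)
    also have "\<dots> \<le> \<epsilon>\<^sup>2 / (2 * (L2_norm y + 1)) * (L2_norm y + 1)"
      by (intro mult_mono) (use q Rle[of N] in \<open>auto simp: add_nonneg_nonneg\<close>)
    also have "\<dots> = \<epsilon>\<^sup>2 / 2"
    proof -
      have "L2_norm y + 1 \<noteq> 0" using L2_norm_nonneg[of y] by linarith
      then show ?thesis by (metis nonzero_mult_divide_mult_cancel_right times_divide_eq_left)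
    qed
    finally have "(L2_norm (R N))\<^sup>2 < \<epsilon>\<^sup>2" using N by simp
    then have "L2_norm (R N) < \<epsilon>"
      using power2_less_imp_less[of "L2_norm (R N)" \<epsilon>] e by simp
    then have lt: "L2_norm (\<lambda>\<zeta>. y \<zeta> - S N \<zeta>) < \<epsilon>"
      by (simp only: yS)
    have "S N \<zeta> = (\<Sum>j\<in>{1..d} \<times> {..<N}. (case j of (i, n) \<Rightarrow> c N n i) * (case j of (i, n) \<Rightarrow> x i n) \<zeta>)" for \<zeta>
      unfolding S_def by (subst sum.swap) (simp add: sum.cartesian_product case_prod_unfold)
    with lt show ?thesis
      by (intro exI[of _ "{1..d} \<times> {..<N}"] exI[of _ "\<lambda>j. case j of (i, n) \<Rightarrow> c N n i"]) auto
  qed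
  show ?thesis
    unfolding mult_op_power x_def[symmetric] orthonormal_basis_H2_def
    using xH orthonormal dense by auto
qed

lemma finite_blaschke_product_orbits:
  assumes \<phi>: "\<phi> \<in> Hinf" and bl: "finite_blaschke_product \<phi>"
  obtains d :: nat and f where "\<And>i. i \<in> {1..d} \<Longrightarrow> f i \<in> H2"
    "orthonormal_basis_H2 ({1..d} \<times> (UNIV :: nat set)) (\<lambda>(i, n). (mult_op \<phi> ^^ n) (f i))"
proof -
  obtain d :: nat and c a where d: "d \<ge> 1" and c: "cmod c = 1" and a_all: "\<forall>j\<in>{1..d}. cmod (a j) < 1"
    and ae: "AE \<zeta> in circle_measure. \<phi> \<zeta> = c * (\<Prod>j=1..d. (\<zeta> - a j) / (1 - cnj (a j) * \<zeta>))"
    using bl unfolding finite_blaschke_product_def mem_ball_0 by blast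
  have a: "\<And>j. j \<in> {1..d} \<Longrightarrow> cmod (a j) < 1" using a_all by blast
  define B where "B = (\<lambda>\<zeta>. c * (\<Prod>j=1..d. blaschke_factor (a j) \<zeta>))"
  have ae': "AE \<zeta> in circle_measure. \<phi> \<zeta> = B \<zeta>"
    using ae unfolding B_def blaschke_factor_def .
  note B = blaschke_product_wandering_basis[of c d a, OF c a, folded B_def]
  obtain f where wbB: "wandering_basis B d f" using B(1) by blast
  have wb: "wandering_basis \<phi> d f"
    by (rule wandering_basis_cong_AE[OF wbB B(2) \<phi> ae'])
  have "AE \<zeta> in circle_measure. cmod \<zeta> = 1" by (rule AE_circle)
  with ae' have uni: "AE \<zeta> in circle_measure. cmod (\<phi> \<zeta>) = 1"
    by eventually_elim (use B(3) in \<open>simp add: B_def\<close>)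
  have "fourier_coeff \<phi> 0 = c * (\<Prod>j=1..d. - a j)"
    using fourier_coeff_cong_AE[OF ae'] B(2,4) \<phi> by (simp add: H2_L2 Hinf_H2)
  then have "cmod (fourier_coeff \<phi> 0) = (\<Prod>j=1..d. cmod (a j))"
    by (simp add: norm_mult c flip: prod_norm)
  also have "\<dots> = cmod (a 1) * (\<Prod>j\<in>{1..d} - {1}. cmod (a j))"
    using d by (intro prod.remove) auto
  also have "\<dots> \<le> cmod (a 1) * 1"
    using a by (intro mult_left_mono prod_le_1) (auto intro: less_imp_le)
  also have "\<dots> < 1" using a[of 1] d by simp
  finally have "cmod (fourier_coeff \<phi> 0) < 1" .
  from wandering_basis_orbits[OF wb \<phi> uni this] wb show thesis
    by (intro that[of d f]) (auto simp: wandering_basis_def)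
qed

section \<open>Parseval's identity\<close>

text \<open>
  Pythagoras gives the distance of \<open>y\<close> to any finite combination: the part of \<open>\<parallel>y\<parallel>\<^sup>2\<close> missed by the inner
  products plus the error in the coefficients.  Density makes this distance small, so nothing is missed.
\<close>

lemma orthonormal_basis_imp_parseval_frame:
  assumes on: "orthonormal_basis_H2 \<Omega> x" and count: "countable \<Omega>"
  shows "parseval_frame_H2 \<Omega> x"
proof -
  have xH: "x j \<in> H2" if "j \<in> \<Omega>" for j
    using on that by (auto simp: orthonormal_basis_H2_def)
  have xx: "L2_inner (x i) (x j) = (if i = j then 1 else 0)" if "i \<in> \<Omega>" "j \<in> \<Omega>" for i j
    using on that by (auto simp: orthonormal_basis_H2_def)
  have "((\<lambda>j. (cmod (L2_inner y (x j)))\<^sup>2) has_sum (L2_norm y)\<^sup>2) \<Omega>" if y: "y \<in> H2" for y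
  proof -
    let ?a = "\<lambda>j. L2_inner y (x j)"
    have pyth: "(L2_norm (\<lambda>\<zeta>. y \<zeta> - (\<Sum>j\<in>F. c j * x j \<zeta>)))\<^sup>2 =
        (L2_norm y)\<^sup>2 - (\<Sum>j\<in>F. (cmod (?a j))\<^sup>2) + (\<Sum>j\<in>F. (cmod (?a j - c j))\<^sup>2)"
      if F: "finite F" "F \<subseteq> \<Omega>" for F c
    proof -
      let ?s = "\<lambda>\<zeta>. \<Sum>j\<in>F. c j * x j \<zeta>"
      have xL: "\<And>j. j \<in> F \<Longrightarrow> x j \<in> L2_circle" using F xH H2_L2 by blast
      have s: "?s \<in> L2_circle" by (intro L2_sum L2_cmult xL)
      have ys: "L2_inner y ?s = (\<Sum>j\<in>F. cnj (c j) * ?a j)"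
        by (rule L2_inner_lincomb_right[OF xL H2_L2[OF y]])
      have "L2_inner ?s ?s = (\<Sum>j\<in>F. c j * L2_inner (x j) ?s)"
        by (rule L2_inner_lincomb_left[OF xL s])
      also have "\<dots> = (\<Sum>j\<in>F. c j * cnj (c j))"
      proof (rule sum.cong[OF refl])
        fix j assume j: "j \<in> F"
        have "L2_inner (x j) ?s = (\<Sum>i\<in>F. cnj (c i) * L2_inner (x j) (x i))"
          by (rule L2_inner_lincomb_right[OF xL xL[OF j]])
        also have "\<dots> = (\<Sum>i\<in>F. if i = j then cnj (c j) else 0)"
          using F j by (intro sum.cong) (auto simp: xx subset_iff)
        also have "\<dots> = cnj (c j)" using F j by simp
        finally show "c j * L2_inner (x j) ?s = c j * cnj (c j)" by simp
      qed
      finally have ss: "(L2_norm ?s)\<^sup>2 = (\<Sum>j\<in>F. (cmod (c j))\<^sup>2)"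
        unfolding L2_inner_self complex_norm_square[symmetric] of_real_sum[symmetric] of_real_eq_iff .
      have "- 2 * Re (cnj v * u) + (cmod v)\<^sup>2 = (cmod (u - v))\<^sup>2 - (cmod u)\<^sup>2" for u v
        unfolding cmod_power2 by (simp add: power2_eq_square algebra_simps)
      then have "- 2 * Re (\<Sum>j\<in>F. cnj (c j) * ?a j) + (\<Sum>j\<in>F. (cmod (c j))\<^sup>2) =
          (\<Sum>j\<in>F. (cmod (?a j - c j))\<^sup>2) - (\<Sum>j\<in>F. (cmod (?a j))\<^sup>2)"
        unfolding Re_sum sum_distrib_left sum.distrib[symmetric] sum_subtractf[symmetric]
        by (intro sum.cong) auto
      then show ?thesis
        unfolding L2_norm_diff_square[OF H2_L2[OF y] s] ys ss by simp
    qed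
    have bessel: "(\<Sum>j\<in>F. (cmod (?a j))\<^sup>2) \<le> (L2_norm y)\<^sup>2" if "finite F" "F \<subseteq> \<Omega>" for F
    proof -
      have "0 \<le> (L2_norm y)\<^sup>2 - (\<Sum>j\<in>F. (cmod (?a j))\<^sup>2)"
        using pyth[OF that, of ?a] by (metis (no_types, lifting) add.right_neutral diff_self norm_zero
            power2_eq_square mult_zero_left sum.neutral zero_le_power2)
      then show ?thesis by simp
    qed
    show ?thesis
      unfolding has_sum_def tendsto_iff eventually_finite_subsets_at_top
    proof (intro allI impI)
      fix e :: real assume e: "0 < e"
      then obtain F c where F: "finite F" "F \<subseteq> \<Omega>" and
        lt: "L2_norm (\<lambda>\<zeta>. y \<zeta> - (\<Sum>j\<in>F. c j * x j \<zeta>)) < sqrt e"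
        using on y unfolding orthonormal_basis_H2_def by (metis real_sqrt_gt_zero)
      have "(L2_norm (\<lambda>\<zeta>. y \<zeta> - (\<Sum>j\<in>F. c j * x j \<zeta>)))\<^sup>2 < e"
        using power_strict_mono[OF lt, of 2] e by simp
      then have "(L2_norm y)\<^sup>2 - e < (\<Sum>j\<in>F. (cmod (?a j))\<^sup>2)"
        unfolding pyth[OF F] using sum_nonneg[of F "\<lambda>j. (cmod (?a j - c j))\<^sup>2"] by simp
      moreover have "(\<Sum>j\<in>F. (cmod (?a j))\<^sup>2) \<le> (\<Sum>j\<in>G. (cmod (?a j))\<^sup>2)"
        if "finite G" "F \<subseteq> G" for G using that by (intro sum_mono2) auto
      ultimately have "dist (\<Sum>j\<in>G. (cmod (?a j))\<^sup>2) ((L2_norm y)\<^sup>2) < e"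
        if "finite G" "F \<subseteq> G" "G \<subseteq> \<Omega>" for G
        using bessel[of G] that by (fastforce simp: dist_real_def)
      with F show "\<exists>X. finite X \<and> X \<subseteq> \<Omega> \<and> (\<forall>Y. finite Y \<and> X \<subseteq> Y \<and> Y \<subseteq> \<Omega> \<longrightarrow>
          dist (\<Sum>j\<in>Y. (cmod (?a j))\<^sup>2) ((L2_norm y)\<^sup>2) < e)" by blast
    qed
  qed
  then have "(\<lambda>j. (cmod (L2_inner y (x j)))\<^sup>2) summable_on \<Omega> \<and>
      (\<Sum>\<^sub>\<infinity>j\<in>\<Omega>. (cmod (L2_inner y (x j)))\<^sup>2) = (L2_norm y)\<^sup>2" if "y \<in> H2" for y
    using that infsumI has_sum_imp_summable by blast
  then show ?thesis
    unfolding parseval_frame_H2_def frame_bounds_H2_def using xH count by simp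
qed

section \<open>Frames tested on square-integrable functions\<close>

lemma frame_finite_sum_le:
  assumes fr: "frame_bounds_H2 A B \<Omega> x" and y: "y \<in> H2" and F: "finite F" "F \<subseteq> \<Omega>"
  shows "(\<Sum>j\<in>F. (cmod (L2_inner y (x j)))\<^sup>2) \<le> B * (L2_norm y)\<^sup>2"
proof -
  have "(\<Sum>j\<in>F. (cmod (L2_inner y (x j)))\<^sup>2) \<le> (\<Sum>\<^sub>\<infinity>j\<in>\<Omega>. (cmod (L2_inner y (x j)))\<^sup>2)"
    using fr y F by (intro finite_sum_le_infsum) (auto simp: frame_bounds_H2_def)
  also have "\<dots> \<le> B * (L2_norm y)\<^sup>2"
    using fr y by (auto simp: frame_bounds_H2_def)
  finally show ?thesis .
qed

text \<open>
  The upper frame bound extends from the Hardy space to all of \<open>L\<^sup>2\<close>: by duality it bounds the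
  norm of linear combinations of the frame vectors, and those lie in the Hardy space.
\<close>

lemma frame_bessel_L2:
  assumes fr: "frame_bounds_H2 A B \<Omega> x" and B: "B \<ge> 0" and y: "y \<in> L2_circle"
    and F: "finite F" "F \<subseteq> \<Omega>"
  shows "(\<Sum>j\<in>F. (cmod (L2_inner y (x j)))\<^sup>2) \<le> B * (L2_norm y)\<^sup>2"
proof -
  define c where "c j = L2_inner y (x j)" for j
  define s where "s = (\<Sum>j\<in>F. (cmod (c j))\<^sup>2)"
  define S where "S = (\<lambda>\<zeta>. \<Sum>j\<in>F. c j * x j \<zeta>)"
  have xH: "x j \<in> H2" if "j \<in> F" for j
    using fr F that by (auto simp: frame_bounds_H2_def)
  then have xL: "\<And>j. j \<in> F \<Longrightarrow> x j \<in> L2_circle" by (simp add: H2_L2)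
  have SH: "S \<in> H2" unfolding S_def by (intro H2_sum H2_cmult xH)
  have s0: "s \<ge> 0" by (simp add: s_def sum_nonneg)
  have "L2_inner y S = (\<Sum>j\<in>F. cnj (c j) * c j)"
    unfolding S_def c_def by (rule L2_inner_lincomb_right[OF xL y])
  also have "\<dots> = of_real s"
    unfolding s_def of_real_sum complex_norm_square by (simp add: mult.commute)
  finally have "s \<le> L2_norm y * L2_norm S"
    using L2_Cauchy_Schwarz[OF y H2_L2[OF SH]] s0 by simp
  then have 1: "s\<^sup>2 \<le> (L2_norm y)\<^sup>2 * (L2_norm S)\<^sup>2"
    using s0 by (simp add: power_mono flip: power_mult_distrib)
  have "L2_inner S S = (\<Sum>j\<in>F. c j * L2_inner (x j) S)"
    using L2_inner_lincomb_left[OF xL H2_L2[OF SH], where c=c] by (simp add: S_def)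
  then have "(L2_norm S)\<^sup>2 = cmod (\<Sum>j\<in>F. c j * L2_inner (x j) S)"
    unfolding L2_inner_self by (metis abs_of_nonneg norm_of_real zero_le_power2)
  also have "\<dots> \<le> (\<Sum>j\<in>F. cmod (c j) * cmod (L2_inner S (x j)))"
    by (rule order_trans[OF norm_sum]) (simp add: norm_mult L2_inner_commute[of _ S])
  finally have "((L2_norm S)\<^sup>2)\<^sup>2 \<le> (\<Sum>j\<in>F. cmod (c j) * cmod (L2_inner S (x j)))\<^sup>2"
    by (intro power_mono) auto
  also have "\<dots> \<le> s * (\<Sum>j\<in>F. (cmod (L2_inner S (x j)))\<^sup>2)"
    unfolding s_def by (rule Cauchy_Schwarz_ineq_sum)
  also have "\<dots> \<le> s * (B * (L2_norm S)\<^sup>2)"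
    by (intro mult_left_mono frame_finite_sum_le[OF fr SH F] s0)
  finally have "(L2_norm S)\<^sup>2 * (L2_norm S)\<^sup>2 \<le> (s * B) * (L2_norm S)\<^sup>2"
    by (simp only: power2_eq_square[of "(L2_norm S)\<^sup>2"] mult.assoc)
  then have 2: "(L2_norm S)\<^sup>2 \<le> s * B"
  proof (cases "L2_norm S = 0")
    case False
    then have "(L2_norm S)\<^sup>2 > 0" by simp
    with \<open>(L2_norm S)\<^sup>2 * (L2_norm S)\<^sup>2 \<le> (s * B) * (L2_norm S)\<^sup>2\<close> show ?thesis
      by (rule mult_right_le_imp_le)
  qed (use s0 B in simp)
  have "s\<^sup>2 \<le> (L2_norm y)\<^sup>2 * (s * B)"
    using 1 mult_left_mono[OF 2, of "(L2_norm y)\<^sup>2"] by simp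
  then have "s \<le> B * (L2_norm y)\<^sup>2"
    using s0 B by (cases "s = 0") (auto simp: power2_eq_square mult_ac)
  then show ?thesis by (simp add: s_def c_def)
qed

text \<open>
  The lower frame bound also extends to \<open>L\<^sup>2\<close>, up to the constant 4 and asymptotically: a high power of
  \<open>\<zeta>\<close> moves any square-integrable function arbitrarily close to the Hardy space without changing
  its norm.  The constant comes from applying \<open>(a + b)\<^sup>2 \<le> 2 * a\<^sup>2 + 2 * b\<^sup>2\<close> twice.
\<close>

lemma frame_lower_bound_L2:
  assumes fr: "frame_bounds_H2 A B \<Omega> x" and A: "A > 0" and B: "B \<ge> 0" and u: "u \<in> L2_circle"
    and ev: "eventually (\<lambda>K. \<forall>F. finite F \<longrightarrow> F \<subseteq> \<Omega> \<longrightarrow>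
      (\<Sum>j\<in>F. (cmod (L2_inner (\<lambda>\<zeta>. \<zeta> ^ K * u \<zeta>) (x j)))\<^sup>2) \<le> T) sequentially"
  shows "A * (L2_norm u)\<^sup>2 \<le> 4 * T"
proof (rule field_le_epsilon)
  fix \<delta> :: real assume d: "0 < \<delta>"
  \<comment> \<open>chosen so that the two approximation errors at the end add up to \<open>\<delta>\<close>\<close>
  define \<epsilon> where "\<epsilon> = sqrt (\<delta> / (4 * B + 2 * A))"
  have pos: "4 * B + 2 * A > 0" using A B by simp
  have e: "\<epsilon> > 0" and e2: "(4 * B + 2 * A) * \<epsilon>\<^sup>2 = \<delta>"
    using d pos by (auto simp: \<epsilon>_def)
  have sq: "(a + b)\<^sup>2 \<le> 2 * a\<^sup>2 + 2 * b\<^sup>2" for a b :: real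
    using zero_le_power2[of "a - b"] by (simp add: power2_eq_square algebra_simps)
  obtain n p where np: "L2_norm (\<lambda>\<zeta>. \<zeta> ^ n * u \<zeta> - poly p \<zeta>) < \<epsilon>"
    using L2_trig_dense[OF u e] by blast
  obtain K0 where K0: "\<And>K F. K \<ge> K0 \<Longrightarrow> finite F \<Longrightarrow> F \<subseteq> \<Omega> \<Longrightarrow>
      (\<Sum>j\<in>F. (cmod (L2_inner (\<lambda>\<zeta>. \<zeta> ^ K * u \<zeta>) (x j)))\<^sup>2) \<le> T"
    using ev unfolding eventually_sequentially by blast
  define K where "K = K0 + n"
  define v where "v = (\<lambda>\<zeta>. \<zeta> ^ K * u \<zeta>)"
  define h where "h = (\<lambda>\<zeta>. \<zeta> ^ K0 * poly p \<zeta>)"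
  have v: "v \<in> L2_circle" unfolding v_def by (rule L2_power_mult[OF u])
  have h: "h \<in> H2" unfolding h_def by (rule H2_power_mult[OF H2_poly])
  have vh: "L2_norm (\<lambda>\<zeta>. v \<zeta> - h \<zeta>) < \<epsilon>"
    using np L2_norm_power_mult[of K0 "\<lambda>\<zeta>. \<zeta> ^ n * u \<zeta> - poly p \<zeta>"]
    by (simp add: v_def h_def K_def power_add algebra_simps)
  have xL: "x j \<in> L2_circle" if "j \<in> \<Omega>" for j
    using fr that by (auto simp: frame_bounds_H2_def H2_L2)
  have "(\<Sum>\<^sub>\<infinity>j\<in>\<Omega>. (cmod (L2_inner h (x j)))\<^sup>2) \<le> 2 * T + 2 * (B * \<epsilon>\<^sup>2)"
  proof (rule infsum_le_finite_sums)
    show "(\<lambda>j. (cmod (L2_inner h (x j)))\<^sup>2) summable_on \<Omega>"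
      using fr h by (auto simp: frame_bounds_H2_def)
    fix F assume F: "finite F" "F \<subseteq> \<Omega>"
    have "(\<Sum>j\<in>F. (cmod (L2_inner h (x j)))\<^sup>2) \<le>
      (\<Sum>j\<in>F. 2 * (cmod (L2_inner v (x j)))\<^sup>2 + 2 * (cmod (L2_inner (\<lambda>\<zeta>. v \<zeta> - h \<zeta>) (x j)))\<^sup>2)"
    proof (rule sum_mono)
      fix j assume "j \<in> F"
      then have "L2_inner h (x j) = L2_inner v (x j) - L2_inner (\<lambda>\<zeta>. v \<zeta> - h \<zeta>) (x j)"
        using F by (subst L2_inner_diff_left) (auto intro: v H2_L2 h xL)
      then have "cmod (L2_inner h (x j)) \<le> cmod (L2_inner v (x j)) + cmod (L2_inner (\<lambda>\<zeta>. v \<zeta> - h \<zeta>) (x j))"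
        by (simp add: norm_triangle_ineq4)
      then have "(cmod (L2_inner h (x j)))\<^sup>2 \<le>
          (cmod (L2_inner v (x j)) + cmod (L2_inner (\<lambda>\<zeta>. v \<zeta> - h \<zeta>) (x j)))\<^sup>2"
        by (intro power_mono) auto
      also note sq
      finally show "(cmod (L2_inner h (x j)))\<^sup>2 \<le>
          2 * (cmod (L2_inner v (x j)))\<^sup>2 + 2 * (cmod (L2_inner (\<lambda>\<zeta>. v \<zeta> - h \<zeta>) (x j)))\<^sup>2" .
    qed
    also have "\<dots> = 2 * (\<Sum>j\<in>F. (cmod (L2_inner v (x j)))\<^sup>2) +
        2 * (\<Sum>j\<in>F. (cmod (L2_inner (\<lambda>\<zeta>. v \<zeta> - h \<zeta>) (x j)))\<^sup>2)"
      by (simp add: sum.distrib sum_distrib_left)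
    also have "\<dots> \<le> 2 * T + 2 * (B * \<epsilon>\<^sup>2)"
    proof (intro add_mono mult_left_mono)
      show "(\<Sum>j\<in>F. (cmod (L2_inner v (x j)))\<^sup>2) \<le> T"
        unfolding v_def by (rule K0) (use F in \<open>auto simp: K_def\<close>)
      have "(\<Sum>j\<in>F. (cmod (L2_inner (\<lambda>\<zeta>. v \<zeta> - h \<zeta>) (x j)))\<^sup>2) \<le> B * (L2_norm (\<lambda>\<zeta>. v \<zeta> - h \<zeta>))\<^sup>2"
        by (rule frame_bessel_L2[OF fr B L2_diff[OF v H2_L2[OF h]] F])
      also have "\<dots> \<le> B * \<epsilon>\<^sup>2"
        using vh B by (intro mult_left_mono power_mono) auto
      finally show "(\<Sum>j\<in>F. (cmod (L2_inner (\<lambda>\<zeta>. v \<zeta> - h \<zeta>) (x j)))\<^sup>2) \<le> B * \<epsilon>\<^sup>2" .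
    qed auto
    finally show "(\<Sum>j\<in>F. (cmod (L2_inner h (x j)))\<^sup>2) \<le> 2 * T + 2 * (B * \<epsilon>\<^sup>2)" .
  qed
  moreover have "A * (L2_norm h)\<^sup>2 \<le> (\<Sum>\<^sub>\<infinity>j\<in>\<Omega>. (cmod (L2_inner h (x j)))\<^sup>2)"
    using fr h by (auto simp: frame_bounds_H2_def)
  ultimately have Ah: "A * (L2_norm h)\<^sup>2 \<le> 2 * T + 2 * (B * \<epsilon>\<^sup>2)" by linarith
  have "L2_norm u = L2_norm v" unfolding v_def by (rule L2_norm_power_mult[symmetric])
  also have "\<dots> \<le> L2_norm h + L2_norm (\<lambda>\<zeta>. v \<zeta> - h \<zeta>)"
    using L2_norm_triangle[OF H2_L2[OF h] L2_diff[OF v H2_L2[OF h]]] by simp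
  also have "\<dots> \<le> L2_norm h + \<epsilon>" using vh by simp
  finally have "(L2_norm u)\<^sup>2 \<le> (L2_norm h + \<epsilon>)\<^sup>2" by (intro power_mono) auto
  also note sq
  finally have "A * (L2_norm u)\<^sup>2 \<le> 2 * (A * (L2_norm h)\<^sup>2) + 2 * A * \<epsilon>\<^sup>2"
    using mult_left_mono[of "(L2_norm u)\<^sup>2" "2 * (L2_norm h)\<^sup>2 + 2 * \<epsilon>\<^sup>2" A] A by (simp add: algebra_simps)
  also have "\<dots> \<le> 2 * (2 * T + 2 * (B * \<epsilon>\<^sup>2)) + 2 * A * \<epsilon>\<^sup>2" using Ah by simp
  also have "\<dots> = 4 * T + (4 * B + 2 * A) * \<epsilon>\<^sup>2" by (simp add: algebra_simps)
  finally show "A * (L2_norm u)\<^sup>2 \<le> 4 * T + \<delta>" unfolding e2 .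
qed

text \<open>
  For a trigonometric polynomial \<open>u\<close> and a polynomial \<open>g\<close> the inner product vanishes as soon as \<open>\<zeta> ^ K * u\<close>
  is analytic with all its frequencies above the degree of \<open>g\<close>.
\<close>

lemma riemann_lebesgue_H2:
  assumes u: "u \<in> L2_circle" and g: "g \<in> H2"
  shows "(\<lambda>K. L2_inner (\<lambda>\<zeta>. \<zeta> ^ K * u \<zeta>) g) \<longlonglongrightarrow> 0"
proof (rule LIMSEQ_I)
  fix r :: real assume r: "0 < r"
  have u1: "L2_norm u + 1 > 0" using L2_norm_nonneg[of u] by linarith
  then obtain q where q: "L2_norm (\<lambda>\<zeta>. g \<zeta> - poly q \<zeta>) < r / 2 / (L2_norm u + 1)"
    using H2_poly_dense[OF g, of "r / 2 / (L2_norm u + 1)"] r by auto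
  have q1: "L2_norm (poly q) + 1 > 0" using L2_norm_nonneg[of "poly q"] by linarith
  then obtain n p where np: "L2_norm (\<lambda>\<zeta>. \<zeta> ^ n * u \<zeta> - poly p \<zeta>) < r / 2 / (L2_norm (poly q) + 1)"
    using L2_trig_dense[OF u, of "r / 2 / (L2_norm (poly q) + 1)"] r by auto
  have "cmod (L2_inner (\<lambda>\<zeta>. \<zeta> ^ K * u \<zeta>) g) < r" if K: "K \<ge> n + Suc (degree q)" for K
  proof -
    define k where "k = K - n"
    have Kk: "K = k + n" and k: "k > degree q" using K by (auto simp: k_def)
    let ?v = "\<lambda>\<zeta>. \<zeta> ^ K * u \<zeta>" and ?h = "\<lambda>\<zeta>. \<zeta> ^ k * poly p \<zeta>"
    have v: "?v \<in> L2_circle" by (rule L2_power_mult[OF u])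
    have h: "?h \<in> L2_circle" by (rule L2_power_mult[OF L2_poly])
    have "fourier_coeff ?h (int i) = 0" if "i \<le> degree q" for i
      using that k by (simp add: fourier_coeff_power_mult H2_neg_coeff[OF H2_poly])
    then have 0: "L2_inner ?h (poly q) = 0"
      by (simp add: L2_inner_poly_right[OF h])
    have "L2_inner ?v g = L2_inner ?v (\<lambda>\<zeta>. g \<zeta> - poly q \<zeta>) + L2_inner (\<lambda>\<zeta>. ?v \<zeta> - ?h \<zeta>) (poly q)"
      using v h g by (simp add: L2_inner_diff_left L2_inner_diff_right H2_L2 0)
    then have "cmod (L2_inner ?v g) \<le>
        cmod (L2_inner ?v (\<lambda>\<zeta>. g \<zeta> - poly q \<zeta>)) + cmod (L2_inner (\<lambda>\<zeta>. ?v \<zeta> - ?h \<zeta>) (poly q))"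
      by (simp add: norm_triangle_ineq)
    also have "\<dots> \<le> L2_norm ?v * L2_norm (\<lambda>\<zeta>. g \<zeta> - poly q \<zeta>) + L2_norm (\<lambda>\<zeta>. ?v \<zeta> - ?h \<zeta>) * L2_norm (poly q)"
      by (intro add_mono L2_Cauchy_Schwarz L2_diff v h H2_L2 g L2_poly)
    also have "L2_norm ?v = L2_norm u" by (rule L2_norm_power_mult)
    also have "L2_norm (\<lambda>\<zeta>. ?v \<zeta> - ?h \<zeta>) = L2_norm (\<lambda>\<zeta>. \<zeta> ^ n * u \<zeta> - poly p \<zeta>)"
      using L2_norm_power_mult[of k "\<lambda>\<zeta>. \<zeta> ^ n * u \<zeta> - poly p \<zeta>"]
      by (simp add: Kk power_add algebra_simps)
    also have "L2_norm u * L2_norm (\<lambda>\<zeta>. g \<zeta> - poly q \<zeta>) \<le> (L2_norm u + 1) * L2_norm (\<lambda>\<zeta>. g \<zeta> - poly q \<zeta>)"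
      by (intro mult_right_mono) auto
    also have "(L2_norm u + 1) * L2_norm (\<lambda>\<zeta>. g \<zeta> - poly q \<zeta>) < r / 2"
      using q u1 by (simp only: pos_less_divide_eq mult.commute)
    also have "L2_norm (\<lambda>\<zeta>. \<zeta> ^ n * u \<zeta> - poly p \<zeta>) * L2_norm (poly q) \<le>
        L2_norm (\<lambda>\<zeta>. \<zeta> ^ n * u \<zeta> - poly p \<zeta>) * (L2_norm (poly q) + 1)"
      by (intro mult_left_mono) auto
    also have "L2_norm (\<lambda>\<zeta>. \<zeta> ^ n * u \<zeta> - poly p \<zeta>) * (L2_norm (poly q) + 1) < r / 2"
      using np q1 by (simp only: pos_less_divide_eq)
    finally show ?thesis by simp
  qed
  then show "\<exists>no. \<forall>K\<ge>no. norm (L2_inner (\<lambda>\<zeta>. \<zeta> ^ K * u \<zeta>) g - 0) < r" by auto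
qed

section \<open>A frame of orbits forces a unimodular multiplier\<close>

lemma orbit_inner_shift:
  "L2_inner (\<lambda>\<zeta>. \<zeta> ^ K * (cnj (\<phi> \<zeta> ^ N) * y \<zeta>)) (\<lambda>\<zeta>. \<phi> \<zeta> ^ n * f \<zeta>) =
    L2_inner (\<lambda>\<zeta>. \<zeta> ^ K * y \<zeta>) (\<lambda>\<zeta>. \<phi> \<zeta> ^ (n + N) * f \<zeta>)"
  by (rule L2_inner_cong) (simp add: power_add mult_ac)

lemma Hinf_power_bounded:
  assumes "\<phi> \<in> Hinf"
  obtains C where "(\<lambda>\<zeta>. \<phi> \<zeta> ^ N) \<in> borel_measurable circle_measure"
    "AE \<zeta> in circle_measure. cmod (\<phi> \<zeta> ^ N) \<le> C"
  using HinfE[OF Hinf_power[OF assms, of N]] by metis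

context
  fixes A B :: real and m :: nat and f :: "nat \<Rightarrow> complex \<Rightarrow> complex" and \<phi> :: "complex \<Rightarrow> complex"
  assumes \<phi>: "\<phi> \<in> Hinf" and A: "A > 0" and B: "B > 0"
    and fr: "frame_bounds_H2 A B ({1..m} \<times> (UNIV :: nat set)) (\<lambda>(i, n) \<zeta>. \<phi> \<zeta> ^ n * f i \<zeta>)"
begin

lemma cnj_power_mult_L2:
  assumes "y \<in> L2_circle" shows "(\<lambda>\<zeta>. cnj (\<phi> \<zeta> ^ N) * y \<zeta>) \<in> L2_circle"
proof -
  obtain C where C: "(\<lambda>\<zeta>. \<phi> \<zeta> ^ N) \<in> borel_measurable circle_measure"
    "AE \<zeta> in circle_measure. cmod (\<phi> \<zeta> ^ N) \<le> C"
    using Hinf_power_bounded[OF \<phi>] by blast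
  show ?thesis
    by (rule L2_AE_bounded_mult[OF borel_measurable_cnj[OF C(1)] _ assms, of C])
      (use C(2) in \<open>simp only: complex_mod_cnj\<close>)
qed

text \<open>
  Testing \<open>y\<close> against \<open>\<phi> ^ (n + N) * f i\<close> is testing \<open>cnj \<phi> ^ N * y\<close> against \<open>\<phi> ^ n * f i\<close>, so the upper
  frame bound for the tail of the orbits sees only the latter function.
\<close>

lemma orbit_tail_bound:
  assumes y: "y \<in> L2_circle" and F: "finite F" "F \<subseteq> {1..m} \<times> {N..}"
  shows "(\<Sum>j\<in>F. (cmod (L2_inner (\<lambda>\<zeta>. \<zeta> ^ K * y \<zeta>) (\<lambda>\<zeta>. \<phi> \<zeta> ^ snd j * f (fst j) \<zeta>)))\<^sup>2)
    \<le> B * (L2_norm (\<lambda>\<zeta>. cnj (\<phi> \<zeta> ^ N) * y \<zeta>))\<^sup>2"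
proof -
  define G where "G = (\<lambda>(i, n). (i, n - N)) ` F"
  have inj: "inj_on (\<lambda>(i, n). (i, n - N)) F"
  proof (rule inj_onI)
    fix p q assume pq: "p \<in> F" "q \<in> F" "(case p of (i, n) \<Rightarrow> (i, n - N)) = (case q of (i, n) \<Rightarrow> (i, n - N))"
    then have "N \<le> snd p" "N \<le> snd q" using F(2) by auto
    with pq(3) show "p = q" by (cases p; cases q) auto
  qed
  have "(\<Sum>j\<in>F. (cmod (L2_inner (\<lambda>\<zeta>. \<zeta> ^ K * y \<zeta>) (\<lambda>\<zeta>. \<phi> \<zeta> ^ snd j * f (fst j) \<zeta>)))\<^sup>2) =
    (\<Sum>j\<in>G. (cmod (L2_inner (\<lambda>\<zeta>. \<zeta> ^ K * (cnj (\<phi> \<zeta> ^ N) * y \<zeta>))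
      ((\<lambda>(i, n) \<zeta>. \<phi> \<zeta> ^ n * f i \<zeta>) j)))\<^sup>2)"
    unfolding G_def sum.reindex[OF inj] o_def
  proof (rule sum.cong[OF refl])
    fix j assume "j \<in> F"
    then obtain i n where j: "j = (i, n)" "N \<le> n" using F(2) by (cases j) auto
    show "(cmod (L2_inner (\<lambda>\<zeta>. \<zeta> ^ K * y \<zeta>) (\<lambda>\<zeta>. \<phi> \<zeta> ^ snd j * f (fst j) \<zeta>)))\<^sup>2 =
      (cmod (L2_inner (\<lambda>\<zeta>. \<zeta> ^ K * (cnj (\<phi> \<zeta> ^ N) * y \<zeta>))
      ((\<lambda>(i, n) \<zeta>. \<phi> \<zeta> ^ n * f i \<zeta>) (case j of (i, n) \<Rightarrow> (i, n - N)))))\<^sup>2"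
      using j orbit_inner_shift[of K \<phi> N y "n - N" "f i"] by simp
  qed
  also have "\<dots> \<le> B * (L2_norm (\<lambda>\<zeta>. \<zeta> ^ K * (cnj (\<phi> \<zeta> ^ N) * y \<zeta>)))\<^sup>2"
    by (rule frame_bessel_L2[OF fr less_imp_le[OF B] L2_power_mult[OF cnj_power_mult_L2[OF y]]])
      (use F in \<open>auto simp: G_def\<close>)
  finally show ?thesis by (simp only: L2_norm_power_mult)
qed

text \<open>
  Conversely the whole frame tested against \<open>cnj \<phi> ^ N * y\<close> is only a tail of the frame tested against
  \<open>y\<close>.  The lower bound for the former therefore bounds the powers of \<open>\<phi>\<close> uniformly in \<open>N\<close>, which
  excludes \<open>\<bar>\<phi>\<bar> > 1\<close> on a set of positive measure.
\<close>

lemma orbit_frame_power_bound: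
  assumes y: "y \<in> L2_circle"
  shows "A * (L2_norm (\<lambda>\<zeta>. cnj (\<phi> \<zeta> ^ N) * y \<zeta>))\<^sup>2 \<le> 4 * (B * (L2_norm y)\<^sup>2)"
proof (rule frame_lower_bound_L2[OF fr A less_imp_le[OF B] cnj_power_mult_L2[OF y]],
    intro always_eventually allI impI)
  fix K F assume F: "finite F" "F \<subseteq> {1..m} \<times> (UNIV :: nat set)"
  define G where "G = (\<lambda>(i, n). (i, n + N)) ` F"
  have inj: "inj_on (\<lambda>(i, n). (i, n + N)) F" by (auto simp: inj_on_def)
  have "(\<Sum>j\<in>F. (cmod (L2_inner (\<lambda>\<zeta>. \<zeta> ^ K * (cnj (\<phi> \<zeta> ^ N) * y \<zeta>))
      ((\<lambda>(i, n) \<zeta>. \<phi> \<zeta> ^ n * f i \<zeta>) j)))\<^sup>2) =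
    (\<Sum>j\<in>G. (cmod (L2_inner (\<lambda>\<zeta>. \<zeta> ^ K * y \<zeta>) ((\<lambda>(i, n) \<zeta>. \<phi> \<zeta> ^ n * f i \<zeta>) j)))\<^sup>2)"
    unfolding G_def sum.reindex[OF inj] o_def
    by (rule sum.cong[OF refl]) (simp only: case_prod_unfold prod.sel orbit_inner_shift)
  also have "\<dots> \<le> B * (L2_norm (\<lambda>\<zeta>. \<zeta> ^ K * y \<zeta>))\<^sup>2"
    by (rule frame_bessel_L2[OF fr less_imp_le[OF B] L2_power_mult[OF y]]) (use F in \<open>auto simp: G_def\<close>)
  finally show "(\<Sum>j\<in>F. (cmod (L2_inner (\<lambda>\<zeta>. \<zeta> ^ K * (cnj (\<phi> \<zeta> ^ N) * y \<zeta>))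
      (case j of (i, n) \<Rightarrow> \<lambda>\<zeta>. \<phi> \<zeta> ^ n * f i \<zeta>)))\<^sup>2) \<le> B * (L2_norm y)\<^sup>2"
    by (simp only: L2_norm_power_mult)
qed

lemma orbit_frame_le_1: "AE \<zeta> in circle_measure. cmod (\<phi> \<zeta>) \<le> 1"
proof -
  have [measurable]: "\<phi> \<in> borel_measurable circle_measure"
    using \<phi> by (intro L2_measurable H2_L2 Hinf_H2)
  have "AE \<zeta> in circle_measure. cmod (\<phi> \<zeta>) < r" if r: "r > 1" for r
  proof -
    define y where "y = (\<lambda>\<zeta>. if r \<le> cmod (\<phi> \<zeta>) then 1 else 0 :: complex)"
    have y: "y \<in> L2_circle"
      by (rule L2_AE_bounded[where C=1]) (auto simp: y_def)
    have le: "r ^ (2 * N) * (A * (L2_norm y)\<^sup>2) \<le> 4 * (B * (L2_norm y)\<^sup>2)" for N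
    proof -
      have "L2_norm y \<le> (1 / r ^ N) * L2_norm (\<lambda>\<zeta>. cnj (\<phi> \<zeta> ^ N) * y \<zeta>)"
      proof (rule L2_norm_mono_AE[OF AE_I2])
        fix \<zeta>
        show "cmod (y \<zeta>) \<le> (1 / r ^ N) * cmod (cnj (\<phi> \<zeta> ^ N) * y \<zeta>)"
          using r power_mono[of r "cmod (\<phi> \<zeta>)" N]
          by (simp add: y_def norm_power field_simps)
      qed (use r y cnj_power_mult_L2[OF y] in auto)
      then have "r ^ N * L2_norm y \<le> L2_norm (\<lambda>\<zeta>. cnj (\<phi> \<zeta> ^ N) * y \<zeta>)"
        using r by (simp add: field_simps)
      then have "(r ^ N * L2_norm y)\<^sup>2 \<le> (L2_norm (\<lambda>\<zeta>. cnj (\<phi> \<zeta> ^ N) * y \<zeta>))\<^sup>2"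
        using r by (intro power_mono) auto
      then have "A * (r ^ N * L2_norm y)\<^sup>2 \<le> A * (L2_norm (\<lambda>\<zeta>. cnj (\<phi> \<zeta> ^ N) * y \<zeta>))\<^sup>2"
        using A by (intro mult_left_mono) auto
      also note orbit_frame_power_bound[OF y]
      finally show ?thesis by (simp add: power_mult_distrib power_mult mult_ac power_commutes)
    qed
    have "L2_norm y = 0"
    proof (rule ccontr)
      assume nz: "L2_norm y \<noteq> 0"
      obtain N where N: "4 * B / A < r ^ N" using real_arch_pow[OF r] by blast
      have "r ^ N \<le> r ^ (2 * N)" using r by (intro power_increasing) auto
      then have "4 * B < r ^ (2 * N) * A" using N A by (simp add: field_simps) (meson less_le_trans mult_left_mono less_imp_le)
      then have "4 * B * (L2_norm y)\<^sup>2 < r ^ (2 * N) * A * (L2_norm y)\<^sup>2"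
        using nz by (intro mult_strict_right_mono) auto
      then show False using le[of N] by (simp add: mult_ac)
    qed
    from L2_norm_eq_0_AE[OF y this] show ?thesis
      by eventually_elim (auto simp: y_def split: if_splits)
  qed
  then have "AE \<zeta> in circle_measure. \<forall>k::nat. cmod (\<phi> \<zeta>) < 1 + inverse (real (Suc k))"
    unfolding AE_all_countable by simp
  then show ?thesis
  proof eventually_elim
    case (elim \<zeta>)
    show ?case
    proof (rule ccontr)
      assume "\<not> cmod (\<phi> \<zeta>) \<le> 1"
      then obtain k where "inverse (real (Suc k)) < cmod (\<phi> \<zeta>) - 1"
        using reals_Archimedean[of "cmod (\<phi> \<zeta>) - 1"] by auto
      with elim[rule_format, of k] show False by simp
    qed
  qed
qed

text \<open>
  On a set where \<open>\<bar>\<phi>\<bar> \<le> r < 1\<close> the orbits decay geometrically, so only finitely many frame vectors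
  see functions supported there; by Riemann--Lebesgue these few miss \<open>\<zeta> ^ K\<close> times its indicator
  for large \<open>K\<close>, contradicting the lower bound unless the set is null.
\<close>

lemma orbit_frame_ge_1: "AE \<zeta> in circle_measure. cmod (\<phi> \<zeta>) \<ge> 1"
proof -
  have [measurable]: "\<phi> \<in> borel_measurable circle_measure"
    using \<phi> by (intro L2_measurable H2_L2 Hinf_H2)
  have fH: "(\<lambda>\<zeta>. \<phi> \<zeta> ^ n * f i \<zeta>) \<in> H2" if "i \<in> {1..m}" for i n
    using fr that by (auto simp: frame_bounds_H2_def)
  have "AE \<zeta> in circle_measure. cmod (\<phi> \<zeta>) > r" if r: "0 \<le> r" "r < 1" for r
  proof -
    define y where "y = (\<lambda>\<zeta>. if cmod (\<phi> \<zeta>) \<le> r then 1 else 0 :: complex)"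
    have y: "y \<in> L2_circle"
      by (rule L2_AE_bounded[where C=1]) (auto simp: y_def)
    have bound: "A * (L2_norm y)\<^sup>2 \<le> 4 * (\<epsilon> + B * (r ^ N * L2_norm y)\<^sup>2)" if e: "\<epsilon> > 0" for \<epsilon> N
    proof (rule frame_lower_bound_L2[OF fr A less_imp_le[OF B] y])
      let ?a = "\<lambda>K j. (cmod (L2_inner (\<lambda>\<zeta>. \<zeta> ^ K * y \<zeta>) (\<lambda>\<zeta>. \<phi> \<zeta> ^ snd j * f (fst j) \<zeta>)))\<^sup>2"
      let ?H = "{1..m} \<times> {..<N}"
      have "(\<lambda>K. \<Sum>j\<in>?H. ?a K j) \<longlonglongrightarrow> (\<Sum>j\<in>?H. (cmod 0)\<^sup>2)"
        by (intro tendsto_sum tendsto_power tendsto_norm riemann_lebesgue_H2[OF y] fH) auto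
      then have "eventually (\<lambda>K. (\<Sum>j\<in>?H. ?a K j) < \<epsilon>) sequentially"
        using e by (intro order_tendstoD(2)[of _ 0]) auto
      then show "eventually (\<lambda>K. \<forall>F. finite F \<longrightarrow> F \<subseteq> {1..m} \<times> UNIV \<longrightarrow>
          (\<Sum>j\<in>F. (cmod (L2_inner (\<lambda>\<zeta>. \<zeta> ^ K * y \<zeta>) (case j of (i, n) \<Rightarrow> \<lambda>\<zeta>. \<phi> \<zeta> ^ n * f i \<zeta>)))\<^sup>2)
          \<le> \<epsilon> + B * (r ^ N * L2_norm y)\<^sup>2) sequentially"
      proof eventually_elim
        case (elim K)
        show ?case
        proof (intro allI impI)
          fix F assume F: "finite F" "F \<subseteq> {1..m} \<times> (UNIV :: nat set)"
          have "(\<Sum>j\<in>F. (cmod (L2_inner (\<lambda>\<zeta>. \<zeta> ^ K * y \<zeta>) (case j of (i, n) \<Rightarrow> \<lambda>\<zeta>. \<phi> \<zeta> ^ n * f i \<zeta>)))\<^sup>2) =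
              (\<Sum>j\<in>F. ?a K j)"
            by (simp add: case_prod_unfold)
          also have "\<dots> = (\<Sum>j\<in>F \<inter> ?H. ?a K j) + (\<Sum>j\<in>F - ?H. ?a K j)"
            using F(1) by (rule sum.Int_Diff)
          also have "(\<Sum>j\<in>F \<inter> ?H. ?a K j) \<le> (\<Sum>j\<in>?H. ?a K j)"
            by (intro sum_mono2) auto
          also have "\<dots> \<le> \<epsilon>" using elim by simp
          also have "(\<Sum>j\<in>F - ?H. ?a K j) \<le> B * (L2_norm (\<lambda>\<zeta>. cnj (\<phi> \<zeta> ^ N) * y \<zeta>))\<^sup>2"
            by (rule orbit_tail_bound[OF y]) (use F in \<open>auto simp: not_less subset_iff\<close>)
          also have "\<dots> \<le> B * (r ^ N * L2_norm y)\<^sup>2"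
          proof (intro mult_left_mono power_mono L2_norm_mono_AE AE_I2)
            fix \<zeta>
            show "cmod (cnj (\<phi> \<zeta> ^ N) * y \<zeta>) \<le> r ^ N * cmod (y \<zeta>)"
              using power_mono[of "cmod (\<phi> \<zeta>)" r N] by (simp add: y_def norm_power)
          qed (use B r y cnj_power_mult_L2[OF y] in auto)
          finally show "(\<Sum>j\<in>F. (cmod (L2_inner (\<lambda>\<zeta>. \<zeta> ^ K * y \<zeta>)
            (case j of (i, n) \<Rightarrow> \<lambda>\<zeta>. \<phi> \<zeta> ^ n * f i \<zeta>)))\<^sup>2) \<le> \<epsilon> + B * (r ^ N * L2_norm y)\<^sup>2" by simp
        qed
      qed
    qed
    have "(\<lambda>N. 4 * (inverse (real (Suc N)) + B * (r ^ N * L2_norm y)\<^sup>2)) \<longlonglongrightarrow> 4 * (0 + B * (0 * L2_norm y)\<^sup>2)"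
      using r by (intro tendsto_intros LIMSEQ_inverse_real_of_nat LIMSEQ_power_zero) auto
    moreover have "A * (L2_norm y)\<^sup>2 \<le> 4 * (inverse (real (Suc N)) + B * (r ^ N * L2_norm y)\<^sup>2)" for N
      by (rule bound) simp
    ultimately have "A * (L2_norm y)\<^sup>2 \<le> 4 * (0 + B * (0 * L2_norm y)\<^sup>2)"
      by (intro LIMSEQ_le_const) auto
    then have "L2_norm y = 0" using A by (simp add: mult_le_0_iff)
    from L2_norm_eq_0_AE[OF y this] show ?thesis
      by eventually_elim (auto simp: y_def split: if_splits)
  qed
  then have "AE \<zeta> in circle_measure. \<forall>k::nat. cmod (\<phi> \<zeta>) > 1 - inverse (real (Suc k))"
    unfolding AE_all_countable by (simp add: inverse_le_1_iff)
  then show ?thesis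
  proof eventually_elim
    case (elim \<zeta>)
    show ?case
    proof (rule ccontr)
      assume "\<not> cmod (\<phi> \<zeta>) \<ge> 1"
      then obtain k where "inverse (real (Suc k)) < 1 - cmod (\<phi> \<zeta>)"
        using reals_Archimedean[of "1 - cmod (\<phi> \<zeta>)"] by auto
      with elim[rule_format, of k] show False by simp
    qed
  qed
qed

lemma orbit_frame_unimodular: "AE \<zeta> in circle_measure. cmod (\<phi> \<zeta>) = 1"
  using orbit_frame_le_1 orbit_frame_ge_1 by eventually_elim simp

end

section \<open>Unimodular multipliers with a finite-dimensional wandering subspace\<close>

lemma exists_nontrivial_relation:
  fixes v :: "'j \<Rightarrow> 'i \<Rightarrow> 'a::field"
  assumes "finite I" "finite J" "card I < card J"
  shows "\<exists>c. (\<exists>j\<in>J. c j \<noteq> 0) \<and> (\<forall>i\<in>I. (\<Sum>j\<in>J. c j * v j i) = 0)"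
  using assms
proof (induction I arbitrary: J v rule: finite_induct)
  case empty
  then have "J \<noteq> {}" by auto
  then show ?case by (intro exI[of _ "\<lambda>_. 1"]) auto
next
  case (insert i I)
  show ?case
  proof (cases "\<forall>j\<in>J. v j i = 0")
    case True
    have "card I < card J" using insert.prems insert.hyps by simp
    from insert.IH[OF insert.prems(1) this, of v]
    obtain c where "\<exists>j\<in>J. c j \<noteq> 0" "\<forall>k\<in>I. (\<Sum>j\<in>J. c j * v j k) = 0" by blast
    with True show ?thesis by (intro exI[of _ c]) auto
  next
    case False
    then obtain l where l: "l \<in> J" "v l i \<noteq> 0" by blast
    let ?J = "J - {l}"
    \<comment> \<open>Gaussian elimination with pivot \<open>v l i\<close>\<close>
    define w where "w j k = v j k - v j i / v l i * v l k" for j k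
    have "card I < card ?J" using insert.prems insert.hyps l by simp
    then obtain c where c: "\<exists>j\<in>?J. c j \<noteq> 0" "\<forall>k\<in>I. (\<Sum>j\<in>?J. c j * w j k) = 0"
      using insert.IH[of ?J w] insert.prems by auto
    define s where "s = (\<Sum>j\<in>?J. c j * v j i) / v l i"
    \<comment> \<open>the coefficient at the pivot that cancels equation \<open>i\<close>\<close>
    define d where "d = c(l := - s)"
    have sum: "(\<Sum>j\<in>J. d j * v j k) = (\<Sum>j\<in>?J. c j * w j k)" for k
    proof -
      have "(\<Sum>j\<in>J. d j * v j k) = d l * v l k + (\<Sum>j\<in>?J. d j * v j k)"
        using insert.prems l by (intro sum.remove) auto
      also have "(\<Sum>j\<in>?J. d j * v j k) = (\<Sum>j\<in>?J. c j * v j k)"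
        by (intro sum.cong) (auto simp: d_def)
      also have "d l * v l k = - (\<Sum>j\<in>?J. c j * (v j i / v l i * v l k))"
        by (simp add: d_def s_def sum_distrib_left sum_distrib_right sum_divide_distrib mult_ac)
      finally show ?thesis by (simp add: w_def right_diff_distrib sum_subtractf)
    qed
    have "w j i = 0" for j using l by (simp add: w_def)
    then have "\<forall>k\<in>insert i I. (\<Sum>j\<in>J. d j * v j k) = 0"
      using c(2) by (auto simp: sum)
    moreover have "\<exists>j\<in>J. d j \<noteq> 0" using c(1) by (auto simp: d_def)
    ultimately show ?thesis by blast
  qed
qed

lemma L2_inner_backward_shift:
  assumes g: "g \<in> H2" and u: "u \<in> H2"
  shows "L2_inner (backward_shift g) u = L2_inner g (\<lambda>\<zeta>. \<zeta> * u \<zeta>)"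
proof -
  let ?c = "fourier_coeff g 0"
  have zu: "(\<lambda>\<zeta>. \<zeta> * u \<zeta>) \<in> H2" by (rule H2_id_mult[OF u])
  have "L2_inner (backward_shift g) u = L2_inner (\<lambda>\<zeta>. g \<zeta> - ?c * 1) (\<lambda>\<zeta>. \<zeta> * u \<zeta>)"
    by (rule L2_inner_cong) (simp add: backward_shift_def mult_ac)
  also have "\<dots> = L2_inner g (\<lambda>\<zeta>. \<zeta> * u \<zeta>) - ?c * L2_inner (\<lambda>\<zeta>. 1) (\<lambda>\<zeta>. \<zeta> * u \<zeta>)"
    unfolding L2_inner_diff_left[OF H2_L2[OF g] L2_cmult[OF L2_const] H2_L2[OF zu]] L2_inner_cmult_left ..
  also have "L2_inner (\<lambda>\<zeta>. 1) (\<lambda>\<zeta>. \<zeta> * u \<zeta>) = cnj (fourier_coeff (\<lambda>\<zeta>. \<zeta> * u \<zeta>) 0)"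
    by (subst L2_inner_commute) (simp add: fourier_coeff_eq_inner)
  also have "\<dots> = 0" using H2_neg_coeff[OF u] by (simp add: fourier_coeff_id_mult)
  finally show ?thesis by simp
qed

text \<open>
  Moving the shifts to the other side, where they commute past \<open>\<phi>\<close>, leaves the inner product of \<open>\<phi>\<close> with
  \<open>\<phi> * \<zeta> * h\<close>; cancelling the unimodular \<open>\<phi>\<close>, this is the mean of a function without constant term.
\<close>

lemma backward_shift_inner_orthogonal:
  assumes \<phi>: "\<phi> \<in> Hinf" and uni: "AE \<zeta> in circle_measure. cmod (\<phi> \<zeta>) = 1" and h: "h \<in> H2"
  shows "L2_inner ((backward_shift ^^ Suc j) \<phi>) (\<lambda>\<zeta>. \<phi> \<zeta> * h \<zeta>) = 0"
  using h
proof (induction j arbitrary: h)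
  case 0
  have zh: "(\<lambda>\<zeta>. \<zeta> * h \<zeta>) \<in> H2" by (rule H2_id_mult[OF 0])
  have "L2_inner (backward_shift \<phi>) (\<lambda>\<zeta>. \<phi> \<zeta> * h \<zeta>) = L2_inner \<phi> (\<lambda>\<zeta>. \<zeta> * (\<phi> \<zeta> * h \<zeta>))"
    by (rule L2_inner_backward_shift[OF Hinf_H2[OF \<phi>] Hinf_mult_H2[OF \<phi> 0]])
  also have "\<dots> = L2_inner (\<lambda>\<zeta>. \<phi> \<zeta> * 1) (\<lambda>\<zeta>. \<phi> \<zeta> * (\<zeta> * h \<zeta>))"
    by (simp add: mult_ac)
  also have "\<dots> = L2_inner (\<lambda>\<zeta>. 1) (\<lambda>\<zeta>. \<zeta> * h \<zeta>)"
    by (rule L2_inner_unimodular_mult[OF L2_measurable[OF H2_L2[OF Hinf_H2[OF \<phi>]]] uni L2_const H2_L2[OF zh]])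
  also have "\<dots> = cnj (fourier_coeff (\<lambda>\<zeta>. \<zeta> * h \<zeta>) 0)"
    by (subst L2_inner_commute) (simp add: fourier_coeff_eq_inner)
  also have "\<dots> = 0" using H2_neg_coeff[OF 0] by (simp add: fourier_coeff_id_mult)
  finally show ?case by simp
next
  case (Suc j)
  let ?g = "(backward_shift ^^ Suc j) \<phi>"
  have g: "?g \<in> H2"
    by (induction j) (auto intro!: backward_shift_H2 Hinf_H2[OF \<phi>])
  have "L2_inner (backward_shift ?g) (\<lambda>\<zeta>. \<phi> \<zeta> * h \<zeta>) = L2_inner ?g (\<lambda>\<zeta>. \<zeta> * (\<phi> \<zeta> * h \<zeta>))"
    by (rule L2_inner_backward_shift[OF g Hinf_mult_H2[OF \<phi> Suc.prems]])
  also have "\<dots> = L2_inner ?g (\<lambda>\<zeta>. \<phi> \<zeta> * (\<zeta> * h \<zeta>))"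
    by (simp add: mult_ac)
  also have "\<dots> = 0" by (rule Suc.IH[OF H2_id_mult[OF Suc.prems]])
  finally show ?case by simp
qed

lemma backward_shift_power_H2: "g \<in> H2 \<Longrightarrow> (backward_shift ^^ j) g \<in> H2"
  by (induction j) (auto intro: backward_shift_H2)

lemma backward_shift_power_eq:
  "\<exists>r. \<forall>\<zeta>. cmod \<zeta> = 1 \<longrightarrow> \<zeta> ^ j * (backward_shift ^^ j) g \<zeta> = g \<zeta> - poly r \<zeta>"
proof (induction j)
  case 0
  show ?case by (intro exI[of _ 0]) simp
next
  case (Suc j)
  then obtain r where r: "\<And>\<zeta>. cmod \<zeta> = 1 \<Longrightarrow> \<zeta> ^ j * (backward_shift ^^ j) g \<zeta> = g \<zeta> - poly r \<zeta>" by blast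
  let ?h = "(backward_shift ^^ j) g"
  have "\<zeta> ^ Suc j * (backward_shift ^^ Suc j) g \<zeta> = g \<zeta> - poly (r + monom (fourier_coeff ?h 0) j) \<zeta>"
    if z: "cmod \<zeta> = 1" for \<zeta>
  proof -
    have "\<zeta> ^ Suc j * (backward_shift ^^ Suc j) g \<zeta> = \<zeta> ^ j * (\<zeta> * backward_shift ?h \<zeta>)"
      by (simp add: mult_ac)
    also have "\<dots> = \<zeta> ^ j * ?h \<zeta> - fourier_coeff ?h 0 * \<zeta> ^ j"
      unfolding backward_shift_eq[OF z] by (simp add: algebra_simps)
    finally show ?thesis unfolding r[OF z] by (simp add: poly_monom)
  qed
  then show ?case by blast
qed

text \<open>
  A vector orthogonal to \<open>\<phi> H2\<close> and to the \<open>m\<close> generators is orthogonal to the whole frame, hence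
  zero.  Being orthogonal to the generators is \<open>m\<close> linear conditions, so some nontrivial combination of
  \<open>m + 1\<close> backward shifts of \<open>\<phi>\<close> meets them and vanishes.  Multiplied by \<open>\<zeta> ^ (m + 1)\<close>, this relation says
  that \<open>\<phi>\<close> is a quotient of polynomials.
\<close>

lemma orbit_frame_rational:
  fixes m :: nat and f :: "nat \<Rightarrow> complex \<Rightarrow> complex"
  assumes \<phi>: "\<phi> \<in> Hinf" and uni: "AE \<zeta> in circle_measure. cmod (\<phi> \<zeta>) = 1" and A: "A > 0"
    and fr: "frame_bounds_H2 A B ({1..m} \<times> (UNIV :: nat set)) (\<lambda>(i, n) \<zeta>. \<phi> \<zeta> ^ n * f i \<zeta>)"
  obtains p q where "q \<noteq> 0" "AE \<zeta> in circle_measure. poly q \<zeta> * \<phi> \<zeta> = poly p \<zeta>"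
proof -
  define g where "g j = (backward_shift ^^ j) \<phi>" for j
  have gH: "g j \<in> H2" for j
    unfolding g_def by (rule backward_shift_power_H2[OF Hinf_H2[OF \<phi>]])
  let ?J = "{1..Suc m}"
  obtain c where c0: "\<exists>j\<in>?J. c j \<noteq> 0" and c: "\<And>i. i \<in> {1..m} \<Longrightarrow> (\<Sum>j\<in>?J. c j * L2_inner (g j) (f i)) = 0"
  proof -
    have "card {1..m} < card ?J" by simp
    from exists_nontrivial_relation[OF _ _ this, of "\<lambda>j i. L2_inner (g j) (f i)"] that
    show thesis by blast
  qed
  define y where "y = (\<lambda>\<zeta>. \<Sum>j\<in>?J. c j * g j \<zeta>)"
  have y: "y \<in> H2" unfolding y_def by (intro H2_sum H2_cmult gH)
  have xH: "(\<lambda>\<zeta>. \<phi> \<zeta> ^ n * f i \<zeta>) \<in> H2" if "i \<in> {1..m}" for i n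
    using fr that by (auto simp: frame_bounds_H2_def)
  have yx: "L2_inner y (\<lambda>\<zeta>. \<phi> \<zeta> ^ n * f i \<zeta>) = 0" if i: "i \<in> {1..m}" for i n
  proof -
    have "L2_inner y (\<lambda>\<zeta>. \<phi> \<zeta> ^ n * f i \<zeta>) = (\<Sum>j\<in>?J. c j * L2_inner (g j) (\<lambda>\<zeta>. \<phi> \<zeta> ^ n * f i \<zeta>))"
      unfolding y_def by (intro L2_inner_lincomb_left H2_L2 gH xH i)
    also have "\<dots> = 0"
    proof (cases n)
      case 0
      then show ?thesis using c[OF i] by simp
    next
      case (Suc k)
      have "L2_inner (g j) (\<lambda>\<zeta>. \<phi> \<zeta> ^ n * f i \<zeta>) = 0" if "j \<in> ?J" for j
        using that backward_shift_inner_orthogonal[OF \<phi> uni xH[OF i, of k], of "j - 1"]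
        by (simp add: Suc g_def mult.assoc)
      then show ?thesis by simp
    qed
    finally show ?thesis .
  qed
  have "(\<Sum>\<^sub>\<infinity>j\<in>{1..m} \<times> (UNIV :: nat set).
      (cmod (L2_inner y (case j of (i, n) \<Rightarrow> \<lambda>\<zeta>. \<phi> \<zeta> ^ n * f i \<zeta>)))\<^sup>2) = 0"
    by (rule infsum_0) (use yx in auto)
  then have "A * (L2_norm y)\<^sup>2 \<le> 0"
    using fr y unfolding frame_bounds_H2_def by (metis (no_types, lifting))
  then have "L2_norm y = 0" using A by (simp add: mult_le_0_iff)
  then have y0: "AE \<zeta> in circle_measure. y \<zeta> = 0" by (rule L2_norm_eq_0_AE[OF H2_L2[OF y]])
  have "\<forall>j. \<exists>r. \<forall>\<zeta>. cmod \<zeta> = 1 \<longrightarrow> \<zeta> ^ j * g j \<zeta> = \<phi> \<zeta> - poly r \<zeta>"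
    unfolding g_def by (intro allI backward_shift_power_eq)
  from choice[OF this] obtain r where
    r: "\<And>j \<zeta>. cmod \<zeta> = 1 \<Longrightarrow> \<zeta> ^ j * g j \<zeta> = \<phi> \<zeta> - poly (r j) \<zeta>" by blast
  define q where "q = (\<Sum>j\<in>?J. monom (c j) (Suc m - j))"
  define p where "p = (\<Sum>j\<in>?J. monom (c j) (Suc m - j) * r j)"
  obtain l where l: "l \<in> ?J" "c l \<noteq> 0" using c0 by blast
  have "coeff q (Suc m - l) = (\<Sum>j\<in>?J. if j = l then c l else 0)"
    unfolding q_def coeff_sum coeff_monom using l by (intro sum.cong) auto
  also have "\<dots> = c l" using l by simp
  finally have "q \<noteq> 0" using l by auto
  moreover have "AE \<zeta> in circle_measure. poly q \<zeta> * \<phi> \<zeta> = poly p \<zeta>"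
  proof -
    have "AE \<zeta> in circle_measure. cmod \<zeta> = 1" by (rule AE_circle)
    with y0 show ?thesis
    proof eventually_elim
      case (elim \<zeta>)
      have "0 = (\<Sum>j\<in>?J. \<zeta> ^ Suc m * (c j * g j \<zeta>))"
        using elim(1) by (simp add: y_def flip: sum_distrib_left)
      also have "\<dots> = (\<Sum>j\<in>?J. c j * \<zeta> ^ (Suc m - j) * (\<phi> \<zeta> - poly (r j) \<zeta>))"
      proof (rule sum.cong[OF refl])
        fix j assume "j \<in> ?J"
        then have "\<zeta> ^ Suc m = \<zeta> ^ (Suc m - j) * \<zeta> ^ j" by (simp flip: power_add)
        then show "\<zeta> ^ Suc m * (c j * g j \<zeta>) = c j * \<zeta> ^ (Suc m - j) * (\<phi> \<zeta> - poly (r j) \<zeta>)"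
          unfolding r[OF elim(2), symmetric] by (simp add: mult_ac)
      qed
      also have "\<dots> = poly q \<zeta> * \<phi> \<zeta> - poly p \<zeta>"
        by (simp only: q_def p_def poly_sum poly_mult poly_monom sum_distrib_right right_diff_distrib
            sum_subtractf)
      finally show ?case by simp
    qed
  qed
  ultimately show thesis by (rule that)
qed

section \<open>Rational inner functions\<close>

text \<open>Otherwise the exceptional null set would contain an arc, and arcs have positive measure.\<close>

lemma AE_circle_imp_everywhere:
  fixes f :: "complex \<Rightarrow> real"
  assumes cont: "continuous_on UNIV f" and ae: "AE \<zeta> in circle_measure. f \<zeta> = 0" and z: "cmod z = 1"
  shows "f z = 0"
proof (rule ccontr)
  assume nz: "f z \<noteq> 0"
  have "AE x in uniform_measure lborel {0..<2*pi}. f (cis x) = 0"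
    using ae unfolding circle_measure_def by (rule AE_distrD[rotated]) simp
  then have "AE x in lborel. x \<in> {0..<2*pi} \<longrightarrow> f (cis x) = 0"
    by (subst (asm) AE_uniform_measure) auto
  then obtain N where N: "N \<in> null_sets lborel" "{x. \<not> (x \<in> {0..<2*pi} \<longrightarrow> f (cis x) = 0)} \<subseteq> N"
    by (auto elim!: AE_E simp: null_sets_def)
  obtain x0 where x0: "0 \<le> x0" "x0 < 2 * pi" "z = cis x0"
  proof -
    have "z = cis (Arg2pi z)" using Arg2pi_eq[of z] z by (simp add: cis_conv_exp)
    then show thesis using that[of "Arg2pi z"] Arg2pi_ge_0 Arg2pi_lt_2pi by blast
  qed
  have "continuous_on UNIV (\<lambda>x. f (cis x))"
    by (rule continuous_on_compose2[OF cont]) (auto intro!: continuous_intros)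
  then have "isCont (\<lambda>x. f (cis x)) x0" by (simp add: continuous_on_eq_continuous_at)
  from continuous_at_avoid[OF this, of 0] nz x0
  obtain e where e: "e > 0" "\<And>x. dist x0 x < e \<Longrightarrow> f (cis x) \<noteq> 0" by auto
  define b where "b = min (x0 + e) (2 * pi)"
  have b: "x0 < b" using e x0 by (simp add: b_def)
  have "{x0<..<b} \<subseteq> N"
    using N(2) e(2) x0 by (auto simp: b_def dist_real_def subset_iff)
  then have "emeasure lborel {x0<..<b} \<le> emeasure lborel N"
    using N(1) by (intro emeasure_mono) auto
  then show False using N(1) b by (auto simp: null_sets_def)
qed

lemma AE_circle_neq: "AE \<zeta> in circle_measure. \<zeta> \<noteq> (a::complex)"
proof -
  have "AE x in lborel. x \<in> {0..<2*pi} \<longrightarrow> cis x \<noteq> a"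
  proof (rule eventually_mono[OF AE_lborel_singleton[of "Arg2pi a"]])
    fix x :: real assume ne: "x \<noteq> Arg2pi a"
    have "x = Arg2pi a" if "0 \<le> x" "x < 2 * pi" "cis x = a"
      using Arg2pi_unique[of 1 x a] that by (simp add: cis_conv_exp)
    with ne show "x \<in> {0..<2*pi} \<longrightarrow> cis x \<noteq> a" by auto
  qed
  then have "AE x in uniform_measure lborel {0..<2*pi}. cis x \<noteq> a"
    by (subst AE_uniform_measure) auto
  moreover have "{\<zeta> \<in> space (restrict_space borel (sphere 0 1)). \<zeta> \<noteq> a} \<in>
      sets (restrict_space borel (sphere 0 1))"
    by measurable
  ultimately show ?thesis
    unfolding circle_measure_def by (subst AE_distr_iff) auto
qed

lemma unimodular_zero_free_constant:
  assumes cont: "continuous_on (cball 0 1) f" and hol: "f holomorphic_on ball 0 1"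
    and nz: "\<And>z. cmod z \<le> 1 \<Longrightarrow> f z \<noteq> 0" and uni: "\<And>z. cmod z = 1 \<Longrightarrow> cmod (f z) = 1"
  obtains c where "cmod c = 1" "\<And>z. cmod z \<le> 1 \<Longrightarrow> f z = c"
proof -
  have bound: "cmod (g \<xi>) \<le> 1"
    if "continuous_on (cball 0 1) g" "g holomorphic_on ball 0 1" "\<And>z. cmod z = 1 \<Longrightarrow> cmod (g z) = 1" "cmod \<xi> < 1" for g \<xi>
    by (rule maximum_modulus_frontier[where S="ball 0 1" and f=g]) (use that in \<open>auto simp: dist_norm\<close>)
  have one: "cmod (f z) = 1" if z: "cmod z < 1" for z
  proof (rule antisym)
    show "cmod (f z) \<le> 1" by (rule bound[OF cont hol uni z])
    have "cmod (inverse (f z)) \<le> 1"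
      by (rule bound[where g="\<lambda>z. inverse (f z)"])
        (use cont hol nz uni z in \<open>auto intro!: continuous_intros holomorphic_intros simp: norm_inverse\<close>)
    then show "1 \<le> cmod (f z)"
      using nz[of z] z by (simp add: norm_inverse inverse_le_1_iff split: if_splits)
  qed
  have "f constant_on ball 0 1"
    by (rule maximum_modulus_principle[OF hol, of "ball 0 1" 0]) (use one in auto)
  then obtain c where c: "\<And>z. z \<in> ball 0 1 \<Longrightarrow> f z = c" unfolding constant_on_def by blast
  have "f z = c" if "cmod z \<le> 1" for z
    by (rule continuous_constant_on_closure[of "ball 0 1" f c]) (use cont c that in auto)
  moreover have "cmod c = 1" using one[of 0] c[of 0] by simp
  ultimately show thesis by (rule that[rotated])
qed

lemma poly_disc_factorization:
  fixes p :: "complex poly"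
  assumes "p \<noteq> 0"
  shows "\<exists>(d::nat) a p0. (\<forall>j\<in>{1..d}. cmod (a j) < 1) \<and> p = (\<Prod>j=1..d. [:- a j, 1:]) * p0 \<and>
    (\<forall>z. cmod z < 1 \<longrightarrow> poly p0 z \<noteq> 0)"
  using assms
proof (induction "degree p" arbitrary: p rule: less_induct)
  case less
  show ?case
  proof (cases "\<exists>z. cmod z < 1 \<and> poly p z = 0")
    case False
    then show ?thesis
      by (intro exI[of _ 0] exI[of _ "\<lambda>_. 0"] exI[of _ p]) auto
  next
    case True
    then obtain z where z: "cmod z < 1" "poly p z = 0" by blast
    then obtain p' where p': "p = [:- z, 1:] * p'"
      unfolding poly_eq_0_iff_dvd by (elim dvdE)
    with less.prems have p0: "p' \<noteq> 0" by auto
    then have "degree p' < degree p" unfolding p' by (subst degree_mult_eq) auto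
    from less.hyps[OF this p0] obtain d a q where q: "\<forall>j\<in>{1..d::nat}. cmod (a j) < 1"
      "p' = (\<Prod>j=1..d. [:- a j, 1:]) * q" "\<forall>z. cmod z < 1 \<longrightarrow> poly q z \<noteq> 0" by blast
    define b where "b = a(Suc d := z)"
    have "(\<Prod>j=1..d. [:- b j, 1:]) = (\<Prod>j=1..d. [:- a j, 1:])"
      by (intro prod.cong) (auto simp: b_def)
    then have "p = (\<Prod>j=1..Suc d. [:- b j, 1:]) * q"
      unfolding p' q(2) by (simp add: b_def mult_ac)
    moreover have "\<forall>j\<in>{1..Suc d}. cmod (b j) < 1"
      using q(1) z(1) by (auto simp: b_def)
    ultimately show ?thesis using q(3) by blast
  qed
qed

text \<open>
  Take the denominator \<open>q\<close> of least degree.  A zero of \<open>q\<close> in the closed disc would be a zero of \<open>p\<close>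
  as well -- inside because \<open>q \<phi>\<close> evaluates to zero there, on the circle because
  \<open>\<bar>p\<bar> = \<bar>q\<bar>\<close> -- and could be cancelled.
\<close>

lemma rational_inner_denominator:
  assumes \<phi>: "\<phi> \<in> Hinf" and uni: "AE \<zeta> in circle_measure. cmod (\<phi> \<zeta>) = 1"
    and "q0 \<noteq> 0" "AE \<zeta> in circle_measure. poly q0 \<zeta> * \<phi> \<zeta> = poly p0 \<zeta>"
  obtains p q where "AE \<zeta> in circle_measure. poly q \<zeta> * \<phi> \<zeta> = poly p \<zeta>"
    "\<And>z. cmod z \<le> 1 \<Longrightarrow> poly q z \<noteq> 0" "\<And>z. cmod z = 1 \<Longrightarrow> cmod (poly p z) = cmod (poly q z)"
proof -
  define P where "P q \<longleftrightarrow> q \<noteq> 0 \<and> (\<exists>p. AE \<zeta> in circle_measure. poly q \<zeta> * \<phi> \<zeta> = poly p \<zeta>)" for q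
  have "P q0" using assms unfolding P_def by blast
  then obtain q where Pq: "P q" and min: "\<And>r. P r \<Longrightarrow> degree q \<le> degree r"
    using ex_has_least_nat[of P q0 degree] by blast
  from Pq obtain p where q0: "q \<noteq> 0" and qp: "AE \<zeta> in circle_measure. poly q \<zeta> * \<phi> \<zeta> = poly p \<zeta>"
    unfolding P_def by blast
  have eq: "cmod (poly p z) = cmod (poly q z)" if z: "cmod z = 1" for z
  proof -
    have "cmod (poly p z) - cmod (poly q z) = 0"
    proof (rule AE_circle_imp_everywhere[OF _ _ z])
      show "AE \<zeta> in circle_measure. cmod (poly p \<zeta>) - cmod (poly q \<zeta>) = 0"
        using qp uni
      proof eventually_elim
        case (elim \<zeta>)
        then show ?case unfolding elim(1)[symmetric] by (simp add: norm_mult)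
      qed
    qed (auto intro!: continuous_intros)
    then show ?thesis by simp
  qed
  have "poly q z \<noteq> 0" if z: "cmod z \<le> 1" for z
  proof
    assume qz: "poly q z = 0"
    then obtain q' where q': "q = [:- z, 1:] * q'"
      unfolding poly_eq_0_iff_dvd by (elim dvdE)
    have "poly p z = 0"
    proof (cases "cmod z = 1")
      case True
      then show ?thesis using eq[OF True] qz by simp
    next
      case False
      then have z1: "cmod z < 1" using z by simp
      have g: "(\<lambda>\<zeta>. poly q' \<zeta> * \<phi> \<zeta>) \<in> H2" by (rule H2_poly_mult[OF Hinf_H2[OF \<phi>]])
      have g': "(\<lambda>\<zeta>. (\<zeta> - z) * (poly q' \<zeta> * \<phi> \<zeta>)) \<in> L2_circle"
        using H2_L2[OF H2_poly_mult[OF g, of "[:- z, 1:]"]] by simp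
      have "poly p z = L2_inner (poly p) (szego z)"
        by (rule L2_inner_poly_szego[OF z1, symmetric])
      also have "\<dots> = L2_inner (\<lambda>\<zeta>. (\<zeta> - z) * (poly q' \<zeta> * \<phi> \<zeta>)) (szego z)"
      proof (rule L2_inner_cong_AE)
        show "AE \<zeta> in circle_measure. poly p \<zeta> * cnj (szego z \<zeta>) =
            (\<zeta> - z) * (poly q' \<zeta> * \<phi> \<zeta>) * cnj (szego z \<zeta>)"
          using qp by eventually_elim (simp add: q' algebra_simps)
      qed (use g' szego_L2[OF z1] in auto)
      also have "\<dots> = 0" by (rule szego_annihilates[OF z1 g])
      finally show ?thesis .
    qed
    then obtain p' where p': "p = [:- z, 1:] * p'"
      unfolding poly_eq_0_iff_dvd by (elim dvdE)
    have "AE \<zeta> in circle_measure. poly q' \<zeta> * \<phi> \<zeta> = poly p' \<zeta>"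
      using qp AE_circle_neq[of z]
    proof eventually_elim
      case (elim \<zeta>)
      have "(\<zeta> - z) * (poly q' \<zeta> * \<phi> \<zeta>) = (\<zeta> - z) * poly p' \<zeta>"
        using elim(1) by (simp add: q' p' algebra_simps)
      then show ?case using elim(2) by simp
    qed
    moreover have q'0: "q' \<noteq> 0" using q0 q' by auto
    ultimately have "degree q \<le> degree q'" by (intro min) (auto simp: P_def)
    moreover have "degree q = Suc (degree q')"
      unfolding q' using q'0 by (subst degree_mult_eq) auto
    ultimately show False by simp
  qed
  with qp eq show thesis by (intro that)
qed

text \<open>
  Pull the zeros of the numerator inside the disc out as Blaschke factors.  What remains is zero-free
  and unimodular on the circle, hence constant by the maximum principle for it and its inverse.
\<close>

lemma rational_inner_blaschke:
  assumes \<phi>: "\<phi> \<in> Hinf" and uni: "AE \<zeta> in circle_measure. cmod (\<phi> \<zeta>) = 1"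
    and q0: "q0 \<noteq> 0" and qp0: "AE \<zeta> in circle_measure. poly q0 \<zeta> * \<phi> \<zeta> = poly p0 \<zeta>"
  shows "\<exists>(d::nat) c a. cmod c = 1 \<and> (\<forall>j\<in>{1..d}. cmod (a j) < 1) \<and>
    (AE \<zeta> in circle_measure. \<phi> \<zeta> = c * (\<Prod>j=1..d. (\<zeta> - a j) / (1 - cnj (a j) * \<zeta>)))"
proof -
  obtain p q where qp: "AE \<zeta> in circle_measure. poly q \<zeta> * \<phi> \<zeta> = poly p \<zeta>"
    and q: "\<And>z. cmod z \<le> 1 \<Longrightarrow> poly q z \<noteq> 0"
    and eq: "\<And>z. cmod z = 1 \<Longrightarrow> cmod (poly p z) = cmod (poly q z)"
    by (rule rational_inner_denominator[OF \<phi> uni q0 qp0]) (rule that)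
  have "poly p 1 \<noteq> 0" using eq[of 1] q[of 1] by auto
  then have "p \<noteq> 0" by auto
  from poly_disc_factorization[OF this] obtain d a r where a: "\<And>j. j \<in> {1..d::nat} \<Longrightarrow> cmod (a j) < 1"
    and p: "p = (\<Prod>j=1..d. [:- a j, 1:]) * r" and r: "\<And>z. cmod z < 1 \<Longrightarrow> poly r z \<noteq> 0" by blast
  define G where "G z = (\<Prod>j=1..d. 1 - cnj (a j) * z) * poly r z / poly q z" for z
  define D where "D z = (\<Prod>j=1..d. (z - a j) / (1 - cnj (a j) * z))" for z
  have nz: "1 - cnj (a j) * z \<noteq> 0" if "j \<in> {1..d}" "cmod z \<le> 1" for j z
    by (rule szego_denom_nonzero[OF a[OF that(1)] that(2)])
  have pq: "poly p z / poly q z = D z * G z" if z: "cmod z \<le> 1" for z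
  proof -
    have "(\<Prod>j=1..d. 1 - cnj (a j) * z) \<noteq> 0" using nz z by simp
    then show ?thesis
      by (simp add: p D_def G_def poly_prod prod_dividef mult_ac)
  qed
  have D1: "cmod (D z) = 1" if z: "cmod z = 1" for z
    unfolding D_def prod_norm[symmetric]
    by (rule prod.neutral) (use cmod_blaschke_factor[OF a z] in \<open>simp add: blaschke_factor_def\<close>)
  have G1: "cmod (G z) = 1" if z: "cmod z = 1" for z
  proof -
    have "cmod (D z * G z) = 1"
      using pq[of z] eq[OF z] q[of z] z by (simp add: norm_divide flip: pq)
    then show ?thesis using D1[OF z] by (simp add: norm_mult)
  qed
  obtain c where c: "cmod c = 1" "\<And>z. cmod z \<le> 1 \<Longrightarrow> G z = c"
  proof (rule unimodular_zero_free_constant)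
    show "continuous_on (cball 0 1) G"
      unfolding G_def by (intro continuous_intros) (use q in auto)
    show "G holomorphic_on ball 0 1"
      unfolding G_def by (intro holomorphic_intros) (use q in auto)
    show "G z \<noteq> 0" if z: "cmod z \<le> 1" for z
    proof (cases "cmod z = 1")
      case True
      then show ?thesis using G1[OF True] by auto
    next
      case False
      then show ?thesis using r[of z] q[OF z] nz z by (simp add: G_def)
    qed
  qed (use G1 in auto)
  have "AE \<zeta> in circle_measure. cmod \<zeta> = 1" by (rule AE_circle)
  with qp have "AE \<zeta> in circle_measure. \<phi> \<zeta> = c * D \<zeta>"
  proof eventually_elim
    case (elim \<zeta>)
    have "\<phi> \<zeta> = poly p \<zeta> / poly q \<zeta>" using elim q[of \<zeta>] by (simp add: field_simps flip: elim(1))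
    then show ?case using pq[of \<zeta>] c(2)[of \<zeta>] elim(2) by simp
  qed
  with c(1) a show ?thesis unfolding D_def by blast
qed

text \<open>
  If \<open>\<phi>\<close> were a unimodular constant, each orbit would repeat one vector up to a phase, and the upper
  frame bound would force it to be orthogonal to the constant function 1.
\<close>

lemma orbit_frame_not_constant:
  fixes m :: nat and f :: "nat \<Rightarrow> complex \<Rightarrow> complex"
  assumes \<phi>: "\<phi> \<in> Hinf" and A: "A > 0"
    and fr: "frame_bounds_H2 A B ({1..m} \<times> (UNIV :: nat set)) (\<lambda>(i, n) \<zeta>. \<phi> \<zeta> ^ n * f i \<zeta>)"
    and c: "cmod c = 1" and ae: "AE \<zeta> in circle_measure. \<phi> \<zeta> = c"
  shows False
proof -
  let ?x = "\<lambda>(i, n) \<zeta>. \<phi> \<zeta> ^ n * f i \<zeta>"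
  have xH: "(\<lambda>\<zeta>. \<phi> \<zeta> ^ n * f i \<zeta>) \<in> H2" if "i \<in> {1..m}" for i n
    using fr that by (auto simp: frame_bounds_H2_def)
  have fH: "f i \<in> H2" if "i \<in> {1..m}" for i
    using xH[OF that, of 0] by simp
  have same: "cmod (L2_inner (\<lambda>_. 1) (\<lambda>\<zeta>. \<phi> \<zeta> ^ n * f i \<zeta>)) = cmod (L2_inner (\<lambda>_. 1) (f i))"
    if i: "i \<in> {1..m}" for i n
  proof -
    have "L2_inner (\<lambda>_. 1) (\<lambda>\<zeta>. \<phi> \<zeta> ^ n * f i \<zeta>) = L2_inner (\<lambda>_. 1) (\<lambda>\<zeta>. c ^ n * f i \<zeta>)"
      by (rule L2_inner_cong_AE)
        (use ae xH[OF i] fH[OF i] in \<open>auto intro: H2_L2 L2_cmult elim: eventually_mono\<close>)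
    then show ?thesis by (simp add: L2_inner_cmult_right norm_mult norm_power c)
  qed
  have zero: "L2_inner (\<lambda>_. 1) (f i) = 0" if i: "i \<in> {1..m}" for i
  proof (rule ccontr)
    assume "L2_inner (\<lambda>_. 1) (f i) \<noteq> 0"
    then have pos: "(cmod (L2_inner (\<lambda>_. 1) (f i)))\<^sup>2 > 0" by simp
    obtain N where N: "B < real N * (cmod (L2_inner (\<lambda>_. 1) (f i)))\<^sup>2"
      using reals_Archimedean3[OF pos] by blast
    have "(\<Sum>j\<in>{i} \<times> {..<N}. (cmod (L2_inner (\<lambda>_. 1) (?x j)))\<^sup>2) \<le> B * (L2_norm (\<lambda>_. 1))\<^sup>2"
      by (rule frame_finite_sum_le[OF fr]) (use i in auto)
    moreover have "(\<Sum>j\<in>{i} \<times> {..<N}. (cmod (L2_inner (\<lambda>_. 1) (?x j)))\<^sup>2) =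
        (\<Sum>j\<in>{i} \<times> {..<N}. (cmod (L2_inner (\<lambda>_. 1) (f i)))\<^sup>2)"
      by (rule sum.cong) (use same[OF i] in auto)
    ultimately show False using N by simp
  qed
  have "(\<Sum>\<^sub>\<infinity>j\<in>{1..m} \<times> (UNIV :: nat set). (cmod (L2_inner (\<lambda>_. 1) (?x j)))\<^sup>2) = 0"
    by (rule infsum_0) (use same zero in auto)
  moreover have "A * (L2_norm (\<lambda>_. 1))\<^sup>2 \<le>
      (\<Sum>\<^sub>\<infinity>j\<in>{1..m} \<times> (UNIV :: nat set). (cmod (L2_inner (\<lambda>_. 1) (?x j)))\<^sup>2)"
    using fr H2_const[of 1] unfolding frame_bounds_H2_def by blast
  ultimately show False using A by simp
qed

lemma orbit_frame_imp_blaschke: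
  fixes m :: nat and f :: "nat \<Rightarrow> complex \<Rightarrow> complex"
  assumes \<phi>: "\<phi> \<in> Hinf"
    and frame: "frame_H2 ({1..m} \<times> (UNIV :: nat set)) (\<lambda>(i, n). (mult_op \<phi> ^^ n) (f i))"
  shows "finite_blaschke_product \<phi>"
proof -
  obtain A B where A: "A > 0" and B: "B > 0"
    and fr: "frame_bounds_H2 A B ({1..m} \<times> (UNIV :: nat set)) (\<lambda>(i, n) \<zeta>. \<phi> \<zeta> ^ n * f i \<zeta>)"
    using frame unfolding frame_H2_def mult_op_power by blast
  have uni: "AE \<zeta> in circle_measure. cmod (\<phi> \<zeta>) = 1"
    by (rule orbit_frame_unimodular[OF \<phi> A B fr])
  obtain p q where "q \<noteq> 0" "AE \<zeta> in circle_measure. poly q \<zeta> * \<phi> \<zeta> = poly p \<zeta>"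
    by (rule orbit_frame_rational[OF \<phi> uni A fr]) (rule that)
  from rational_inner_blaschke[OF \<phi> uni this] obtain d :: nat and c a where c: "cmod c = 1"
    and a: "\<forall>j\<in>{1..d}. cmod (a j) < 1"
    and ae: "AE \<zeta> in circle_measure. \<phi> \<zeta> = c * (\<Prod>j=1..d. (\<zeta> - a j) / (1 - cnj (a j) * \<zeta>))" by blast
  have "d \<noteq> 0"
    using orbit_frame_not_constant[OF \<phi> A fr c] ae by (cases "d = 0") auto
  with c a ae show ?thesis
    unfolding finite_blaschke_product_def by (intro exI[of _ d] exI[of _ c] exI[of _ a]) auto
qed

section \<open>The equivalence\<close>

theorem theorem2p6:
  fixes \<phi> :: "complex \<Rightarrow> complex"
  assumes "\<phi> \<in> Hinf"
  defines "i \<equiv> finite_blaschke_product \<phi>"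
    and "ii \<equiv> (\<exists>(m::nat) f. (\<forall>i\<in>{1..m}. f i \<in> H2) \<and>
      orthonormal_basis_H2 ({1..m} \<times> (UNIV :: nat set)) (\<lambda>(i, n). (mult_op \<phi> ^^ n) (f i)))"
    and "iii \<equiv> (\<exists>(m::nat) f. (\<forall>i\<in>{1..m}. f i \<in> H2) \<and>
      parseval_frame_H2 ({1..m} \<times> (UNIV :: nat set)) (\<lambda>(i, n). (mult_op \<phi> ^^ n) (f i)))"
    and "iv \<equiv> (\<exists>(m::nat) f. (\<forall>i\<in>{1..m}. f i \<in> H2) \<and>
      frame_H2 ({1..m} \<times> (UNIV :: nat set)) (\<lambda>(i, n). (mult_op \<phi> ^^ n) (f i)))"
  shows "(i \<longleftrightarrow> ii) \<and> (ii \<longleftrightarrow> iii) \<and> (iii \<longleftrightarrow> iv)"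
proof -
  have "ii" if "i"
  proof -
    have "finite_blaschke_product \<phi>" using that unfolding i_def .
    then obtain d :: nat and f where f: "\<And>i. i \<in> {1..d} \<Longrightarrow> f i \<in> H2"
      and on: "orthonormal_basis_H2 ({1..d} \<times> (UNIV :: nat set)) (\<lambda>(i, n). (mult_op \<phi> ^^ n) (f i))"
      by (rule finite_blaschke_product_orbits[OF assms(1)]) (rule that)
    show ?thesis
      unfolding ii_def using f by (intro exI[of _ d] exI[of _ f] conjI ballI on)
  qed
  moreover have "iii" if "ii"
  proof -
    obtain m :: nat and f where f: "\<forall>i\<in>{1..m}. f i \<in> H2"
      and on: "orthonormal_basis_H2 ({1..m} \<times> (UNIV :: nat set)) (\<lambda>(i, n). (mult_op \<phi> ^^ n) (f i))"
      using \<open>ii\<close> unfolding ii_def by blast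
    have "countable ({1..m} \<times> (UNIV :: nat set))" by (intro countable_SIGMA) auto
    from orthonormal_basis_imp_parseval_frame[OF on this] show ?thesis
      unfolding iii_def by (intro exI[of _ m] exI[of _ f] conjI f)
  qed
  moreover have "iv" if "iii"
  proof -
    obtain m :: nat and f where f: "\<forall>i\<in>{1..m}. f i \<in> H2"
      and pf: "parseval_frame_H2 ({1..m} \<times> (UNIV :: nat set)) (\<lambda>(i, n). (mult_op \<phi> ^^ n) (f i))"
      using \<open>iii\<close> unfolding iii_def by blast
    from pf have "frame_H2 ({1..m} \<times> (UNIV :: nat set)) (\<lambda>(i, n). (mult_op \<phi> ^^ n) (f i))"
      unfolding parseval_frame_H2_def frame_H2_def by (intro exI[of _ 1] conjI zero_less_one)
    then show ?thesis
      unfolding iv_def by (intro exI[of _ m] exI[of _ f] conjI f)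
  qed
  moreover have "i" if "iv"
  proof -
    obtain m :: nat and f
      where "frame_H2 ({1..m} \<times> (UNIV :: nat set)) (\<lambda>(i, n). (mult_op \<phi> ^^ n) (f i))"
      using \<open>iv\<close> unfolding iv_def by blast
    from orbit_frame_imp_blaschke[OF assms(1) this] show ?thesis unfolding i_def .
  qed
  ultimately show ?thesis by blast
qed

end
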